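(* Let $G$ be an arbitrary group, let $k$ be a commutative ring with identity, and let $V$ be a $\mathcal{C}$-module over $k$ presented in finite degrees, where $\mathcal{C}$ is the skeletal full subcategory of $FI_G$ with objects $[n]$, $n\geqslant 0$. Then $\Sigma_n V$ is a filtered module for all $n\gg 0$.
   Context: For a group $G$, $FI_G$ is the category whose objects are finite sets and whose morphisms $S\to T$ are pairs $(f,g)$ with $f:S\to T$ an injection and $g:S\to G$ a function; composition is $(f_1,g_1)\circ(f_2,g_2)=(f_1\circ f_2,h)$ with $h(x)=g_1(f_2(x))\,g_2(x)$. $\mathcal{C}$ is the full subcategory on the objects $[n]=\{1,\dots,n\}$, $n\geqslant 0$ (with $[0]=\emptyset$), and $G_n$ is the endomorphism group of $[n]$. A $\mathcal{C}$-module $V$ (over $k$) is a covariant functor from $\mathcal{C}$ to $k$-modules; $V_n$ is its value on $[n]$. Homological degrees: let $H_0(V)$ be the $\mathcal{C}$-module with $H_0(V)_n = V_n/\sum_{i<n}\sum_{\alpha:[i]\to[n]}\alpha(V_i)$ (this is $V/\mathfrak{m}V$, with $\mathfrak{m}$ the span of the non-invertible morphisms), and let $H_s$ be the $s$-th left derived functor of $H_0$. Put $\mathrm{hd}_s(V)=\sup\{n\mid H_s(V)_n\neq 0\}$ (with $\sup\emptyset=-\infty$) and $\mathrm{gd}(V)=\mathrm{hd}_0(V)$. $V$ is presented in finite degrees if $\mathrm{gd}(V)<\infty$ and $\mathrm{hd}_1(V)<\infty$. Shift functor: let $\iota:\mathcal{C}\to\mathcal{C}$ be the functor $[n]\mapsto[n+1]$,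 $(f,g)\mapsto(\tilde f,\tilde g)$ with $\tilde f(1)=1$, $\tilde f(i+1)=f(i)+1$, $\tilde g(1)=1_G$, $\tilde g(i+1)=g(i)$. The shift functor is $\Sigma V=V\circ\iota$, and $\Sigma_n$ is its $n$-fold iterate. Filtered modules: for a $kG_m$-module $T$, let $M(T)$ be the $\mathcal{C}$-module with $M(T)_n=k\,\mathcal{C}([m],[n])\otimes_{kG_m}T$. A $\mathcal{C}$-module $V$ is filtered if it has a finite chain of submodules $0=V^{-1}\subseteq V^0\subseteq\dots\subseteq V^r=V$ such that each $V^i/V^{i-1}$ is isomorphic to $M(T_i)$ for some $m_i\geqslant 0$ and some $kG_{m_i}$-module $T_i$ (the zero module is filtered). *)

theory Defs
  imports
    "HOL-Algebra.Module"
    "HOL-Algebra.AbelCoset"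
    "HOL-Library.FuncSet"
    "HOL-Library.FSet"
    "HOL-Library.Extended_Real"
begin

section \<open>The category\<close>

text \<open>A morphism \<open>(f, g)\<close> from \<open>[m]\<close> to \<open>[n]\<close>; both components are extensional on \<open>{1..m}\<close>,
  so that equality of morphisms is equality of pairs. Source and target are not recorded in a
  morphism; they are passed as separate arguments where needed.\<close>

type_synonym 'g mor = "(nat \<Rightarrow> nat) \<times> (nat \<Rightarrow> 'g)"

definition mor :: "('g, 'x) monoid_scheme \<Rightarrow> nat \<Rightarrow> nat \<Rightarrow> 'g mor set" where
  "mor G m n = {(f, g). f \<in> {1..m} \<rightarrow>\<^sub>E {1..n} \<and> inj_on f {1..m} \<and> g \<in> {1..m} \<rightarrow>\<^sub>E carrier G}"

definition mor_id :: "('g, 'x) monoid_scheme \<Rightarrow> nat \<Rightarrow> 'g mor" where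
  "mor_id G m = (\<lambda>i\<in>{1..m}. i, \<lambda>i\<in>{1..m}. \<one>\<^bsub>G\<^esub>)"

text \<open>\<open>mor_comp G l \<phi> \<psi>\<close> is \<open>\<phi> \<circ> \<psi>\<close>, where \<open>[l]\<close> is the source of \<open>\<psi>\<close>.\<close>

definition mor_comp :: "('g, 'x) monoid_scheme \<Rightarrow> nat \<Rightarrow> 'g mor \<Rightarrow> 'g mor \<Rightarrow> 'g mor" where
  "mor_comp G l \<phi> \<psi> =
     (\<lambda>i\<in>{1..l}. fst \<phi> (fst \<psi> i), \<lambda>i\<in>{1..l}. snd \<phi> (fst \<psi> i) \<otimes>\<^bsub>G\<^esub> snd \<psi> i)"

definition mor_shift :: "('g, 'x) monoid_scheme \<Rightarrow> nat \<Rightarrow> 'g mor \<Rightarrow> 'g mor" where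
  "mor_shift G m \<phi> =
     (\<lambda>i\<in>{1..Suc m}. if i = 1 then 1 else fst \<phi> (i - 1) + 1,
      \<lambda>i\<in>{1..Suc m}. if i = 1 then \<one>\<^bsub>G\<^esub> else snd \<phi> (i - 1))"


section \<open>Modules over a commutative ring\<close>

definition mod_hom ::
  "('k, 'y) ring_scheme \<Rightarrow> ('k, 'a) module \<Rightarrow> ('k, 'b) module \<Rightarrow> ('a \<Rightarrow> 'b) set" where
  "mod_hom k M N = {f. f \<in> carrier M \<rightarrow> carrier N
     \<and> (\<forall>x\<in>carrier M. \<forall>y\<in>carrier M. f (x \<oplus>\<^bsub>M\<^esub> y) = f x \<oplus>\<^bsub>N\<^esub> f y)
     \<and> (\<forall>a\<in>carrier k. \<forall>x\<in>carrier M. f (a \<odot>\<^bsub>M\<^esub> x) = a \<odot>\<^bsub>N\<^esub> f x)}"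

definition mod_span :: "('k, 'y) ring_scheme \<Rightarrow> ('k, 'a) module \<Rightarrow> 'a set \<Rightarrow> 'a set" where
  "mod_span k M S = \<Inter>{N. submodule N k M \<and> S \<subseteq> N}"

text \<open>The map between sets of cosets induced by \<open>f\<close>, the target being cosets of \<open>N\<close> in \<open>M\<close>.\<close>

definition coset_map :: "('k, 'b) module \<Rightarrow> 'b set \<Rightarrow> ('a \<Rightarrow> 'b) \<Rightarrow> 'a set \<Rightarrow> 'b set" where
  "coset_map M N f X = (\<Union>x\<in>X. N +>\<^bsub>M\<^esub> f x)"

text \<open>The ring multiplication and unit that every \<^typ>\<open>('k, 'a) module\<close> record carries play no
  role for modules and are left unspecified in all constructions below.\<close>

definition mod_quot :: "('k, 'a) module \<Rightarrow> 'a set \<Rightarrow> ('k, 'a set) module" where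
  "mod_quot M N =
     \<lparr>carrier = a_rcosets\<^bsub>M\<^esub> N, mult = undefined, one = undefined, zero = N, add = set_add M,
      smult = (\<lambda>a. coset_map M N (\<lambda>x. a \<odot>\<^bsub>M\<^esub> x))\<rparr>"

text \<open>The free module on a set: finitely supported functions into \<open>k\<close>, zero outside the set.\<close>

definition mod_free :: "('k, 'y) ring_scheme \<Rightarrow> 'b set \<Rightarrow> ('k, 'b \<Rightarrow> 'k) module" where
  "mod_free k X =
     \<lparr>carrier = {c. finite {x. c x \<noteq> \<zero>\<^bsub>k\<^esub>} \<and> (\<forall>x\<in>X. c x \<in> carrier k) \<and> (\<forall>x. x \<notin> X \<longrightarrow> c x = \<zero>\<^bsub>k\<^esub>)},
      mult = undefined, one = undefined, zero = (\<lambda>x. \<zero>\<^bsub>k\<^esub>),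
      add = (\<lambda>c d x. c x \<oplus>\<^bsub>k\<^esub> d x), smult = (\<lambda>a c x. a \<otimes>\<^bsub>k\<^esub> c x)\<rparr>"

definition free_gen :: "('k, 'y) ring_scheme \<Rightarrow> 'b \<Rightarrow> 'b \<Rightarrow> 'k" where
  "free_gen k x = (\<lambda>y. if y = x then \<one>\<^bsub>k\<^esub> else \<zero>\<^bsub>k\<^esub>)"

text \<open>The linear extension of a map \<open>f\<close> between bases, and of a map \<open>f\<close> from a basis to a module.\<close>

definition free_map :: "('k, 'y) ring_scheme \<Rightarrow> ('b \<Rightarrow> 'c) \<Rightarrow> ('b \<Rightarrow> 'k) \<Rightarrow> 'c \<Rightarrow> 'k" where
  "free_map k f c = (\<lambda>y. \<Oplus>\<^bsub>k\<^esub>x\<in>{x. c x \<noteq> \<zero>\<^bsub>k\<^esub> \<and> f x = y}. c x)"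

definition free_eval ::
  "('k, 'y) ring_scheme \<Rightarrow> ('k, 'a) module \<Rightarrow> ('b \<Rightarrow> 'a) \<Rightarrow> ('b \<Rightarrow> 'k) \<Rightarrow> 'a" where
  "free_eval k M f c = (\<Oplus>\<^bsub>M\<^esub>x\<in>{x. c x \<noteq> \<zero>\<^bsub>k\<^esub>}. c x \<odot>\<^bsub>M\<^esub> f x)"

text \<open>For a group \<open>S\<close> acting \<open>k\<close>-linearly on \<open>X\<close> from the right (by \<open>rX\<close>) and on \<open>T\<close> from the left
  (by \<open>lT\<close>), the module \<open>mod_tensor k S X rX T lT\<close> is \<open>X \<otimes> T\<close> over the group ring \<open>kS\<close>: the free
  \<open>k\<close>-module on pairs modulo bilinearity and balancedness. Since \<open>kS\<close> is spanned by \<open>S\<close> over \<open>k\<close>,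
  balancedness over \<open>kS\<close> amounts to balancedness over scalars and over \<open>S\<close>.\<close>

definition tensor_rels ::
  "('k, 'y) ring_scheme \<Rightarrow> 's set \<Rightarrow> ('k, 'b) module \<Rightarrow> ('s \<Rightarrow> 'b \<Rightarrow> 'b) \<Rightarrow>
   ('k, 't) module \<Rightarrow> ('s \<Rightarrow> 't \<Rightarrow> 't) \<Rightarrow> ('b \<times> 't \<Rightarrow> 'k) set" where
  "tensor_rels k S X rX T lT =
     (let F = mod_free k (carrier X \<times> carrier T); p = (\<lambda>x t. free_gen k (x, t)) in
       {p (x \<oplus>\<^bsub>X\<^esub> x') t \<ominus>\<^bsub>F\<^esub> (p x t \<oplus>\<^bsub>F\<^esub> p x' t) | x x' t.
          x \<in> carrier X \<and> x' \<in> carrier X \<and> t \<in> carrier T}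
     \<union> {p x (t \<oplus>\<^bsub>T\<^esub> t') \<ominus>\<^bsub>F\<^esub> (p x t \<oplus>\<^bsub>F\<^esub> p x t') | x t t'.
          x \<in> carrier X \<and> t \<in> carrier T \<and> t' \<in> carrier T}
     \<union> {p (a \<odot>\<^bsub>X\<^esub> x) t \<ominus>\<^bsub>F\<^esub> (a \<odot>\<^bsub>F\<^esub> p x t) | a x t.
          a \<in> carrier k \<and> x \<in> carrier X \<and> t \<in> carrier T}
     \<union> {p x (a \<odot>\<^bsub>T\<^esub> t) \<ominus>\<^bsub>F\<^esub> (a \<odot>\<^bsub>F\<^esub> p x t) | a x t.
          a \<in> carrier k \<and> x \<in> carrier X \<and> t \<in> carrier T}
     \<union> {p (rX s x) t \<ominus>\<^bsub>F\<^esub> p x (lT s t) | s x t.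
          s \<in> S \<and> x \<in> carrier X \<and> t \<in> carrier T})"

definition tensor_sub ::
  "('k, 'y) ring_scheme \<Rightarrow> 's set \<Rightarrow> ('k, 'b) module \<Rightarrow> ('s \<Rightarrow> 'b \<Rightarrow> 'b) \<Rightarrow>
   ('k, 't) module \<Rightarrow> ('s \<Rightarrow> 't \<Rightarrow> 't) \<Rightarrow> ('b \<times> 't \<Rightarrow> 'k) set" where
  "tensor_sub k S X rX T lT =
     mod_span k (mod_free k (carrier X \<times> carrier T)) (tensor_rels k S X rX T lT)"

definition mod_tensor ::
  "('k, 'y) ring_scheme \<Rightarrow> 's set \<Rightarrow> ('k, 'b) module \<Rightarrow> ('s \<Rightarrow> 'b \<Rightarrow> 'b) \<Rightarrow>
   ('k, 't) module \<Rightarrow> ('s \<Rightarrow> 't \<Rightarrow> 't) \<Rightarrow> ('k, ('b \<times> 't \<Rightarrow> 'k) set) module" where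
  "mod_tensor k S X rX T lT =
     mod_quot (mod_free k (carrier X \<times> carrier T)) (tensor_sub k S X rX T lT)"


section \<open>\<open>C\<close>-modules\<close>

record ('k, 'g, 'a) cmod =
  obj :: "nat \<Rightarrow> ('k, 'a) module"
  act :: "nat \<Rightarrow> nat \<Rightarrow> 'g mor \<Rightarrow> 'a \<Rightarrow> 'a"

text \<open>\<open>act V m n \<phi>\<close> is the value of the functor \<open>V\<close> on \<open>\<phi> : [m] \<rightarrow> [n]\<close>; only its restriction to
  \<open>carrier (obj V m)\<close>, for \<open>\<phi> \<in> mor G m n\<close>, is meaningful.\<close>

definition cmodule ::
  "('g, 'x) monoid_scheme \<Rightarrow> ('k, 'y) ring_scheme \<Rightarrow> ('k, 'g, 'a) cmod \<Rightarrow> bool" where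
  "cmodule G k V \<longleftrightarrow>
     (\<forall>n. Module.module k (obj V n))
   \<and> (\<forall>m n. \<forall>\<phi>\<in>mor G m n. act V m n \<phi> \<in> mod_hom k (obj V m) (obj V n))
   \<and> (\<forall>n. \<forall>v\<in>carrier (obj V n). act V n n (mor_id G n) v = v)
   \<and> (\<forall>l m n. \<forall>\<psi>\<in>mor G l m. \<forall>\<phi>\<in>mor G m n. \<forall>v\<in>carrier (obj V l).
        act V l n (mor_comp G l \<phi> \<psi>) v = act V m n \<phi> (act V l m \<psi> v))"

definition csubmodule ::
  "('g, 'x) monoid_scheme \<Rightarrow> ('k, 'y) ring_scheme \<Rightarrow> ('k, 'g, 'a) cmod \<Rightarrow> (nat \<Rightarrow> 'a set) \<Rightarrow> bool"
  where
  "csubmodule G k V W \<longleftrightarrow>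
     (\<forall>n. submodule (W n) k (obj V n))
   \<and> (\<forall>m n. \<forall>\<phi>\<in>mor G m n. act V m n \<phi> ` W m \<subseteq> W n)"

definition cmod_restrict :: "('k, 'g, 'a) cmod \<Rightarrow> (nat \<Rightarrow> 'a set) \<Rightarrow> ('k, 'g, 'a) cmod" where
  "cmod_restrict V A = V\<lparr>obj := (\<lambda>n. (obj V n)\<lparr>carrier := A n\<rparr>)\<rparr>"

definition cmod_quot :: "('k, 'g, 'a) cmod \<Rightarrow> (nat \<Rightarrow> 'a set) \<Rightarrow> ('k, 'g, 'a set) cmod" where
  "cmod_quot V B =
     \<lparr>obj = (\<lambda>n. mod_quot (obj V n) (B n)),
      act = (\<lambda>m n \<phi>. coset_map (obj V n) (B n) (act V m n \<phi>))\<rparr>"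

definition cmod_iso ::
  "('g, 'x) monoid_scheme \<Rightarrow> ('k, 'y) ring_scheme \<Rightarrow> ('k, 'g, 'a) cmod \<Rightarrow> ('k, 'g, 'b) cmod \<Rightarrow> bool"
  where
  "cmod_iso G k V W \<longleftrightarrow> (\<exists>\<eta>.
     (\<forall>n. \<eta> n \<in> mod_hom k (obj V n) (obj W n)
          \<and> bij_betw (\<eta> n) (carrier (obj V n)) (carrier (obj W n)))
   \<and> (\<forall>m n. \<forall>\<phi>\<in>mor G m n. \<forall>v\<in>carrier (obj V m).
        \<eta> n (act V m n \<phi> v) = act W m n \<phi> (\<eta> m v)))"

definition cmod_shift ::
  "('g, 'x) monoid_scheme \<Rightarrow> ('k, 'g, 'a) cmod \<Rightarrow> ('k, 'g, 'a) cmod" where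
  "cmod_shift G V =
     \<lparr>obj = (\<lambda>n. obj V (Suc n)), act = (\<lambda>m n \<phi>. act V (Suc m) (Suc n) (mor_shift G m \<phi>))\<rparr>"


section \<open>Filtered modules\<close>

text \<open>A \<open>kG\<^sub>m\<close>-module, given as a \<open>k\<close>-module \<open>T\<close> with a \<open>k\<close>-linear action \<open>\<rho>\<close> of
  \<open>G\<^sub>m = mor G m m\<close>.\<close>

definition group_rep ::
  "('g, 'x) monoid_scheme \<Rightarrow> ('k, 'y) ring_scheme \<Rightarrow> nat \<Rightarrow> ('k, 't) module \<Rightarrow>
   ('g mor \<Rightarrow> 't \<Rightarrow> 't) \<Rightarrow> bool" where
  "group_rep G k m T \<rho> \<longleftrightarrow>
     Module.module k T
   \<and> (\<forall>\<sigma>\<in>mor G m m. \<rho> \<sigma> \<in> mod_hom k T T)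
   \<and> (\<forall>t\<in>carrier T. \<rho> (mor_id G m) t = t)
   \<and> (\<forall>\<sigma>\<in>mor G m m. \<forall>\<tau>\<in>mor G m m. \<forall>t\<in>carrier T.
        \<rho> (mor_comp G m \<sigma> \<tau>) t = \<rho> \<sigma> (\<rho> \<tau> t))"

text \<open>The right action of \<open>G\<^sub>m\<close> on \<open>k C([m], [n])\<close> by precomposition.\<close>

definition mor_right :: "('g, 'x) monoid_scheme \<Rightarrow> ('k, 'y) ring_scheme \<Rightarrow> nat \<Rightarrow> 'g mor \<Rightarrow>
    ('g mor \<Rightarrow> 'k) \<Rightarrow> 'g mor \<Rightarrow> 'k" where
  "mor_right G k m \<sigma> = free_map k (\<lambda>\<phi>. mor_comp G m \<phi> \<sigma>)"

text \<open>\<open>M(T)\<close>, with \<open>M(T)\<^sub>n = k C([m], [n]) \<otimes> T\<close> over \<open>kG\<^sub>m\<close>; morphisms act by postcomposition on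
  the left factor.\<close>

definition induced :: "('g, 'x) monoid_scheme \<Rightarrow> ('k, 'y) ring_scheme \<Rightarrow> nat \<Rightarrow> ('k, 't) module \<Rightarrow>
    ('g mor \<Rightarrow> 't \<Rightarrow> 't) \<Rightarrow> ('k, 'g, (('g mor \<Rightarrow> 'k) \<times> 't \<Rightarrow> 'k) set) cmod" where
  "induced G k m T \<rho> =
     \<lparr>obj = (\<lambda>n. mod_tensor k (mor G m m) (mod_free k (mor G m n)) (mor_right G k m) T \<rho>),
      act = (\<lambda>n n' \<psi>.
        coset_map (mod_free k (carrier (mod_free k (mor G m n')) \<times> carrier T))
          (tensor_sub k (mor G m m) (mod_free k (mor G m n')) (mor_right G k m) T \<rho>)
          (free_map k (\<lambda>(x, t). (free_map k (mor_comp G m \<psi>) x, t))))\<rparr>"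

text \<open>The chain \<open>V\<^sup>-\<^sup>1 \<subseteq> V\<^sup>0 \<subseteq> \<dots>\<close> is indexed from \<open>0\<close> here, as \<open>F 0 \<subseteq> F 1 \<subseteq> \<dots> \<subseteq> F r\<close>.
  The modules \<open>T\<close> range over carriers in \<^typ>\<open>'a set\<close>. This is no restriction: \<open>M(T)\<^sub>m\<close> is isomorphic
  to \<open>T\<close>, so if the subquotient is isomorphic to \<open>M(T)\<close>, then its value in degree \<open>m\<close>, whose elements
  have type \<^typ>\<open>'a set\<close>, is a copy of \<open>T\<close>.\<close>

definition filtered ::
  "('g, 'x) monoid_scheme \<Rightarrow> ('k, 'y) ring_scheme \<Rightarrow> ('k, 'g, 'a) cmod \<Rightarrow> bool" where
  "filtered G k V \<longleftrightarrow> (\<exists>(r::nat) F.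
     (\<forall>i\<le>r. csubmodule G k V (F i))
   \<and> F 0 = (\<lambda>n. {\<zero>\<^bsub>obj V n\<^esub>})
   \<and> F r = (\<lambda>n. carrier (obj V n))
   \<and> (\<forall>i<r. (\<forall>n. F i n \<subseteq> F (Suc i) n)
        \<and> (\<exists>m (T :: ('k, 'a set) module) \<rho>. group_rep G k m T \<rho>
             \<and> cmod_iso G k (cmod_quot (cmod_restrict V (F (Suc i))) (F i)) (induced G k m T \<rho>))))"


section \<open>The functor \<open>H\<^sub>0\<close> and its left derived functors\<close>

definition decomposables ::
  "('g, 'x) monoid_scheme \<Rightarrow> ('k, 'y) ring_scheme \<Rightarrow> ('k, 'g, 'a) cmod \<Rightarrow> nat \<Rightarrow> 'a set" where
  "decomposables G k V n =
     mod_span k (obj V n) (\<Union>i\<in>{..<n}. \<Union>\<alpha>\<in>mor G i n. act V i n \<alpha> ` carrier (obj V i))"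

definition H0 ::
  "('g, 'x) monoid_scheme \<Rightarrow> ('k, 'y) ring_scheme \<Rightarrow> ('k, 'g, 'a) cmod \<Rightarrow> ('k, 'g, 'a set) cmod"
  where
  "H0 G k V = cmod_quot V (decomposables G k V)"

definition H0_map :: "('g, 'x) monoid_scheme \<Rightarrow> ('k, 'y) ring_scheme \<Rightarrow> ('k, 'g, 'b) cmod \<Rightarrow>
    (nat \<Rightarrow> 'a \<Rightarrow> 'b) \<Rightarrow> nat \<Rightarrow> 'a set \<Rightarrow> 'b set" where
  "H0_map G k W \<eta> n = coset_map (obj W n) (decomposables G k W n) (\<eta> n)"

text \<open>The free \<open>C\<close>-module with basis \<open>X m\<close> in degree \<open>m\<close>, that is, the direct sum over all \<open>m\<close> and
  \<open>x \<in> X m\<close> of copies of the representable module \<open>k C([m], -)\<close>.\<close>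

definition cmod_free :: "('g, 'x) monoid_scheme \<Rightarrow> ('k, 'y) ring_scheme \<Rightarrow> (nat \<Rightarrow> 'b set) \<Rightarrow>
    ('k, 'g, nat \<times> 'g mor \<times> 'b \<Rightarrow> 'k) cmod" where
  "cmod_free G k X =
     \<lparr>obj = (\<lambda>n. mod_free k {(m, \<phi>, x). \<phi> \<in> mor G m n \<and> x \<in> X m}),
      act = (\<lambda>n n' \<psi>. free_map k (\<lambda>(m, \<phi>, x). (m, mor_comp G m \<psi> \<phi>, x)))\<rparr>"

text \<open>The left derived functors are computed from the standard free resolution
  \<open>\<dots> \<rightarrow> P\<^sub>1 \<rightarrow> P\<^sub>0 \<rightarrow> V\<close>, in which \<open>P\<^sub>0\<close> is free on the underlying graded set of \<open>V\<close> and \<open>P\<^sub>s\<^sub>+\<^sub>1\<close>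
  is free on the underlying graded set of the kernel of \<open>P\<^sub>s \<rightarrow> P\<^sub>s\<^sub>-\<^sub>1\<close>. To have all \<open>P\<^sub>s\<close> in
  one type, a datatype closed under forming finite linear combinations is used: \<open>Comb\<close> holds the
  graph of a finitely supported coefficient function, restricted to its support.\<close>

datatype ('k, 'g, 'a) formal =
    Elem 'a
  | Comb "((nat \<times> 'g mor \<times> ('k, 'g, 'a) formal) \<times> 'k) fset"

definition comb :: "('k, 'y) ring_scheme \<Rightarrow>
    (nat \<times> 'g mor \<times> ('k, 'g, 'a) formal \<Rightarrow> 'k) \<Rightarrow> ('k, 'g, 'a) formal" where
  "comb k c = Comb (Abs_fset ((\<lambda>x. (x, c x)) ` {x. c x \<noteq> \<zero>\<^bsub>k\<^esub>}))"

text \<open>Transport of structure along a map \<open>h\<close> that is injective on the carriers.\<close>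

definition cmod_transport :: "('a \<Rightarrow> 'b) \<Rightarrow> ('k, 'g, 'a) cmod \<Rightarrow> ('k, 'g, 'b) cmod" where
  "cmod_transport h V =
     \<lparr>obj = (\<lambda>n. let M = obj V n; u = inv_into (carrier M) h in
        \<lparr>carrier = h ` carrier M, mult = undefined, one = undefined, zero = h \<zero>\<^bsub>M\<^esub>,
         add = (\<lambda>x y. h (u x \<oplus>\<^bsub>M\<^esub> u y)), smult = (\<lambda>a x. h (a \<odot>\<^bsub>M\<^esub> u x))\<rparr>),
      act = (\<lambda>m n \<phi> x. h (act V m n \<phi> (inv_into (carrier (obj V m)) h x)))\<rparr>"

text \<open>The free \<open>C\<close>-module on the underlying graded set of \<open>W\<close>, and the canonical epimorphism from
  it to \<open>W\<close>, which sends the basis element \<open>(m, \<phi>, x)\<close> to \<open>\<phi> x\<close>.\<close>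

definition cover :: "('g, 'x) monoid_scheme \<Rightarrow> ('k, 'y) ring_scheme \<Rightarrow>
    ('k, 'g, ('k, 'g, 'a) formal) cmod \<Rightarrow> ('k, 'g, ('k, 'g, 'a) formal) cmod" where
  "cover G k W = cmod_transport (comb k) (cmod_free G k (\<lambda>m. carrier (obj W m)))"

definition cover_map :: "('g, 'x) monoid_scheme \<Rightarrow> ('k, 'y) ring_scheme \<Rightarrow>
    ('k, 'g, ('k, 'g, 'a) formal) cmod \<Rightarrow> nat \<Rightarrow> ('k, 'g, 'a) formal \<Rightarrow> ('k, 'g, 'a) formal" where
  "cover_map G k W n u =
     free_eval k (obj W n) (\<lambda>(m, \<phi>, x). act W m n \<phi> x)
       (inv_into (carrier (obj (cmod_free G k (\<lambda>m. carrier (obj W m))) n)) (comb k) u)"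

text \<open>\<open>syzygy G k V 0\<close> is a copy of \<open>V\<close>, and \<open>syzygy G k V (s + 1)\<close> is the kernel of
  \<open>P\<^sub>s \<rightarrow> syzygy G k V s\<close>, a submodule of \<open>P\<^sub>s\<close>.\<close>

primrec syzygy :: "('g, 'x) monoid_scheme \<Rightarrow> ('k, 'y) ring_scheme \<Rightarrow> ('k, 'g, 'a) cmod \<Rightarrow> nat \<Rightarrow>
    ('k, 'g, ('k, 'g, 'a) formal) cmod" where
  "syzygy G k V 0 = cmod_transport Elem V"
| "syzygy G k V (Suc s) =
     cmod_restrict (cover G k (syzygy G k V s))
       (\<lambda>n. {u \<in> carrier (obj (cover G k (syzygy G k V s)) n).
               cover_map G k (syzygy G k V s) n u = \<zero>\<^bsub>obj (syzygy G k V s) n\<^esub>})"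

definition resol :: "('g, 'x) monoid_scheme \<Rightarrow> ('k, 'y) ring_scheme \<Rightarrow> ('k, 'g, 'a) cmod \<Rightarrow> nat \<Rightarrow>
    ('k, 'g, ('k, 'g, 'a) formal) cmod" where
  "resol G k V s = cover G k (syzygy G k V s)"

text \<open>The differential \<open>P\<^sub>s\<^sub>+\<^sub>1 \<rightarrow> P\<^sub>s\<close>: the canonical epimorphism onto the syzygy inside \<open>P\<^sub>s\<close>.\<close>

definition resol_diff :: "('g, 'x) monoid_scheme \<Rightarrow> ('k, 'y) ring_scheme \<Rightarrow> ('k, 'g, 'a) cmod \<Rightarrow>
    nat \<Rightarrow> nat \<Rightarrow> ('k, 'g, 'a) formal \<Rightarrow> ('k, 'g, 'a) formal" where
  "resol_diff G k V s = cover_map G k (syzygy G k V (Suc s))"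

primrec H_cycles :: "('g, 'x) monoid_scheme \<Rightarrow> ('k, 'y) ring_scheme \<Rightarrow> ('k, 'g, 'a) cmod \<Rightarrow>
    nat \<Rightarrow> nat \<Rightarrow> ('k, 'g, 'a) formal set set" where
  "H_cycles G k V 0 = (\<lambda>n. carrier (obj (H0 G k (resol G k V 0)) n))"
| "H_cycles G k V (Suc s) =
     (\<lambda>n. {z \<in> carrier (obj (H0 G k (resol G k V (Suc s))) n).
             H0_map G k (resol G k V s) (resol_diff G k V s) n z
               = \<zero>\<^bsub>obj (H0 G k (resol G k V s)) n\<^esub>})"

definition H_boundaries :: "('g, 'x) monoid_scheme \<Rightarrow> ('k, 'y) ring_scheme \<Rightarrow>
    ('k, 'g, 'a) cmod \<Rightarrow> nat \<Rightarrow> nat \<Rightarrow> ('k, 'g, 'a) formal set set" where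
  "H_boundaries G k V s n =
     H0_map G k (resol G k V s) (resol_diff G k V s) n
       ` carrier (obj (H0 G k (resol G k V (Suc s))) n)"

definition H :: "('g, 'x) monoid_scheme \<Rightarrow> ('k, 'y) ring_scheme \<Rightarrow> nat \<Rightarrow> ('k, 'g, 'a) cmod \<Rightarrow>
    ('k, 'g, ('k, 'g, 'a) formal set set) cmod" where
  "H G k s V =
     cmod_quot (cmod_restrict (H0 G k (resol G k V s)) (H_cycles G k V s)) (H_boundaries G k V s)"

text \<open>Suprema are taken in \<^typ>\<open>ereal\<close>, where the supremum of the empty set is \<open>-\<infinity>\<close>.\<close>

definition top_degree :: "('k, 'g, 'a) cmod \<Rightarrow> ereal" where
  "top_degree V = Sup ((\<lambda>n. ereal (real n)) ` {n. carrier (obj V n) \<noteq> {\<zero>\<^bsub>obj V n\<^esub>}})"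

definition hom_deg ::
  "('g, 'x) monoid_scheme \<Rightarrow> ('k, 'y) ring_scheme \<Rightarrow> nat \<Rightarrow> ('k, 'g, 'a) cmod \<Rightarrow> ereal" where
  "hom_deg G k s V = top_degree (H G k s V)"

text \<open>As \<open>H\<^sub>0\<close> is right exact, it is naturally isomorphic to its zeroth left derived functor
  \<open>H G k 0\<close>; the generation degree refers to \<open>H\<^sub>0\<close> itself.\<close>

definition gen_deg ::
  "('g, 'x) monoid_scheme \<Rightarrow> ('k, 'y) ring_scheme \<Rightarrow> ('k, 'g, 'a) cmod \<Rightarrow> ereal" where
  "gen_deg G k V = top_degree (H0 G k V)"

definition presented_in_finite_degrees ::
  "('g, 'x) monoid_scheme \<Rightarrow> ('k, 'y) ring_scheme \<Rightarrow> ('k, 'g, 'a) cmod \<Rightarrow> bool" where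
  "presented_in_finite_degrees G k V \<longleftrightarrow> gen_deg G k V < \<infinity> \<and> hom_deg G k 1 V < \<infinity>"

end

(*
Inserting a new first point gives a natural map V -> Sigma V; write KV and DV for its kernel and
cokernel. The derivative D lowers the generation degree, and all non-invertible morphisms act as
zero on KV. Let C(V)_n be the complex with C_p(V)_n the sum of V_(n-p) over the p-subsets of [n], so
that C(V)_(n+1) is the cone of C(V)_n -> C(Sigma V)_n. Its homology in degree 0 is H_0(V), and if the
relations of V are generated in bounded degree then its homology in degree 1 is bounded. The exact
sequence 0 -> KV -> V -> Sigma V -> DV -> 0 gives
  H_2(C(DV))_n -> (KV)_n -> H_1(C(V))_(n+1),
so by induction on the generation degree KV is bounded, and hence so is H_p(C(V)) for every p. The
same holds for all iterated derivatives D^a V. After enough shifts every D^a V therefore embeds into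
its own shift. Since D^i V at the empty set is H_0(V)_i, this says that the sum of the images of H_0(V)_i
under the i-subsets of [n] is direct modulo the submodule generated in degrees below i, i.e. that the
filtration by generation degree has subquotients M(H_0(V)_i).
*)
theory Submission
  imports Defs "HOL-Algebra.Free_Abelian_Groups"
begin

section \<open>Chain complexes of semi-cosimplicial abelian groups\<close>

text \<open>Iterated derivatives are not formed as modules of their own. All values are subquotients
  of one abelian group: the numerators remain values of \<open>A\<close>, and each derivative only
  enlarges the denominators \<open>BB\<close>, so no tower of quotients arises and one induction
  serves all \<open>a\<close>. Vanishing of homology passes from \<open>C(V)\<close> to
  \<open>C(DV)\<close> in degrees 0 and 1, where a lifted chain has no further boundary; higher
  degrees are recovered from the derivative once torsion is known to vanish. That non-invertible
  morphisms kill \<open>KV\<close> rests on the symmetric groups: transpositions turn one way of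
  inserting a point into all others. Degree 1 is tied to relations by a free cover \<open>P\<close>
  of \<open>V\<close> with kernel \<open>K\<close>: derivatives of free modules have no torsion, so
  \<open>C(P)\<close> is acyclic in positive degrees, and degree 1 for \<open>V\<close> becomes the
  kernel of \<open>H_0(K) -> H_0(P)\<close>, which is \<open>H_1(V)\<close>. The torsion bound
  depends on the derivative; it becomes uniform because only finitely many derivatives are
  nonzero.\<close>

definition add_subgroup :: "'b::ab_group_add set \<Rightarrow> bool" where
  "add_subgroup S \<longleftrightarrow> 0 \<in> S \<and> (\<forall>x\<in>S. \<forall>y\<in>S. x - y \<in> S)"

lemma add_subgroup_zero: "add_subgroup S \<Longrightarrow> 0 \<in> S"
  by (simp add: add_subgroup_def)

lemma add_subgroup_diff: "add_subgroup S \<Longrightarrow> x \<in> S \<Longrightarrow> y \<in> S \<Longrightarrow> x - y \<in> S"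
  by (simp add: add_subgroup_def)

lemma add_subgroup_uminus: "add_subgroup S \<Longrightarrow> x \<in> S \<Longrightarrow> - x \<in> S"
  using add_subgroup_diff[of S 0 x] by (simp add: add_subgroup_zero)

lemma add_subgroup_add: "add_subgroup S \<Longrightarrow> x \<in> S \<Longrightarrow> y \<in> S \<Longrightarrow> x + y \<in> S"
  using add_subgroup_diff[of S x "- y"] by (simp add: add_subgroup_uminus)

lemmas add_subgroup_closed = add_subgroup_zero add_subgroup_diff add_subgroup_uminus add_subgroup_add

text \<open>A \<open>p\<close>-subset of \<open>[n]\<close> is encoded as a list of \<open>n\<close> booleans, \<open>p\<close> of which are \<open>True\<close>. A
  \<open>p\<close>-chain assigns to it an element of level \<open>n - p\<close>, the number of entries \<open>False\<close>. Degrees of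
  chains are integers so that \<open>p - 1\<close> is not truncated.\<close>

definition shape :: "nat \<Rightarrow> int \<Rightarrow> bool list \<Rightarrow> bool" where
  "shape n p l \<longleftrightarrow> length l = n \<and> int (count_list l True) = p"

definition chains :: "(nat \<Rightarrow> 'b::ab_group_add set) \<Rightarrow> nat \<Rightarrow> int \<Rightarrow> (bool list \<Rightarrow> 'b) set" where
  "chains S n p = {c. \<forall>l. if shape n p l then c l \<in> S (count_list l False) else c l = 0}"

lemma chainsI:
  "(\<And>l. shape n p l \<Longrightarrow> c l \<in> S (count_list l False)) \<Longrightarrow> (\<And>l. \<not> shape n p l \<Longrightarrow> c l = 0) \<Longrightarrow>
    c \<in> chains S n p"
  by (simp add: chains_def)

lemma chainsD: "c \<in> chains S n p \<Longrightarrow> shape n p l \<Longrightarrow> c l \<in> S (count_list l False)"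
  by (simp add: chains_def)

lemma chains_outside: "c \<in> chains S n p \<Longrightarrow> \<not> shape n p l \<Longrightarrow> c l = 0"
  by (simp add: chains_def)

lemma shape_Nil [simp]: "shape n p [] \<longleftrightarrow> n = 0 \<and> p = 0"
  by (auto simp: shape_def)

lemma shape_Cons [simp]: "shape (Suc n) p (x # l) \<longleftrightarrow> shape n (if x then p - 1 else p) l"
  by (auto simp: shape_def)

lemma shape_0: "shape 0 p l \<longleftrightarrow> l = [] \<and> p = 0"
  by (auto simp: shape_def)

lemma count_list_True_False: "count_list l True + count_list l False = length l"
  by (induct l) auto

lemma shape_bounds: "shape n p l \<Longrightarrow> 0 \<le> p \<and> p \<le> int n \<and> int (count_list l False) = int n - p"
  using count_list_True_False[of l] by (auto simp: shape_def)

lemma shape_p0: "shape n 0 l \<longleftrightarrow> l = replicate n False"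
proof
  assume "shape n 0 l"
  then show "l = replicate n False"
    by (intro nth_equalityI) (auto simp: shape_def count_list_0_iff in_set_conv_nth)
qed (auto simp: shape_def count_list_0_iff)

lemma count_replicate_False [simp]: "count_list (replicate n False) False = n"
  by (induct n) auto

text \<open>The recursion on the list is the one for iterated mapping cones; \<open>d a, d (a + 1), \<dots>\<close> are the
  face maps of the \<open>a\<close>-th shift.\<close>

primrec bnd :: "(nat \<Rightarrow> 'b \<Rightarrow> 'b) \<Rightarrow> bool list \<Rightarrow> nat \<Rightarrow> (bool list \<Rightarrow> 'b::ab_group_add) \<Rightarrow> 'b" where
  "bnd d [] a c = 0"
| "bnd d (x # l) a c =
     (if x then - bnd d l a (\<lambda>m. c (True # m))
      else bnd d l (Suc a) (\<lambda>m. c (False # m)) + d a (c (True # l)))"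

text \<open>A chain on \<open>n + 1\<close> points is a pair: \<open>f\<close> collects the subsets
  avoiding the first point and is a chain of the shift, \<open>g\<close> collects those containing
  it and has degree one less. The empty list is no subset of \<open>n + 1\<close> points and gets
  0.\<close>

definition cone :: "(bool list \<Rightarrow> 'b) \<Rightarrow> (bool list \<Rightarrow> 'b) \<Rightarrow> bool list \<Rightarrow> 'b::ab_group_add" where
  "cone f g l = (case l of [] \<Rightarrow> 0 | x # m \<Rightarrow> if x then g m else f m)"

lemma cone_simps [simp]:
  "cone f g [] = 0" "cone f g (True # m) = g m" "cone f g (False # m) = f m"
  by (auto simp: cone_def)

text \<open>This splitting turns the long exact sequences of the cone into computations with pairs.
  The first component has all levels raised by one because the first point is present in it.\<close>

lemma chains_Suc:
  "c \<in> chains S (Suc n) p \<longleftrightarrow> c [] = 0 \<and> (\<lambda>m. c (False # m)) \<in> chains (\<lambda>n. S (Suc n)) n p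
     \<and> (\<lambda>m. c (True # m)) \<in> chains S n (p - 1)" (is "?L \<longleftrightarrow> ?R")
proof
  assume c: ?L
  show ?R
    using chains_outside[OF c] chainsD[OF c, of "False # _"] chainsD[OF c, of "True # _"]
    by (auto intro!: chainsI)
next
  assume c: ?R
  show ?L
  proof (rule chainsI)
    fix l
    show "c l \<in> S (count_list l False)" if "shape (Suc n) p l"
      using that c by (cases l) (auto split: if_splits dest: chainsD)
    show "c l = 0" if "\<not> shape (Suc n) p l"
      using that c by (cases l) (auto split: if_splits dest: chains_outside)
  qed
qed

lemma chains_0: "c \<in> chains S 0 p \<longleftrightarrow> (\<forall>l. if l = [] \<and> p = 0 then c [] \<in> S 0 else c l = 0)"
  unfolding chains_def shape_0 by auto

lemma chains_neg: "p < 0 \<Longrightarrow> c \<in> chains S n p \<Longrightarrow> c = (\<lambda>l. 0)"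
  by (rule ext, rule chains_outside) (auto dest: shape_bounds)

lemma chains_mono: "(\<And>m. S m \<subseteq> S' m) \<Longrightarrow> c \<in> chains S n p \<Longrightarrow> c \<in> chains S' n p"
  by (rule chainsI) (auto dest: chainsD chains_outside)

text \<open>All values of a \<open>p\<close>-chain on \<open>n\<close> points lie in the single
  level \<open>n - p\<close>, so facts known in one level only can be applied to whole
  chains.\<close>

lemma chains_mono_level:
  assumes "\<And>m. int m = int n - p \<Longrightarrow> S m \<subseteq> S' m" and "c \<in> chains S n p"
  shows "c \<in> chains S' n p"
  by (rule chainsI) (use assms shape_bounds in \<open>blast dest: chainsD chains_outside\<close>)+

lemma chains_add_subgroup:
  assumes "\<And>m. add_subgroup (S m)" and "c \<in> chains S n p" and "e \<in> chains S n p"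
  shows "(\<lambda>l. c l + e l) \<in> chains S n p" "(\<lambda>l. c l - e l) \<in> chains S n p"
    "(\<lambda>l. - c l) \<in> chains S n p"
  using assms by (auto simp: add_subgroup_closed chains_outside chainsD intro!: chainsI)

lemma chains_zero: "(\<And>m. add_subgroup (S m)) \<Longrightarrow> (\<lambda>l. 0) \<in> chains S n p"
  by (rule chainsI) (auto simp: add_subgroup_zero)

lemma chains_map:
  assumes "f 0 = 0" and "\<And>m x. x \<in> S m \<Longrightarrow> f x \<in> S' m" and "c \<in> chains S n p"
  shows "(\<lambda>l. f (c l)) \<in> chains S' n p"
  using assms by (auto simp: chains_outside chainsD intro!: chainsI)

section \<open>Boundary operators from cosimplicial face maps\<close>

locale face_maps =
  fixes d :: "nat \<Rightarrow> 'b::ab_group_add \<Rightarrow> 'b"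
  assumes d_add: "d i (x + y) = d i x + d i y"
    and dd: "i \<le> j \<Longrightarrow> d (Suc j) (d i x) = d i (d j x)"
begin

lemma d_0 [simp]: "d i 0 = 0"
  using d_add[of i 0 0] by simp

lemma d_uminus: "d i (- x) = - d i x"
  using d_add[of i x "- x"] by (simp add: eq_neg_iff_add_eq_0 add.commute)

lemma d_diff: "d i (x - y) = d i x - d i y"
  using d_add[of i x "- y"] by (simp add: d_uminus)

lemma bnd_add: "bnd d l a (\<lambda>m. c m + e m) = bnd d l a c + bnd d l a e"
  by (induct l arbitrary: a c e) (auto simp: d_add)

lemma bnd_0 [simp]: "bnd d l a (\<lambda>m. 0) = 0"
  by (induct l arbitrary: a) auto

lemma bnd_uminus: "bnd d l a (\<lambda>m. - c m) = - bnd d l a c"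
  by (induct l arbitrary: a c) (auto simp: d_uminus)

lemma bnd_diff: "bnd d l a (\<lambda>m. c m - e m) = bnd d l a c - bnd d l a e"
  using bnd_add[of l a c "\<lambda>m. - e m"] by (simp add: bnd_uminus)

text \<open>Makes \<open>d a\<close> a chain map from a complex to that of its shift, namely the map
  whose cone is taken. The index on the left rises because the point inserted by \<open>d i\<close>
  precedes those inserted by the boundary.\<close>

lemma bnd_d: "i \<le> a \<Longrightarrow> bnd d l (Suc a) (\<lambda>m. d i (c m)) = d i (bnd d l a c)"
  by (induct l arbitrary: a c) (auto simp: d_add d_uminus dd)

text \<open>In the cone the two mixed terms agree by \<open>bnd_d\<close> and cancel because the
  component containing the first point carries the minus sign.\<close>

lemma bnd_bnd: "bnd d l a (\<lambda>m. bnd d m a c) = 0"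
proof (induct l arbitrary: a c)
  case (Cons x l)
  show ?case
    using Cons by (cases x) (auto simp: bnd_uminus bnd_add bnd_d d_uminus)
qed auto

text \<open>Values \<open>S\<close> of the chain and values \<open>R\<close> of its boundary are
  kept apart: the same induction yields stability of numerators and of denominators, and later that
  chains with torsion values have boundaries in the denominators.\<close>

lemma bnd_chains:
  assumes R: "\<And>n. add_subgroup (R n)"
    and S: "\<And>i n x. x \<in> S n \<Longrightarrow> d (a + i) x \<in> R (Suc n)"
    and c: "c \<in> chains S n p"
  shows "(\<lambda>l. bnd d l a c) \<in> chains R n (p - 1)"
  using assms
proof (induct n arbitrary: a c p S R)
  case 0
  then have "c l = 0" if "l \<noteq> []" for l using that by (auto simp: chains_0)
  then have "bnd d l a c = 0" for l
    by (cases l) auto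
  then show ?case using 0 by (simp add: chains_0 add_subgroup_zero)
next
  case (Suc n)
  have cF: "(\<lambda>m. c (False # m)) \<in> chains (\<lambda>n. S (Suc n)) n p"
    and cT: "(\<lambda>m. c (True # m)) \<in> chains S n (p - 1)"
    using Suc.prems(3) by (auto simp: chains_Suc)
  have "(\<lambda>l. bnd d l (Suc a) (\<lambda>m. c (False # m))) \<in> chains (\<lambda>n. R (Suc n)) n (p - 1)"
    by (rule Suc.hyps[OF _ _ cF]) (use Suc.prems(1) Suc.prems(2)[of _ _ "Suc _"] in auto)
  moreover have "(\<lambda>l. d a (c (True # l))) \<in> chains (\<lambda>n. R (Suc n)) n (p - 1)"
    by (rule chains_map[OF _ _ cT]) (use Suc.prems(2)[of _ _ 0] in auto)
  moreover have "(\<lambda>l. bnd d l a (\<lambda>m. c (True # m))) \<in> chains R n (p - 1 - 1)"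
    by (rule Suc.hyps[OF _ _ cT]) (use Suc.prems in auto)
  ultimately show ?case
    using Suc.prems(1) by (simp add: chains_Suc chains_add_subgroup)
qed

end

text \<open>\<open>d i\<close> models the insertion of a new point \<open>i + 1\<close>, and
  \<open>s i\<close> the transposition of the points \<open>i + 1\<close> and \<open>i + 2\<close>.
  The identities carry no bounds by the level and range over the whole type; the concrete maps are
  extended by 0 so as to satisfy them.\<close>

locale face_system = face_maps +
  fixes s :: "nat \<Rightarrow> 'b::ab_group_add \<Rightarrow> 'b" and A B :: "nat \<Rightarrow> 'b set"
  assumes s_add: "s i (x + y) = s i x + s i y"
    and sd: "s i (d i x) = d (Suc i) x"
    and sd': "i \<le> j \<Longrightarrow> s (Suc j) (d i x) = d i (s j x)"
    and A_sub: "add_subgroup (A n)"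
    and B_sub: "add_subgroup (B n)"
    and BA: "B n \<subseteq> A n"
    and A_d: "x \<in> A n \<Longrightarrow> d i x \<in> A (Suc n)"
    and A_s: "x \<in> A n \<Longrightarrow> s i x \<in> A n"
    and B_d: "x \<in> B n \<Longrightarrow> d i x \<in> B (Suc n)"
    and B_s: "x \<in> B n \<Longrightarrow> s i x \<in> B n"
begin

section \<open>Denominators of the iterated derivatives\<close>

text \<open>The system of groups under consideration is \<open>A n / B n\<close>. Its \<open>a\<close>-th derivative has value
  \<open>A (n + a) / BB a n\<close> in level \<open>n\<close>, with face maps \<open>d a, d (a + 1), \<dots>\<close>\<close>

primrec BB :: "nat \<Rightarrow> nat \<Rightarrow> 'b set" where
  "BB 0 n = B n"
| "BB (Suc a) n = {b + d a y | b y. b \<in> BB a (Suc n) \<and> y \<in> A (n + a)}"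

abbreviation AA :: "nat \<Rightarrow> nat \<Rightarrow> 'b set" where
  "AA a n \<equiv> A (n + a)"

lemma BB_sub: "add_subgroup (BB a n)"
proof (induct a arbitrary: n)
  case (Suc a)
  have "x - y \<in> BB (Suc a) n" if xy: "x \<in> BB (Suc a) n" "y \<in> BB (Suc a) n" for x y
  proof -
    obtain b y' b' y'' where "x = b + d a y'" "y = b' + d a y''" "b \<in> BB a (Suc n)" "b' \<in> BB a (Suc n)"
      "y' \<in> A (n + a)" "y'' \<in> A (n + a)" using xy by auto
    then have "x - y = (b - b') + d a (y' - y'')" "b - b' \<in> BB a (Suc n)" "y' - y'' \<in> A (n + a)"
      using Suc A_sub by (auto simp: d_diff add_subgroup_diff)
    then show ?thesis by auto
  qed
  moreover have "0 + d a 0 \<in> BB (Suc a) n"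
    using Suc[of "Suc n"] A_sub[of "n + a"] unfolding BB.simps by (blast intro: add_subgroup_zero)
  ultimately show ?case by (simp add: add_subgroup_def del: BB.simps)
qed (simp add: B_sub)


lemma BB_d: "x \<in> BB a n \<Longrightarrow> d (a + i) x \<in> BB a (Suc n)"
proof (induct a arbitrary: n x i)
  case (Suc a)
  then obtain b y where "x = b + d a y" "b \<in> BB a (Suc n)" "y \<in> A (n + a)" by auto
  moreover have "d (a + Suc i) b \<in> BB a (Suc (Suc n))" using Suc.hyps calculation(2) by blast
  moreover have "d (Suc (a + i)) (d a y) = d a (d (a + i) y)" by (simp add: dd)
  ultimately show ?case using A_d[of y "n + a"] by (auto simp: d_add)
qed (simp add: B_d)

lemma BB_s: "x \<in> BB a n \<Longrightarrow> s (a + i) x \<in> BB a n"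
proof (induct a arbitrary: n x i)
  case (Suc a)
  then obtain b y where "x = b + d a y" "b \<in> BB a (Suc n)" "y \<in> A (n + a)" by auto
  moreover have "s (a + Suc i) b \<in> BB a (Suc n)" using Suc.hyps calculation(2) by blast
  moreover have "s (Suc (a + i)) (d a y) = d a (s (a + i) y)" by (simp add: sd')
  ultimately show ?case using A_s[of y "n + a"] by (auto simp: s_add)
qed (simp add: B_s)

lemma BB_SucI: "b \<in> BB a (Suc n) \<Longrightarrow> y \<in> AA a n \<Longrightarrow> b + d a y \<in> BB (Suc a) n"
  by auto

text \<open>Componentwise choice: a chain that vanishes for the derivative comes, up to the old
  denominators, from a chain \<open>g\<close> under the chain map \<open>d a\<close>.\<close>

lemma chains_BB_Suc:
  assumes "c \<in> chains (BB (Suc a)) n p"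
  obtains b g where "b \<in> chains (\<lambda>n. BB a (Suc n)) n p" "g \<in> chains (AA a) n p"
    "c = (\<lambda>l. b l + d a (g l))"
proof -
  have "\<exists>b y. b \<in> BB a (Suc (count_list l False)) \<and> y \<in> AA a (count_list l False) \<and> c l = b + d a y"
    if "shape n p l" for l
    using chainsD[OF assms that] by auto
  then obtain b g where bg: "\<And>l. shape n p l \<Longrightarrow> b l \<in> BB a (Suc (count_list l False))
     \<and> g l \<in> AA a (count_list l False) \<and> c l = b l + d a (g l)" by metis
  show ?thesis
  proof
    show "(\<lambda>l. if shape n p l then b l else 0) \<in> chains (\<lambda>n. BB a (Suc n)) n p"
      "(\<lambda>l. if shape n p l then g l else 0) \<in> chains (AA a) n p"
      using bg by (auto intro!: chainsI)
    show "c = (\<lambda>l. (if shape n p l then b l else 0) + d a (if shape n p l then g l else 0))"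
      using bg chains_outside[OF assms] by auto
  qed
qed

lemma chains_BB_SucI:
  assumes c: "(\<lambda>l. c l + d a (g l)) \<in> chains (\<lambda>n. BB a (Suc n)) n p" and g: "g \<in> chains (AA a) n p"
  shows "c \<in> chains (BB (Suc a)) n p"
proof (rule chainsI)
  fix l
  show "c l \<in> BB (Suc a) (count_list l False)" if "shape n p l"
  proof -
    have "(c l + d a (g l)) + d a (- g l) \<in> BB (Suc a) (count_list l False)"
      using chainsD[OF c that] chainsD[OF g that] A_sub by (intro BB_SucI) (auto simp: add_subgroup_uminus)
    then show ?thesis by (simp add: d_uminus)
  qed
  show "c l = 0" if "\<not> shape n p l"
    using chains_outside[OF c that] chains_outside[OF g that] by simp
qed

section \<open>Homology and torsion of the derivatives\<close>

text \<open>\<open>acyclic_at a p n\<close>: the homology in chain degree \<open>p\<close> and level \<open>n\<close> of the \<open>a\<close>-th derivative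
  vanishes; \<open>torsionfree_at a n\<close>: level \<open>n\<close> of the \<open>a\<close>-th derivative embeds into its shift.\<close>

definition acyclic_at :: "nat \<Rightarrow> int \<Rightarrow> nat \<Rightarrow> bool" where
  "acyclic_at a p n \<longleftrightarrow> (\<forall>c\<in>chains (AA a) n p. (\<lambda>l. bnd d l a c) \<in> chains (BB a) n (p - 1) \<longrightarrow>
     (\<exists>e\<in>chains (AA a) n (p + 1). (\<lambda>l. c l - bnd d l a e) \<in> chains (BB a) n p))"

definition torsionfree_at :: "nat \<Rightarrow> nat \<Rightarrow> bool" where
  "torsionfree_at a n \<longleftrightarrow> (\<forall>x\<in>AA a n. d a x \<in> BB a (Suc n) \<longrightarrow> x \<in> BB a n)"

lemma bnd_AA: "c \<in> chains (AA a) n p \<Longrightarrow> (\<lambda>l. bnd d l b c) \<in> chains (AA a) n (p - 1)"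
  by (rule bnd_chains) (use A_sub A_d in auto)

lemma bnd_BB: "c \<in> chains (BB a) n p \<Longrightarrow> (\<lambda>l. bnd d l a c) \<in> chains (BB a) n (p - 1)"
  by (rule bnd_chains) (use BB_sub BB_d in auto)

lemma bnd_BB_Suc: "c \<in> chains (\<lambda>n. BB a (Suc n)) n p \<Longrightarrow>
    (\<lambda>l. bnd d l (Suc a) c) \<in> chains (\<lambda>n. BB a (Suc n)) n (p - 1)"
proof (rule bnd_chains)
  show "d (Suc a + i) x \<in> BB a (Suc (Suc n))" if "x \<in> BB a (Suc n)" for i n x
    using BB_d[OF that, of "Suc i"] by simp
qed (use BB_sub in auto)


text \<open>A cycle for the derivative lifts to a chain \<open>c\<close> of the shift whose boundary
  is \<open>d a (g l)\<close> up to the denominators. The pair of \<open>c\<close> and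
  \<open>- g\<close> is a cycle of the cone once the boundary of \<open>g\<close> is trivial. That
  boundary has degree \<open>p - 2\<close>, so it vanishes for \<open>p \<le> 1\<close>; in higher
  degrees it is only known to be torsion.\<close>

lemma acyclic_Suc:
  assumes ac: "acyclic_at a p (Suc n)" and p: "p \<le> 1"
  shows "acyclic_at (Suc a) p n"
  unfolding acyclic_at_def
proof (intro ballI impI)
  fix c assume c: "c \<in> chains (AA (Suc a)) n p"
    and "(\<lambda>l. bnd d l (Suc a) c) \<in> chains (BB (Suc a)) n (p - 1)"
  then obtain b g where b: "b \<in> chains (\<lambda>n. BB a (Suc n)) n (p - 1)" and g: "g \<in> chains (AA a) n (p - 1)"
    and eq: "(\<lambda>l. bnd d l (Suc a) c) = (\<lambda>l. b l + d a (g l))"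
    by (blast elim: chains_BB_Suc)
  have "(\<lambda>l. bnd d l a g) \<in> chains (AA a) n (p - 1 - 1)" using bnd_AA g by blast
  then have bg0: "(\<lambda>l. bnd d l a g) = (\<lambda>l. 0)" using chains_neg p by force
  \<comment> \<open>The sign makes \<open>d a (- g l)\<close> cancel the term
    \<open>d a (g l)\<close> in the boundary of \<open>c\<close>.\<close>
  have c': "cone c (\<lambda>l. - g l) \<in> chains (AA a) (Suc n) p"
    using c chains_add_subgroup(3)[OF _ g g] A_sub by (simp add: chains_Suc)
  moreover have "(\<lambda>l. bnd d l a (cone c (\<lambda>l. - g l))) \<in> chains (BB a) (Suc n) (p - 1)"
    using b fun_cong[OF eq] fun_cong[OF bg0] chains_zero[OF BB_sub]
    by (simp add: chains_Suc bnd_uminus d_uminus)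
  ultimately obtain e where e: "e \<in> chains (AA a) (Suc n) (p + 1)"
    and e2: "(\<lambda>l. cone c (\<lambda>l. - g l) l - bnd d l a e) \<in> chains (BB a) (Suc n) p"
    using ac unfolding acyclic_at_def by blast
  have eF: "(\<lambda>m. e (False # m)) \<in> chains (AA (Suc a)) n (p + 1)"
    and eT: "(\<lambda>m. e (True # m)) \<in> chains (AA a) n p"
    using e by (auto simp: chains_Suc)
  have "(\<lambda>l. c l - (bnd d l (Suc a) (\<lambda>m. e (False # m)) + d a (e (True # l)))) \<in> chains (\<lambda>n. BB a (Suc n)) n p"
    using e2 by (simp add: chains_Suc)
  then have "(\<lambda>l. (c l - bnd d l (Suc a) (\<lambda>m. e (False # m))) + d a (- e (True # l))) \<in> chains (\<lambda>n. BB a (Suc n)) n p"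
    by (simp add: d_uminus algebra_simps)
  then have "(\<lambda>l. c l - bnd d l (Suc a) (\<lambda>m. e (False # m))) \<in> chains (BB (Suc a)) n p"
    by (rule chains_BB_SucI) (use chains_add_subgroup(3)[OF A_sub eT eT] in simp)
  then show "\<exists>e\<in>chains (AA (Suc a)) n (p + 1). (\<lambda>l. c l - bnd d l (Suc a) e) \<in> chains (BB (Suc a)) n p"
    using eF by blast
qed

text \<open>For systems without an action of the transpositions this fails, and with it the boundedness of
  torsion.\<close>

lemma d_torsion:
  assumes "d a x \<in> BB a (Suc n)"
  shows "d (a + i) x \<in> BB a (Suc n)"
proof (induct i)
  case (Suc i)
  then show ?case using BB_s[of "d (a + i) x" a "Suc n" i] by (simp add: sd)
qed (use assms in simp)

text \<open>A torsion element \<open>x\<close>, placed at the subset consisting of the first point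
  alone, is a 1-cycle. If \<open>e\<close> bounds it, the part \<open>eF\<close> over the shift is a
  2-cycle for the derivative; correcting by a chain that bounds \<open>eF\<close> replaces
  \<open>eT\<close> by a chain \<open>y\<close> with torsion values. Its boundary vanishes since
  every face kills torsion, and so \<open>x\<close> vanishes.\<close>

lemma torsionfree_if_acyclic:
  assumes ac2: "acyclic_at (Suc a) 2 n" and ac1: "acyclic_at a 1 (Suc n)"
  shows "torsionfree_at a n"
  unfolding torsionfree_at_def
proof (intro ballI impI)
  fix x assume x: "x \<in> AA a n" and dx: "d a x \<in> BB a (Suc n)"
  define K where "K m = {y \<in> AA a m. d a y \<in> BB a (Suc m)}" for m
  let ?F = "replicate n False"
  define c where "c = cone (\<lambda>l. 0) (\<lambda>l. if l = ?F then x else 0)"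
  have c1: "(\<lambda>l. if l = ?F then x else 0) \<in> chains (AA a) n 0"
    using x by (intro chainsI) (auto simp: shape_p0)
  have c: "c \<in> chains (AA a) (Suc n) 1"
    unfolding c_def chains_Suc using c1 A_sub by (auto intro!: chains_zero)
  have "(\<lambda>l. bnd d l a (\<lambda>l. if l = ?F then x else 0)) \<in> chains (AA a) n (-1)"
    using bnd_AA[OF c1] by simp
  then have b0: "bnd d l a (\<lambda>l. if l = ?F then x else 0) = 0" for l
    using fun_cong[OF chains_neg, of "- 1"] by simp
  have "(\<lambda>l. bnd d l a c) \<in> chains (BB a) (Suc n) (1 - 1)"
    unfolding chains_Suc
  proof (intro conjI)
    show "(\<lambda>m. bnd d (False # m) a c) \<in> chains (\<lambda>n. BB a (Suc n)) n (1 - 1)"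
      using dx by (intro chainsI) (auto simp: c_def shape_p0)
    show "(\<lambda>m. bnd d (True # m) a c) \<in> chains (BB a) n (1 - 1 - 1)"
      using b0 chains_zero[OF BB_sub] by (simp add: c_def)
  qed simp
  then obtain e where e: "e \<in> chains (AA a) (Suc n) 2"
    and ce: "(\<lambda>l. c l - bnd d l a e) \<in> chains (BB a) (Suc n) 1"
    using ac1 c unfolding acyclic_at_def by force
  define eF eT where "eF = (\<lambda>m. e (False # m))" and "eT = (\<lambda>m. e (True # m))"
  have eF: "eF \<in> chains (AA (Suc a)) n 2" and eT: "eT \<in> chains (AA a) n 1"
    using e by (auto simp: chains_Suc eF_def eT_def)
  have "(\<lambda>l. - (bnd d l (Suc a) eF + d a (eT l))) \<in> chains (\<lambda>n. BB a (Suc n)) n 1"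
    and ceT: "(\<lambda>l. (if l = ?F then x else 0) + bnd d l a eT) \<in> chains (BB a) n 0"
    using ce by (auto simp: chains_Suc c_def eF_def eT_def)
  then have 1: "(\<lambda>l. bnd d l (Suc a) eF + d a (eT l)) \<in> chains (\<lambda>n. BB a (Suc n)) n 1"
    using chains_add_subgroup(3)[of "\<lambda>n. BB a (Suc n)" _ n 1, OF BB_sub, of "\<lambda>l. - (bnd d l (Suc a) eF + d a (eT l))"] by (simp add: add.commute)
  then have "(\<lambda>l. bnd d l (Suc a) eF) \<in> chains (BB (Suc a)) n (2 - 1)"
    using eT by (intro chains_BB_SucI[where g = eT]) simp_all
  then obtain f where f: "f \<in> chains (AA (Suc a)) n (2 + 1)"
    and ef: "(\<lambda>l. eF l - bnd d l (Suc a) f) \<in> chains (BB (Suc a)) n 2"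
    using ac2 eF unfolding acyclic_at_def by blast
  then obtain b g where b: "b \<in> chains (\<lambda>n. BB a (Suc n)) n 2" and g: "g \<in> chains (AA a) n 2"
    and eq: "(\<lambda>l. eF l - bnd d l (Suc a) f) = (\<lambda>l. b l + d a (g l))"
    using chains_BB_Suc by blast
  have eF_eq: "eF = (\<lambda>l. bnd d l (Suc a) f + b l + d a (g l))"
  proof
    fix l show "eF l = bnd d l (Suc a) f + b l + d a (g l)"
      using fun_cong[OF eq, of l] by (simp add: algebra_simps)
  qed
  \<comment> \<open>\<open>y\<close> and \<open>eT\<close> differ by a boundary and hence have the
    same boundary, while \<open>d a (y l)\<close> lies in the denominators.\<close>
  define y where "y l = bnd d l a g + eT l" for l
  have "(\<lambda>l. bnd d l (Suc a) eF + d a (eT l)) = (\<lambda>l. bnd d l (Suc a) b + d a (y l))"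
    unfolding eF_eq by (simp add: bnd_add bnd_bnd bnd_d y_def d_add add.assoc)
  moreover have "(\<lambda>l. bnd d l (Suc a) b) \<in> chains (\<lambda>n. BB a (Suc n)) n 1"
    using bnd_BB_Suc[OF b] by simp
  ultimately have dy: "(\<lambda>l. d a (y l)) \<in> chains (\<lambda>n. BB a (Suc n)) n 1"
    using chains_add_subgroup(2)[OF BB_sub 1, of "\<lambda>l. bnd d l (Suc a) b"] by (simp add: fun_eq_iff)
  have "y \<in> chains (AA a) n 1"
    unfolding y_def using bnd_AA[OF g, of a] eT A_sub by (auto intro!: chains_add_subgroup)
  then have "y \<in> chains K n 1"
    using dy by (auto simp: K_def chains_outside intro!: chainsI dest: chainsD)
  then have "(\<lambda>l. bnd d l a y) \<in> chains (BB a) n (1 - 1)"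
    by (rule bnd_chains[rotated -1]) (auto simp: BB_sub K_def d_torsion)
  then have "(\<lambda>l. bnd d l a eT) \<in> chains (BB a) n 0"
    by (simp add: y_def[abs_def] bnd_add bnd_bnd)
  then have "bnd d ?F a eT \<in> BB a n"
    using chainsD[of _ "BB a" n 0 ?F] by (simp add: shape_p0)
  moreover have "x + bnd d ?F a eT \<in> BB a n"
    using chainsD[OF ceT, of ?F] by (simp add: shape_p0)
  ultimately show "x \<in> BB a n"
    using add_subgroup_diff[OF BB_sub] by fastforce
qed

text \<open>The chase of \<open>torsionfree_if_acyclic\<close> for a general cycle: subtracting the
  boundary of \<open>cone f g\<close> leaves denominators and a \<open>(p - 1)\<close>-chain
  \<open>y\<close> with torsion values. Those values have level \<open>n - (p - 1)\<close>, where
  torsion vanishes by hypothesis; for \<open>p \<le> 0\<close> the chain \<open>y\<close> has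
  negative degree.\<close>

lemma acyclic_if_Suc:
  assumes ac: "acyclic_at (Suc a) p n"
    and tf: "\<And>m. 1 \<le> p \<Longrightarrow> int m = int n - p + 1 \<Longrightarrow> torsionfree_at a m"
  shows "acyclic_at a p (Suc n)"
  unfolding acyclic_at_def
proof (intro ballI impI)
  fix c assume c: "c \<in> chains (AA a) (Suc n) p"
    and bc: "(\<lambda>l. bnd d l a c) \<in> chains (BB a) (Suc n) (p - 1)"
  define cF cT where "cF = (\<lambda>m. c (False # m))" and "cT = (\<lambda>m. c (True # m))"
  have cF: "cF \<in> chains (AA (Suc a)) n p" and cT: "cT \<in> chains (AA a) n (p - 1)" and c0: "c [] = 0"
    using c by (auto simp: chains_Suc cF_def cT_def)
  have 1: "(\<lambda>l. bnd d l (Suc a) cF + d a (cT l)) \<in> chains (\<lambda>n. BB a (Suc n)) n (p - 1)"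
    and bcT: "(\<lambda>l. - bnd d l a cT) \<in> chains (BB a) n (p - 1 - 1)"
    using bc by (auto simp: chains_Suc cF_def cT_def)
  have "(\<lambda>l. bnd d l (Suc a) cF) \<in> chains (BB (Suc a)) n (p - 1)"
    using 1 cT by (rule chains_BB_SucI)
  then obtain f where f: "f \<in> chains (AA (Suc a)) n (p + 1)"
    and ef: "(\<lambda>l. cF l - bnd d l (Suc a) f) \<in> chains (BB (Suc a)) n p"
    using ac cF unfolding acyclic_at_def by blast
  then obtain b g where b: "b \<in> chains (\<lambda>n. BB a (Suc n)) n p" and g: "g \<in> chains (AA a) n p"
    and eq: "(\<lambda>l. cF l - bnd d l (Suc a) f) = (\<lambda>l. b l + d a (g l))"
    using chains_BB_Suc by blast
  have cF_eq: "cF = (\<lambda>l. bnd d l (Suc a) f + b l + d a (g l))"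
  proof
    fix l show "cF l = bnd d l (Suc a) f + b l + d a (g l)"
      using fun_cong[OF eq, of l] by (simp add: algebra_simps)
  qed
  define y where "y l = bnd d l a g + cT l" for l
  have "(\<lambda>l. bnd d l (Suc a) cF + d a (cT l)) = (\<lambda>l. bnd d l (Suc a) b + d a (y l))"
    unfolding cF_eq by (simp add: bnd_add bnd_bnd bnd_d y_def d_add add.assoc)
  moreover have "(\<lambda>l. bnd d l (Suc a) b) \<in> chains (\<lambda>n. BB a (Suc n)) n (p - 1)"
    using bnd_BB_Suc[OF b] by simp
  ultimately have dy: "(\<lambda>l. d a (y l)) \<in> chains (\<lambda>n. BB a (Suc n)) n (p - 1)"
    using chains_add_subgroup(2)[OF BB_sub 1, of "\<lambda>l. bnd d l (Suc a) b"] by (simp add: fun_eq_iff)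
  have y: "y \<in> chains (AA a) n (p - 1)"
    unfolding y_def using bnd_AA[OF g, of a] cT A_sub by (auto intro!: chains_add_subgroup)
  have yB: "y \<in> chains (BB a) n (p - 1)"
  proof (cases "1 \<le> p")
    case True
    have "y \<in> chains (\<lambda>m. {y \<in> AA a m. d a y \<in> BB a (Suc m)}) n (p - 1)"
      using y dy by (auto simp: chains_outside intro!: chainsI dest: chainsD)
    then show ?thesis
      by (rule chains_mono_level[rotated]) (use tf[OF True] in \<open>auto simp: torsionfree_at_def\<close>)
  next
    case False
    then have "y = (\<lambda>l. 0)" using chains_neg[OF _ y] by simp
    then show ?thesis using chains_zero[OF BB_sub] by simp
  qed
  have "cone f g \<in> chains (AA a) (Suc n) (p + 1)"
    using f g by (simp add: chains_Suc)
  moreover have "(\<lambda>l. c l - bnd d l a (cone f g)) \<in> chains (BB a) (Suc n) p"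
  proof -
    have F: "c (False # m) - bnd d (False # m) a (cone f g) = b m" for m
      using fun_cong[OF cF_eq, of m] by (simp add: cF_def)
    have T: "c (True # m) - bnd d (True # m) a (cone f g) = y m" for m
      by (simp add: y_def cT_def)
    show ?thesis unfolding chains_Suc F T using c0 b yB by simp
  qed
  ultimately show "\<exists>e\<in>chains (AA a) (Suc n) (p + 1). (\<lambda>l. c l - bnd d l a e) \<in> chains (BB a) (Suc n) p"
    by blast
qed

text \<open>In degree 0, level \<open>n + 1\<close> of one derivative and level \<open>n\<close> of
  the next one are equivalent. Everything is thereby moved to level 0, where the empty set has a
  single subset and no boundary enters.\<close>

lemma acyclic_0_iff: "acyclic_at a 0 n \<longleftrightarrow> AA a n \<subseteq> BB (a + n) 0"
proof (induct n arbitrary: a)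
  case 0
  show ?case
  proof
    assume ac: "acyclic_at a 0 0"
    show "AA a 0 \<subseteq> BB (a + 0) 0"
    proof
      fix x assume x: "x \<in> AA a 0"
      define c where "c l = (if l = [] then x else 0)" for l :: "bool list"
      have "c \<in> chains (AA a) 0 0" using x by (auto simp: chains_0 c_def)
      moreover have "(\<lambda>l. bnd d l a c) \<in> chains (BB a) 0 (0 - 1)"
        using fun_cong[OF chains_neg[OF _ bnd_AA[OF calculation, of a]]] by (auto simp: chains_0)
      ultimately obtain e where "e \<in> chains (AA a) 0 (0 + 1)" "(\<lambda>l. c l - bnd d l a e) \<in> chains (BB a) 0 0"
        using ac unfolding acyclic_at_def by blast
      then show "x \<in> BB (a + 0) 0" by (auto simp: chains_0 c_def split: if_splits)
    qed
  next
    assume "AA a 0 \<subseteq> BB (a + 0) 0"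
    then show "acyclic_at a 0 0"
      unfolding acyclic_at_def
      by (intro ballI impI bexI[of _ "\<lambda>l. 0"] chains_zero A_sub) (auto simp: chains_0 split: if_splits)
  qed
next
  case (Suc n)
  have "acyclic_at a 0 (Suc n) \<longleftrightarrow> acyclic_at (Suc a) 0 n"
    using acyclic_Suc[of a 0 n] acyclic_if_Suc[of a 0 n] by auto
  then show ?case using Suc[of "Suc a"] by simp
qed

text \<open>Each recursion step of \<open>BB\<close> splits off a summand \<open>d a y\<close>;
  placing \<open>y\<close> at the subset formed by the first point alone collects these summands
  into one 1-chain. The chain keeps its values in \<open>A\<close>, which matters when
  \<open>A\<close> comes from a proper submodule.\<close>

lemma BB_boundary:
  assumes "x \<in> BB (a + n) 0"
  shows "\<exists>e\<in>chains (AA a) n 1. x - bnd d (replicate n False) a e \<in> BB a n"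
  using assms
proof (induct n arbitrary: a)
  case 0
  then show ?case using A_sub by (auto simp: chains_0 intro!: bexI[of _ "\<lambda>l. 0"])
next
  case (Suc n)
  then obtain e where e: "e \<in> chains (AA (Suc a)) n 1"
    and "x - bnd d (replicate n False) (Suc a) e \<in> BB (Suc a) n"
    using Suc.hyps[of "Suc a"] by auto
  then obtain b y where b: "b \<in> BB a (Suc n)" and y: "y \<in> AA a n"
    and eq: "x - bnd d (replicate n False) (Suc a) e = b + d a y" by auto
  let ?F = "replicate n False"
  have "cone e (\<lambda>l. if l = ?F then y else 0) \<in> chains (AA a) (Suc n) 1"
    using e y by (auto simp: chains_Suc shape_p0 intro!: chainsI dest: chainsD)
  moreover have "x - bnd d (replicate (Suc n) False) a (cone e (\<lambda>l. if l = ?F then y else 0)) = b"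
    using eq by (simp add: algebra_simps)
  ultimately show ?case using b by metis
qed

text \<open>A graded Nakayama argument: without generators every element is the boundary of a chain
  with values one level lower, and these vanish by induction on the level.\<close>

lemma AA_BB_if_acyclic:
  assumes "\<And>n. acyclic_at a 0 n"
  shows "AA a n \<subseteq> BB a n"
proof (induct n rule: less_induct)
  case (less n)
  show ?case
  proof
    fix x assume "x \<in> AA a n"
    then obtain e where e: "e \<in> chains (AA a) n 1" and xe: "x - bnd d (replicate n False) a e \<in> BB a n"
      using BB_boundary assms acyclic_0_iff by blast
    have "e \<in> chains (BB a) n 1"
      using e by (rule chains_mono_level[rotated]) (simp add: less)
    then have "(\<lambda>l. bnd d l a e) \<in> chains (BB a) n (1 - 1)" using bnd_BB by blast
    then have "bnd d (replicate n False) a e \<in> BB a n"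
      using chainsD[of _ "BB a" n 0 "replicate n False"] by (simp add: shape_p0)
    then show "x \<in> BB a n" using xe add_subgroup_add[OF BB_sub] by fastforce
  qed
qed

text \<open>Passing to the derivative lowers the generator bound \<open>D\<close> by one, keeps
  \<open>R\<close>, and \<open>D = 0\<close> means that the derivative is zero. In the step torsion
  is bounded first, from degree 2 of the derivative and degree 1 of the system itself; with that,
  each degree \<open>p\<close> of the derivative controls degree \<open>p\<close> of the
  system.\<close>

lemma acyclic_bounded:
  assumes "\<And>n. n \<ge> D \<Longrightarrow> acyclic_at a 0 n" and "\<And>n. n \<ge> R \<Longrightarrow> acyclic_at a 1 n"
  shows "(\<forall>p\<ge>0. \<exists>N. \<forall>n\<ge>N. acyclic_at a p n) \<and> (\<exists>N. \<forall>n\<ge>N. torsionfree_at a n)"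
  using assms
proof (induct D arbitrary: a)
  case 0
  have AB: "AA a n \<subseteq> BB a n" for n using AA_BB_if_acyclic 0 by blast
  have "acyclic_at a p n" for p n
    unfolding acyclic_at_def
  proof (intro ballI impI)
    fix c assume "c \<in> chains (AA a) n p"
    then have "c \<in> chains (BB a) n p" by (rule chains_mono[rotated]) (rule AB)
    then show "\<exists>e\<in>chains (AA a) n (p + 1). (\<lambda>l. c l - bnd d l a e) \<in> chains (BB a) n p"
      by (intro bexI[of _ "\<lambda>l. 0"] chains_zero A_sub) simp
  qed
  then show ?case using AB by (fastforce simp: torsionfree_at_def)
next
  case (Suc D)
  have IH: "(\<forall>p\<ge>0. \<exists>N. \<forall>n\<ge>N. acyclic_at (Suc a) p n)"
    using Suc.hyps[of "Suc a"] Suc.prems by (simp add: acyclic_Suc)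
  then obtain N2 where N2: "\<And>n. n \<ge> N2 \<Longrightarrow> acyclic_at (Suc a) 2 n" by fastforce
  have tf: "torsionfree_at a n" if "n \<ge> max N2 R" for n
    using torsionfree_if_acyclic N2 Suc.prems(2)[of "Suc n"] that by simp
  have "\<exists>N. \<forall>n\<ge>N. acyclic_at a p n" if p: "p \<ge> 0" for p
  proof -
    obtain Np where Np: "\<And>n. n \<ge> Np \<Longrightarrow> acyclic_at (Suc a) p n" using IH p by blast
    \<comment> \<open>The summand \<open>nat p\<close> keeps the level \<open>m - p + 1\<close>, in
      which torsion occurs, above the torsion bound.\<close>
    have "acyclic_at a p n" if n: "n \<ge> Suc (max Np (max N2 R + nat p))" for n
    proof -
      obtain m where m: "n = Suc m" using n by (cases n) auto
      have "acyclic_at (Suc a) p m" using Np m n by auto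
      moreover have "torsionfree_at a q" if "int q = int m - p + 1" for q
        by (rule tf) (use that m n p in linarith)
      ultimately show ?thesis unfolding m by (rule acyclic_if_Suc)
    qed
    then show ?thesis by blast
  qed
  then show ?case using tf by blast
qed

text \<open>By truncated subtraction the bound reaches 0 once \<open>a \<ge> D\<close>: high
  derivatives then satisfy the conclusion in every level.\<close>

lemma acyclic_shift_bound:
  assumes "\<And>n. n \<ge> D \<Longrightarrow> acyclic_at 0 p n" and "p \<le> 1"
  shows "n \<ge> D - a \<Longrightarrow> acyclic_at a p n"
  using assms
proof (induct a arbitrary: n)
  case (Suc a)
  then show ?case using acyclic_Suc[of a p n] by simp
qed simp

theorem torsionfree_bounded:
  assumes "\<And>n. n \<ge> D \<Longrightarrow> acyclic_at 0 0 n" and "\<And>n. n \<ge> R \<Longrightarrow> acyclic_at 0 1 n"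
  shows "\<exists>N. \<forall>a n. n \<ge> N \<longrightarrow> torsionfree_at a n"
proof -
  have "\<exists>N. \<forall>n\<ge>N. torsionfree_at a n" for a
  proof -
    have "acyclic_at a 0 n" if "n \<ge> D" for n
      using acyclic_shift_bound[OF assms(1)] that by simp
    moreover have "acyclic_at a 1 n" if "n \<ge> R" for n
      using acyclic_shift_bound[OF assms(2)] that by simp
    ultimately show ?thesis using acyclic_bounded by blast
  qed
  then obtain f where f: "\<And>a n. n \<ge> f a \<Longrightarrow> torsionfree_at a n" by metis
  have big: "torsionfree_at a n" if a: "a \<ge> D" for a n
  proof -
    have ac: "acyclic_at a 0 n" for n using acyclic_shift_bound[OF assms(1)] a by simp
    then have "AA a n \<subseteq> BB a n" for n using AA_BB_if_acyclic by blast
    then show ?thesis by (auto simp: torsionfree_at_def)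
  qed
  \<comment> \<open>From \<open>D\<close> on the derivatives are zero, so a maximum over finitely
    many \<open>a\<close> bounds them all.\<close>
  have "torsionfree_at a n" if n: "n \<ge> Max (f ` {..D})" for a n
  proof (cases "a \<le> D")
    case True
    then have "f a \<le> Max (f ` {..D})" by simp
    then show ?thesis using f n by (meson order_trans)
  qed (use big in auto)
  then show ?thesis by blast
qed

end

section \<open>Modules and the category\<close>

lemma module_abelian_group: "Module.module k M \<Longrightarrow> abelian_group M"
  by (simp add: Module.module_def)

lemma submodule_carrier: "Module.module k M \<Longrightarrow> submodule (carrier M) k M"
  by (rule Module.module.carrier_is_submodule)

lemma submodule_subset: "submodule N k M \<Longrightarrow> N \<subseteq> carrier M"
  using submodule.axioms(1)[THEN subgroup.subset] by fastforce

lemma submodule_zero: "submodule N k M \<Longrightarrow> \<zero>\<^bsub>M\<^esub> \<in> N"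
  using submodule.axioms(1)[THEN subgroup.one_closed] by fastforce

lemma submodule_add: "submodule N k M \<Longrightarrow> x \<in> N \<Longrightarrow> y \<in> N \<Longrightarrow> x \<oplus>\<^bsub>M\<^esub> y \<in> N"
  using subgroup.m_closed[OF submodule.axioms(1)] by fastforce

lemma submodule_smult: "submodule N k M \<Longrightarrow> a \<in> carrier k \<Longrightarrow> x \<in> N \<Longrightarrow> a \<odot>\<^bsub>M\<^esub> x \<in> N"
  by (rule submodule.smult_closed)

lemma submodule_a_inv: "submodule N k M \<Longrightarrow> x \<in> N \<Longrightarrow> \<ominus>\<^bsub>M\<^esub> x \<in> N"
  using subgroup.m_inv_closed[OF submodule.axioms(1)] by (fastforce simp: a_inv_def)

lemma submodule_minus: "submodule N k M \<Longrightarrow> x \<in> N \<Longrightarrow> y \<in> N \<Longrightarrow> x \<ominus>\<^bsub>M\<^esub> y \<in> N"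
  by (simp add: a_minus_def submodule_add submodule_a_inv)

lemma submodule_finsum:
  assumes "Module.module k M" and "submodule N k M" and "\<And>i. i \<in> I \<Longrightarrow> f i \<in> N"
  shows "finsum M f I \<in> N"
proof -
  interpret M: abelian_group M using assms module_abelian_group by blast
  show ?thesis using assms(3)
  proof (induct I rule: infinite_finite_induct)
    case (insert i I)
    then have "f \<in> I \<rightarrow> carrier M" "f i \<in> carrier M" using submodule_subset[OF assms(2)] by auto
    then show ?case using insert assms(2) by (simp add: submodule_add)
  qed (use assms submodule_zero in \<open>auto\<close>)
qed

lemma submoduleI':
  assumes "Module.module k M" and "N \<subseteq> carrier M" and "\<zero>\<^bsub>M\<^esub> \<in> N"
    and "\<And>x y. x \<in> N \<Longrightarrow> y \<in> N \<Longrightarrow> x \<oplus>\<^bsub>M\<^esub> y \<in> N"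
    and "\<And>a x. a \<in> carrier k \<Longrightarrow> x \<in> N \<Longrightarrow> a \<odot>\<^bsub>M\<^esub> x \<in> N"
  shows "submodule N k M"
proof -
  interpret Module.module k M by fact
  have "\<ominus>\<^bsub>M\<^esub> x \<in> N" if "x \<in> N" for x
  proof -
    have "(\<ominus>\<^bsub>k\<^esub> \<one>\<^bsub>k\<^esub>) \<odot>\<^bsub>M\<^esub> x \<in> N" using assms that by simp
    then show ?thesis using that assms(2) smult_l_minus[of "\<one>\<^bsub>k\<^esub>" x] by auto
  qed
  then show ?thesis using assms by (intro submoduleI) auto
qed

lemma mod_span_submodule:
  assumes M: "Module.module k M" and S: "S \<subseteq> carrier M"
  shows "submodule (mod_span k M S) k M"
proof (rule submoduleI'[OF M])
  show "mod_span k M S \<subseteq> carrier M"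
    using submodule_carrier[OF M] S by (auto simp: mod_span_def)
qed (auto simp: mod_span_def submodule_zero submodule_add submodule_smult)

lemma mod_span_superset: "S \<subseteq> mod_span k M S"
  by (auto simp: mod_span_def)

lemma mod_span_least: "submodule N k M \<Longrightarrow> S \<subseteq> N \<Longrightarrow> mod_span k M S \<subseteq> N"
  by (auto simp: mod_span_def)

lemma mod_hom_closed: "f \<in> mod_hom k M N \<Longrightarrow> x \<in> carrier M \<Longrightarrow> f x \<in> carrier N"
  and mod_hom_add: "f \<in> mod_hom k M N \<Longrightarrow> x \<in> carrier M \<Longrightarrow> y \<in> carrier M \<Longrightarrow> f (x \<oplus>\<^bsub>M\<^esub> y) = f x \<oplus>\<^bsub>N\<^esub> f y"
  and mod_hom_smult: "f \<in> mod_hom k M N \<Longrightarrow> a \<in> carrier k \<Longrightarrow> x \<in> carrier M \<Longrightarrow> f (a \<odot>\<^bsub>M\<^esub> x) = a \<odot>\<^bsub>N\<^esub> f x"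
  by (auto simp: mod_hom_def)

lemma mod_homI:
  assumes "\<And>x. x \<in> carrier M \<Longrightarrow> f x \<in> carrier N"
    and "\<And>x y. x \<in> carrier M \<Longrightarrow> y \<in> carrier M \<Longrightarrow> f (x \<oplus>\<^bsub>M\<^esub> y) = f x \<oplus>\<^bsub>N\<^esub> f y"
    and "\<And>a x. a \<in> carrier k \<Longrightarrow> x \<in> carrier M \<Longrightarrow> f (a \<odot>\<^bsub>M\<^esub> x) = a \<odot>\<^bsub>N\<^esub> f x"
  shows "f \<in> mod_hom k M N"
  using assms by (auto simp: mod_hom_def)

lemma mod_hom_zero:
  assumes "Module.module k M" "Module.module k N" "f \<in> mod_hom k M N"
  shows "f \<zero>\<^bsub>M\<^esub> = \<zero>\<^bsub>N\<^esub>"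
proof -
  interpret M: Module.module k M by fact
  interpret N: Module.module k N by fact
  have "f (\<zero>\<^bsub>k\<^esub> \<odot>\<^bsub>M\<^esub> \<zero>\<^bsub>M\<^esub>) = \<zero>\<^bsub>k\<^esub> \<odot>\<^bsub>N\<^esub> f \<zero>\<^bsub>M\<^esub>" by (intro mod_hom_smult[OF assms(3)]) auto
  then show ?thesis using mod_hom_closed[OF assms(3)] by simp
qed

lemma mod_hom_a_inv:
  assumes "Module.module k M" "Module.module k N" "f \<in> mod_hom k M N" "x \<in> carrier M"
  shows "f (\<ominus>\<^bsub>M\<^esub> x) = \<ominus>\<^bsub>N\<^esub> f x"
proof -
  interpret M: Module.module k M by fact
  interpret N: Module.module k N by fact
  have "f (\<ominus>\<^bsub>M\<^esub> x) \<oplus>\<^bsub>N\<^esub> f x = f (\<ominus>\<^bsub>M\<^esub> x \<oplus>\<^bsub>M\<^esub> x)" using mod_hom_add[OF assms(3)] assms(4) by simp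
  also have "\<dots> = \<zero>\<^bsub>N\<^esub>" using assms by (simp add: M.l_neg mod_hom_zero)
  finally show ?thesis using assms mod_hom_closed[OF assms(3)] by (simp add: N.minus_equality)
qed

lemma mod_hom_minus:
  assumes "Module.module k M" "Module.module k N" "f \<in> mod_hom k M N" "x \<in> carrier M" "y \<in> carrier M"
  shows "f (x \<ominus>\<^bsub>M\<^esub> y) = f x \<ominus>\<^bsub>N\<^esub> f y"
proof -
  interpret M: Module.module k M by fact
  show ?thesis using assms by (simp add: a_minus_def mod_hom_add mod_hom_a_inv)
qed

lemma mod_hom_finsum:
  assumes M: "Module.module k M" and N: "Module.module k N" and f: "f \<in> mod_hom k M N"
    and g: "\<And>i. i \<in> I \<Longrightarrow> g i \<in> carrier M"
  shows "f (finsum M g I) = finsum N (\<lambda>i. f (g i)) I"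
proof -
  interpret M: abelian_group M using M module_abelian_group by blast
  interpret N: abelian_group N using N module_abelian_group by blast
  show ?thesis using g
  proof (induct I rule: infinite_finite_induct)
    case (insert i I)
    then have "g \<in> I \<rightarrow> carrier M" "(\<lambda>i. f (g i)) \<in> I \<rightarrow> carrier N"
      using mod_hom_closed[OF f] by auto
    then show ?case using insert mod_hom_closed[OF f] by (simp add: mod_hom_add[OF f])
  qed (use mod_hom_zero[OF M N f] in auto)
qed

lemma submodule_preimage:
  assumes M: "Module.module k M" and N: "Module.module k N" and f: "f \<in> mod_hom k M N"
    and L: "submodule L k N"
  shows "submodule {x \<in> carrier M. f x \<in> L} k M"
proof -
  interpret M: Module.module k M by fact
  show ?thesis
    by (rule submoduleI'[OF M])
      (use f L in \<open>auto simp: mod_hom_zero[OF M N f] submodule_zero submodule_add mod_hom_add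
        submodule_smult mod_hom_smult\<close>)
qed

lemma submodule_trivial: "Module.module k M \<Longrightarrow> submodule {\<zero>\<^bsub>M\<^esub>} k M"
proof -
  assume M: "Module.module k M"
  interpret Module.module k M by fact
  show ?thesis by (rule submoduleI'[OF M]) auto
qed

section \<open>Factorisation and extension of morphisms, faces and transpositions\<close>

lemma mor_iff:
  "\<phi> \<in> mor G m n \<longleftrightarrow> fst \<phi> \<in> {1..m} \<rightarrow>\<^sub>E {1..n} \<and> inj_on (fst \<phi>) {1..m} \<and> snd \<phi> \<in> {1..m} \<rightarrow>\<^sub>E carrier G"
  by (cases \<phi>) (simp add: mor_def)

lemma mor_comp_fst: "i \<in> {1..l} \<Longrightarrow> fst (mor_comp G l \<phi> \<psi>) i = fst \<phi> (fst \<psi> i)"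
  and mor_comp_snd: "i \<in> {1..l} \<Longrightarrow> snd (mor_comp G l \<phi> \<psi>) i = snd \<phi> (fst \<psi> i) \<otimes>\<^bsub>G\<^esub> snd \<psi> i"
  by (auto simp: mor_comp_def)

lemma mor_eqI:
  assumes "\<phi> \<in> mor G m n" "\<psi> \<in> mor G m n'"
    and "\<And>i. i \<in> {1..m} \<Longrightarrow> fst \<phi> i = fst \<psi> i" "\<And>i. i \<in> {1..m} \<Longrightarrow> snd \<phi> i = snd \<psi> i"
  shows "\<phi> = \<psi>"
proof (rule prod_eqI)
  show "fst \<phi> = fst \<psi>" "snd \<phi> = snd \<psi>"
    using assms(1,2) unfolding mor_iff PiE_def by (intro extensionalityI[of _ "{1..m}"] assms(3,4); blast)+
qed

lemma restrict_morI:
  assumes "\<And>i. i \<in> {1..m} \<Longrightarrow> u i \<in> {1..n}" "inj_on u {1..m}" "\<And>i. i \<in> {1..m} \<Longrightarrow> g i \<in> carrier G"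
  shows "(\<lambda>i\<in>{1..m}. u i, \<lambda>i\<in>{1..m}. g i) \<in> mor G m n"
  unfolding mor_iff fst_conv snd_conv using assms by (simp add: inj_on_restrict_eq PiE_iff del: atLeastAtMost_iff)

abbreviation mor_image :: "nat \<Rightarrow> 'g mor \<Rightarrow> nat set" where
  "mor_image m \<phi> \<equiv> fst \<phi> ` {1..m}"

text \<open>Its image misses exactly the point \<open>i + 1\<close>, so \<open>i\<close> counts the
  points before the inserted one. This agrees with the index in \<open>bnd\<close>, which counts the
  earlier entries \<open>False\<close>.\<close>

definition face :: "('g, 'x) monoid_scheme \<Rightarrow> nat \<Rightarrow> nat \<Rightarrow> 'g mor" where
  "face G n i = (\<lambda>j\<in>{1..n}. if j \<le> i then j else Suc j, \<lambda>j\<in>{1..n}. \<one>\<^bsub>G\<^esub>)"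

definition swap :: "('g, 'x) monoid_scheme \<Rightarrow> nat \<Rightarrow> nat \<Rightarrow> 'g mor" where
  "swap G n i = (\<lambda>j\<in>{1..n}. if j = i + 1 then i + 2 else if j = i + 2 then i + 1 else j,
     \<lambda>j\<in>{1..n}. \<one>\<^bsub>G\<^esub>)"

locale FIG =
  fixes G :: "('g, 'x) monoid_scheme" and k :: "('k, 'y) ring_scheme"
  assumes grp: "group G" and kcring: "cring k"
begin

lemma mor_fst: "\<phi> \<in> mor G m n \<Longrightarrow> i \<in> {1..m} \<Longrightarrow> fst \<phi> i \<in> {1..n}"
  and mor_snd: "\<phi> \<in> mor G m n \<Longrightarrow> i \<in> {1..m} \<Longrightarrow> snd \<phi> i \<in> carrier G"
  and mor_inj: "\<phi> \<in> mor G m n \<Longrightarrow> inj_on (fst \<phi>) {1..m}"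
  unfolding mor_iff by blast+

lemma mor_le: "\<phi> \<in> mor G m n \<Longrightarrow> m \<le> n"
  using card_inj_on_le[of "fst \<phi>" "{1..m}" "{1..n}"] unfolding mor_iff by auto

lemma mor_comp_closed: "\<phi> \<in> mor G m n \<Longrightarrow> \<psi> \<in> mor G l m \<Longrightarrow> mor_comp G l \<phi> \<psi> \<in> mor G l n"
proof -
  assume a: "\<phi> \<in> mor G m n" "\<psi> \<in> mor G l m"
  interpret group G by (rule grp)
  have "inj_on (\<lambda>i. fst \<phi> (fst \<psi> i)) {1..l}"
    by (rule inj_onI) (meson a inj_onD mor_inj mor_fst)
  then show ?thesis
    unfolding mor_comp_def by (rule restrict_morI[rotated]) (meson a mor_fst mor_snd m_closed)+
qed

lemma mor_comp_assoc:
  assumes "\<chi> \<in> mor G n p" "\<phi> \<in> mor G m n" "\<psi> \<in> mor G l m"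
  shows "mor_comp G l \<chi> (mor_comp G l \<phi> \<psi>) = mor_comp G l (mor_comp G m \<chi> \<phi>) \<psi>"
proof -
  interpret group G by (rule grp)
  have "fst \<psi> i \<in> {1..m}" "fst \<phi> (fst \<psi> i) \<in> {1..n}" if "i \<in> {1..l}" for i
    using assms that mor_fst by blast+
  then show ?thesis unfolding mor_comp_def
    using assms mor_snd by (auto intro!: restrict_ext simp: m_assoc mor_snd)
qed

lemma mor_id_closed: "mor_id G m \<in> mor G m m"
proof -
  interpret group G by (rule grp)
  show ?thesis by (auto simp: mor_iff mor_id_def inj_on_def)
qed

lemma mor_comp_id_left: "\<phi> \<in> mor G m n \<Longrightarrow> mor_comp G m (mor_id G n) \<phi> = \<phi>"
proof -
  interpret group G by (rule grp)
  assume a: "\<phi> \<in> mor G m n"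
  show ?thesis
    by (rule mor_eqI[OF mor_comp_closed[OF mor_id_closed a] a])
      (use mor_fst[OF a] mor_snd[OF a] in \<open>auto simp: mor_comp_def mor_id_def\<close>)
qed

lemma mor_comp_id_right: "\<phi> \<in> mor G m n \<Longrightarrow> mor_comp G m \<phi> (mor_id G m) = \<phi>"
proof -
  interpret group G by (rule grp)
  assume a: "\<phi> \<in> mor G m n"
  show ?thesis
    by (rule mor_eqI[OF mor_comp_closed[OF a mor_id_closed] a])
      (use mor_fst[OF a] mor_snd[OF a] in \<open>auto simp: mor_comp_def mor_id_def\<close>)
qed

lemma mor_left_cancel:
  assumes "\<phi> \<in> mor G m n" "\<psi> \<in> mor G l m" "\<psi>' \<in> mor G l m" "mor_comp G l \<phi> \<psi> = mor_comp G l \<phi> \<psi>'"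
  shows "\<psi> = \<psi>'"
proof (rule mor_eqI[OF assms(2,3)])
  interpret group G by (rule grp)
  fix i assume i: "i \<in> {1..l}"
  have "fst \<phi> (fst \<psi> i) = fst \<phi> (fst \<psi>' i)" "snd \<phi> (fst \<psi> i) \<otimes>\<^bsub>G\<^esub> snd \<psi> i = snd \<phi> (fst \<psi>' i) \<otimes>\<^bsub>G\<^esub> snd \<psi>' i"
    using assms(4) mor_comp_fst[OF i] mor_comp_snd[OF i] by metis+
  then show f: "fst \<psi> i = fst \<psi>' i" "snd \<psi> i = snd \<psi>' i"
    using mor_inj[OF assms(1)] mor_fst[OF assms(2) i] mor_fst[OF assms(3) i] mor_snd[OF assms(2) i]
      mor_snd[OF assms(3) i] mor_snd[OF assms(1) mor_fst[OF assms(2) i]]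
    by (auto dest: inj_onD)
qed

text \<open>Injectivity of \<open>\<iota>\<close> determines the points, and the composition rule
  then forces the labels: those of \<open>\<beta>\<close> divided on the left by those of
  \<open>\<iota>\<close>.\<close>

lemma mor_factor:
  assumes \<beta>: "\<beta> \<in> mor G j n" and \<iota>: "\<iota> \<in> mor G m n" and sub: "mor_image j \<beta> \<subseteq> mor_image m \<iota>"
  obtains \<gamma> where "\<gamma> \<in> mor G j m" "\<beta> = mor_comp G j \<iota> \<gamma>"
proof -
  interpret group G by (rule grp)
  define u where "u i = inv_into {1..m} (fst \<iota>) (fst \<beta> i)" for i
  define \<gamma> where "\<gamma> = (\<lambda>i\<in>{1..j}. u i, \<lambda>i\<in>{1..j}. inv\<^bsub>G\<^esub> (snd \<iota> (u i)) \<otimes>\<^bsub>G\<^esub> snd \<beta> i)"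
  have u: "u i \<in> {1..m}" "fst \<iota> (u i) = fst \<beta> i" if "i \<in> {1..j}" for i
    using that sub inv_into_into[of "fst \<beta> i" "fst \<iota>" "{1..m}"] f_inv_into_f[of "fst \<beta> i" "fst \<iota>" "{1..m}"]
    unfolding u_def by blast+
  have "inj_on u {1..j}"
    by (rule inj_onI) (metis u(2) inj_onD mor_inj[OF \<beta>])
  then have \<gamma>: "\<gamma> \<in> mor G j m"
    unfolding \<gamma>_def using u(1) mor_snd[OF \<iota>] mor_snd[OF \<beta>] by (intro restrict_morI) blast+
  moreover have "\<beta> = mor_comp G j \<iota> \<gamma>"
  proof (rule mor_eqI[OF \<beta> mor_comp_closed[OF \<iota> \<gamma>]])
    fix i assume i: "i \<in> {1..j}"
    show "fst \<beta> i = fst (mor_comp G j \<iota> \<gamma>) i" "snd \<beta> i = snd (mor_comp G j \<iota> \<gamma>) i"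
      using u[OF i] i mor_snd[OF \<iota> u(1)[OF i]] mor_snd[OF \<beta> i]
      by (auto simp: mor_comp_fst mor_comp_snd \<gamma>_def m_assoc[symmetric])
  qed
  ultimately show ?thesis using that by blast
qed

lemma mor_image_self: "\<sigma> \<in> mor G m m \<Longrightarrow> mor_image m \<sigma> = {1..m}"
  using mor_inj mor_fst by (intro endo_inj_surj) blast+

lemma mor_inverse:
  assumes "\<sigma> \<in> mor G m m"
  obtains \<tau> where "\<tau> \<in> mor G m m" "mor_comp G m \<sigma> \<tau> = mor_id G m" "mor_comp G m \<tau> \<sigma> = mor_id G m"
proof -
  obtain \<tau> where \<tau>: "\<tau> \<in> mor G m m" "mor_id G m = mor_comp G m \<sigma> \<tau>"
    using mor_factor[OF mor_id_closed assms] mor_image_self[OF assms] mor_image_self[OF mor_id_closed]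
    by blast
  have "mor_comp G m \<sigma> (mor_comp G m \<tau> \<sigma>) = mor_comp G m \<sigma> (mor_id G m)"
    using assms \<tau> by (simp add: mor_comp_assoc[OF assms \<tau>(1) assms] \<tau>(2)[symmetric] mor_comp_id_left mor_comp_id_right)
  then have "mor_comp G m \<tau> \<sigma> = mor_id G m"
    using mor_left_cancel[OF assms] mor_comp_closed \<tau> assms mor_id_closed by blast
  then show ?thesis using \<tau> that by simp
qed

text \<open>Automorphisms of \<open>[r]\<close> act transitively on the morphisms from
  \<open>[p]\<close> to \<open>[r]\<close>: the images are matched with quotients of labels, and the
  complements, being of equal size, by any bijection with trivial labels. This brings arbitrary
  morphisms into a standard form.\<close>

lemma mor_extend:
  assumes \<theta>: "\<theta> \<in> mor G p r" and e: "e \<in> mor G p r"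
  obtains \<sigma> where "\<sigma> \<in> mor G r r" "mor_comp G p \<sigma> \<theta> = e"
proof -
  interpret group G by (rule grp)
  have sub: "mor_image p \<theta> \<subseteq> {1..r}" "mor_image p e \<subseteq> {1..r}" using mor_fst \<theta> e by blast+
  have "card ({1..r} - mor_image p \<theta>) = card ({1..r} - mor_image p e)"
    using sub card_image[OF mor_inj[OF \<theta>]] card_image[OF mor_inj[OF e]] by (simp add: card_Diff_subset)
  then obtain h where h: "bij_betw h ({1..r} - mor_image p \<theta>) ({1..r} - mor_image p e)"
    using finite_same_card_bij by (metis finite_Diff finite_atLeastAtMost)
  define u where "u = inv_into {1..p} (fst \<theta>)"
  have u: "u (fst \<theta> i) = i" if "i \<in> {1..p}" for i
    using that mor_inj[OF \<theta>] by (simp add: u_def)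
  define \<sigma> where "\<sigma> = (\<lambda>x\<in>{1..r}. if x \<in> mor_image p \<theta> then fst e (u x) else h x,
     \<lambda>x\<in>{1..r}. if x \<in> mor_image p \<theta> then snd e (u x) \<otimes>\<^bsub>G\<^esub> inv\<^bsub>G\<^esub> (snd \<theta> (u x)) else \<one>\<^bsub>G\<^esub>)"
  have hin: "h x \<in> {1..r}" "h x \<notin> mor_image p e" if "x \<in> {1..r}" "x \<notin> mor_image p \<theta>" for x
    using bij_betw_apply[OF h, of x] that by blast+
  have ein: "fst e i \<in> mor_image p e" if "i \<in> {1..p}" for i using that by blast
  have "inj_on (\<lambda>x. if x \<in> mor_image p \<theta> then fst e (u x) else h x) {1..r}"
  proof (rule inj_onI)
    fix x y assume xy: "x \<in> {1..r}" "y \<in> {1..r}"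
      "(if x \<in> mor_image p \<theta> then fst e (u x) else h x) = (if y \<in> mor_image p \<theta> then fst e (u y) else h y)"
    show "x = y"
    proof (cases "x \<in> mor_image p \<theta>"; cases "y \<in> mor_image p \<theta>")
      assume "x \<in> mor_image p \<theta>" "y \<in> mor_image p \<theta>"
      then obtain i j where "i \<in> {1..p}" "j \<in> {1..p}" "x = fst \<theta> i" "y = fst \<theta> j" by blast
      then show ?thesis using xy(3) u mor_inj[OF e] by (auto dest: inj_onD)
    next
      assume "x \<notin> mor_image p \<theta>" "y \<notin> mor_image p \<theta>"
      then show ?thesis using xy h by (auto simp: bij_betw_def dest: inj_onD)
    next
      assume 1: "x \<in> mor_image p \<theta>" "y \<notin> mor_image p \<theta>"
      then obtain i where "i \<in> {1..p}" "x = fst \<theta> i" by blast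
      then show ?thesis using 1 xy u hin(2)[OF xy(2)] ein[of i] by auto
    next
      assume 1: "x \<notin> mor_image p \<theta>" "y \<in> mor_image p \<theta>"
      then obtain i where "i \<in> {1..p}" "y = fst \<theta> i" by blast
      then show ?thesis using 1 xy u hin(2)[OF xy(1)] ein[of i] by auto
    qed
  qed
  moreover have "(if x \<in> mor_image p \<theta> then fst e (u x) else h x) \<in> {1..r}" if "x \<in> {1..r}" for x
  proof (cases "x \<in> mor_image p \<theta>")
    case True
    then obtain i where "i \<in> {1..p}" "x = fst \<theta> i" by blast
    then show ?thesis using u mor_fst[OF e] True by simp
  qed (use that hin in simp)
  moreover have "(if x \<in> mor_image p \<theta> then snd e (u x) \<otimes>\<^bsub>G\<^esub> inv\<^bsub>G\<^esub> (snd \<theta> (u x)) else \<one>\<^bsub>G\<^esub>) \<in> carrier G"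
    if "x \<in> {1..r}" for x
  proof (cases "x \<in> mor_image p \<theta>")
    case True
    then obtain i where "i \<in> {1..p}" "x = fst \<theta> i" by blast
    then show ?thesis using u mor_snd[OF e] mor_snd[OF \<theta>] True by simp
  qed simp
  ultimately have \<sigma>: "\<sigma> \<in> mor G r r" unfolding \<sigma>_def by (intro restrict_morI)
  moreover have "mor_comp G p \<sigma> \<theta> = e"
  proof (rule mor_eqI[OF mor_comp_closed[OF \<sigma> \<theta>] e])
    fix i assume i: "i \<in> {1..p}"
    have "fst \<theta> i \<in> {1..r}" "fst \<theta> i \<in> mor_image p \<theta>" using i mor_fst[OF \<theta>] by blast+
    then show "fst (mor_comp G p \<sigma> \<theta>) i = fst e i" "snd (mor_comp G p \<sigma> \<theta>) i = snd e i"
      using i u[OF i] mor_snd[OF e i] mor_snd[OF \<theta> i]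
      by (auto simp: mor_comp_fst mor_comp_snd \<sigma>_def m_assoc)
  qed
  ultimately show ?thesis using that by blast
qed


lemma face_closed: "face G n i \<in> mor G n (Suc n)"
  unfolding face_def using group.is_monoid[OF grp]
  by (intro restrict_morI inj_onI) (auto simp: monoid.one_closed split: if_split_asm)

lemma face_image: "i \<le> n \<Longrightarrow> mor_image n (face G n i) = {1..Suc n} - {Suc i}"
proof
  assume i: "i \<le> n"
  show "mor_image n (face G n i) \<subseteq> {1..Suc n} - {Suc i}" by (auto simp: face_def)
  show "{1..Suc n} - {Suc i} \<subseteq> mor_image n (face G n i)"
  proof
    fix x assume x: "x \<in> {1..Suc n} - {Suc i}"
    show "x \<in> mor_image n (face G n i)"
      by (rule image_eqI[of _ _ "if x \<le> i then x else x - 1"]) (use x i in \<open>auto simp: face_def\<close>)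
  qed
qed

lemma swap_closed: "i + 2 \<le> n \<Longrightarrow> swap G n i \<in> mor G n n"
  unfolding swap_def using group.is_monoid[OF grp]
  by (intro restrict_morI inj_onI) (auto simp: monoid.one_closed split: if_split_asm)

lemma face_face: "i \<le> j \<Longrightarrow> j \<le> n \<Longrightarrow>
    mor_comp G n (face G (Suc n) (Suc j)) (face G n i) = mor_comp G n (face G (Suc n) i) (face G n j)"
  unfolding mor_comp_def face_def by (intro arg_cong2[where f = Pair] restrict_ext) auto

lemma swap_face: "i < n \<Longrightarrow> mor_comp G n (swap G (Suc n) i) (face G n i) = face G n (Suc i)"
  unfolding mor_comp_def face_def swap_def using group.is_monoid[OF grp]
  by (intro arg_cong2[where f = Pair] restrict_ext) (auto simp: monoid.l_one)

lemma swap_face': "i \<le> j \<Longrightarrow> j + 2 \<le> n \<Longrightarrow>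
    mor_comp G n (swap G (Suc n) (Suc j)) (face G n i) = mor_comp G n (face G n i) (swap G n j)"
  unfolding mor_comp_def face_def swap_def using group.is_monoid[OF grp]
  by (intro arg_cong2[where f = Pair] restrict_ext) (auto simp: monoid.l_one)

text \<open>Reduces images of arbitrary morphisms that miss a point to images of faces.\<close>

lemma mor_missing_factor:
  assumes "\<beta> \<in> mor G j (Suc m)" "z \<le> m" "Suc z \<notin> mor_image j \<beta>"
  obtains \<gamma> where "\<gamma> \<in> mor G j m" "\<beta> = mor_comp G j (face G m z) \<gamma>"
proof -
  have "fst \<beta> i \<in> {1..Suc m} - {Suc z}" if "i \<in> {1..j}" for i
  proof -
    have "fst \<beta> i \<noteq> Suc z" using assms(3) that by (metis imageI)
    then show ?thesis using mor_fst[OF assms(1) that] by blast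
  qed
  then have "mor_image j \<beta> \<subseteq> mor_image m (face G m z)"
    unfolding face_image[OF assms(2)] by (rule image_subsetI)
  from mor_factor[OF assms(1) face_closed this] show thesis using that .
qed

section \<open>Elementary facts on C-modules\<close>

lemma cmodule_module: "cmodule G k V \<Longrightarrow> Module.module k (obj V n)"
  and cmodule_act: "cmodule G k V \<Longrightarrow> \<phi> \<in> mor G m n \<Longrightarrow> act V m n \<phi> \<in> mod_hom k (obj V m) (obj V n)"
  and cmodule_id: "cmodule G k V \<Longrightarrow> v \<in> carrier (obj V n) \<Longrightarrow> act V n n (mor_id G n) v = v"
  and cmodule_comp: "cmodule G k V \<Longrightarrow> \<psi> \<in> mor G l m \<Longrightarrow> \<phi> \<in> mor G m n \<Longrightarrow> v \<in> carrier (obj V l) \<Longrightarrow>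
        act V l n (mor_comp G l \<phi> \<psi>) v = act V m n \<phi> (act V l m \<psi> v)"
  by (simp_all add: cmodule_def)

lemma cmodule_abelian: "cmodule G k V \<Longrightarrow> abelian_group (obj V n)"
  using cmodule_module module_abelian_group by blast

lemma act_closed: "cmodule G k V \<Longrightarrow> \<phi> \<in> mor G m n \<Longrightarrow> v \<in> carrier (obj V m) \<Longrightarrow> act V m n \<phi> v \<in> carrier (obj V n)"
  by (rule mod_hom_closed[OF cmodule_act])

lemma act_zero: "cmodule G k V \<Longrightarrow> \<phi> \<in> mor G m n \<Longrightarrow> act V m n \<phi> \<zero>\<^bsub>obj V m\<^esub> = \<zero>\<^bsub>obj V n\<^esub>"
  by (rule mod_hom_zero[OF cmodule_module cmodule_module cmodule_act])

lemma csubmodule_submodule: "csubmodule G k V W \<Longrightarrow> submodule (W n) k (obj V n)"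
  and csubmodule_act: "csubmodule G k V W \<Longrightarrow> \<phi> \<in> mor G m n \<Longrightarrow> v \<in> W m \<Longrightarrow> act V m n \<phi> v \<in> W n"
  by (auto simp: csubmodule_def image_subset_iff)

lemma csubmodule_subset: "csubmodule G k V W \<Longrightarrow> W n \<subseteq> carrier (obj V n)"
  by (rule submodule_subset[OF csubmodule_submodule])

lemma csubmodule_carrier: "cmodule G k V \<Longrightarrow> csubmodule G k V (\<lambda>n. carrier (obj V n))"
  by (auto simp: csubmodule_def cmodule_module submodule_carrier act_closed)

end

section \<open>Derivatives\<close>

lemma submodule_sum_image:
  assumes M: "Module.module k M" and N: "Module.module k N" and f: "f \<in> mod_hom k N M"
    and L: "submodule L k M" and W: "submodule W k N"
  shows "submodule {u \<oplus>\<^bsub>M\<^esub> f y | u y. u \<in> L \<and> y \<in> W} k M"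
proof -
  interpret M: Module.module k M by fact
  interpret N: Module.module k N by fact
  have fc: "f y \<in> carrier M" "y \<in> carrier N" if "y \<in> W" for y
    using that submodule_subset[OF W] mod_hom_closed[OF f] by auto
  have uc: "u \<in> carrier M" if "u \<in> L" for u using that submodule_subset[OF L] by auto
  have in': "x \<in> {u \<oplus>\<^bsub>M\<^esub> f y | u y. u \<in> L \<and> y \<in> W}" if "x = u \<oplus>\<^bsub>M\<^esub> f y" "u \<in> L" "y \<in> W" for x u y
    using that by blast
  show ?thesis
  proof (rule submoduleI'[OF M])
    show "{u \<oplus>\<^bsub>M\<^esub> f y | u y. u \<in> L \<and> y \<in> W} \<subseteq> carrier M" using fc uc by auto
    show "\<zero>\<^bsub>M\<^esub> \<in> {u \<oplus>\<^bsub>M\<^esub> f y | u y. u \<in> L \<and> y \<in> W}"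
      by (rule in'[OF _ submodule_zero[OF L] submodule_zero[OF W]]) (simp add: mod_hom_zero[OF N M f])
  next
    fix x x' assume "x \<in> {u \<oplus>\<^bsub>M\<^esub> f y | u y. u \<in> L \<and> y \<in> W}" "x' \<in> {u \<oplus>\<^bsub>M\<^esub> f y | u y. u \<in> L \<and> y \<in> W}"
    then obtain u y u' y' where *: "x = u \<oplus>\<^bsub>M\<^esub> f y" "u \<in> L" "y \<in> W" "x' = u' \<oplus>\<^bsub>M\<^esub> f y'" "u' \<in> L" "y' \<in> W"
      by blast
    show "x \<oplus>\<^bsub>M\<^esub> x' \<in> {u \<oplus>\<^bsub>M\<^esub> f y | u y. u \<in> L \<and> y \<in> W}"
      by (rule in'[OF _ submodule_add[OF L *(2,5)] submodule_add[OF W *(3,6)]])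
        (use * fc uc in \<open>simp add: mod_hom_add[OF f] M.a_ac\<close>)
  next
    fix a x assume a: "a \<in> carrier k" and "x \<in> {u \<oplus>\<^bsub>M\<^esub> f y | u y. u \<in> L \<and> y \<in> W}"
    then obtain u y where *: "x = u \<oplus>\<^bsub>M\<^esub> f y" "u \<in> L" "y \<in> W" by blast
    show "a \<odot>\<^bsub>M\<^esub> x \<in> {u \<oplus>\<^bsub>M\<^esub> f y | u y. u \<in> L \<and> y \<in> W}"
      by (rule in'[OF _ submodule_smult[OF L a *(2)] submodule_smult[OF W a *(3)]])
        (use * fc uc a in \<open>simp add: mod_hom_smult[OF f] M.smult_r_distr\<close>)
  qed
qed

text \<open>The submodule of \<open>V\<^sub>m\<close> spanned by the images of all morphisms into \<open>[m]\<close> that miss a point of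
  \<open>Z\<close>; the quotient by it is the value at \<open>[m] - Z\<close> of the iterated derivative of \<open>V\<close>.\<close>

definition deficient ::
  "('g, 'x) monoid_scheme \<Rightarrow> ('k, 'y) ring_scheme \<Rightarrow> ('k, 'g, 'a) cmod \<Rightarrow> nat set \<Rightarrow> nat \<Rightarrow> 'a set" where
  "deficient G k V Z m = mod_span k (obj V m)
     (\<Union>j. \<Union>\<beta>\<in>{\<beta> \<in> mor G j m. \<not> Z \<subseteq> mor_image j \<beta>}. act V j m \<beta> ` carrier (obj V j))"

text \<open>The counterpart of \<open>BB\<close> inside \<open>V\<close> in degree
  \<open>n + a\<close>: the sum of the images of \<open>W\<close> under the first \<open>a\<close>
  faces. \<open>W\<close> is a parameter because, for a submodule \<open>K\<close> of
  \<open>P\<close>, the sum for \<open>K\<close> with \<open>n = 0\<close> is the decomposable part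
  of \<open>K\<close> itself, formed inside \<open>P\<close>.\<close>

primrec face_sum ::
  "('g, 'x) monoid_scheme \<Rightarrow> ('k, 'g, 'a) cmod \<Rightarrow> (nat \<Rightarrow> 'a set) \<Rightarrow> nat \<Rightarrow> nat \<Rightarrow> 'a set" where
  "face_sum G V W 0 n = {\<zero>\<^bsub>obj V n\<^esub>}"
| "face_sum G V W (Suc a) n = {u \<oplus>\<^bsub>obj V (Suc (n + a))\<^esub> act V (n + a) (Suc (n + a)) (face G (n + a) a) y | u y.
     u \<in> face_sum G V W a (Suc n) \<and> y \<in> W (n + a)}"

declare face_sum.simps(2) [simp del]

definition cmod_hom ::
  "('g, 'x) monoid_scheme \<Rightarrow> ('k, 'y) ring_scheme \<Rightarrow> ('k, 'g, 'a) cmod \<Rightarrow> ('k, 'g, 'b) cmod \<Rightarrow>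
    (nat \<Rightarrow> 'a \<Rightarrow> 'b) \<Rightarrow> bool" where
  "cmod_hom G k V U \<eta> \<longleftrightarrow> (\<forall>n. \<eta> n \<in> mod_hom k (obj V n) (obj U n))
     \<and> (\<forall>m n. \<forall>\<phi>\<in>mor G m n. \<forall>v\<in>carrier (obj V m). \<eta> n (act V m n \<phi> v) = act U m n \<phi> (\<eta> m v))"

context FIG
begin

lemma cmod_hom_mod_hom: "cmod_hom G k V U \<eta> \<Longrightarrow> \<eta> n \<in> mod_hom k (obj V n) (obj U n)"
  and cmod_hom_act: "cmod_hom G k V U \<eta> \<Longrightarrow> \<phi> \<in> mor G m n \<Longrightarrow> v \<in> carrier (obj V m) \<Longrightarrow>
     \<eta> n (act V m n \<phi> v) = act U m n \<phi> (\<eta> m v)"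
  by (simp_all add: cmod_hom_def)

lemma face_sum_SucI:
  "u \<in> face_sum G V W a (Suc n) \<Longrightarrow> y \<in> W (n + a) \<Longrightarrow>
    u \<oplus>\<^bsub>obj V (Suc (n + a))\<^esub> act V (n + a) (Suc (n + a)) (face G (n + a) a) y \<in> face_sum G V W (Suc a) n"
  unfolding face_sum.simps(2) by blast

lemma face_sum_SucE:
  assumes "x \<in> face_sum G V W (Suc a) n"
  obtains u y where "u \<in> face_sum G V W a (Suc n)" "y \<in> W (n + a)"
    "x = u \<oplus>\<^bsub>obj V (Suc (n + a))\<^esub> act V (n + a) (Suc (n + a)) (face G (n + a) a) y"
  using assms unfolding face_sum.simps(2) by blast

lemma face_sum_submodule:
  assumes V: "cmodule G k V" and W: "csubmodule G k V W"
  shows "submodule (face_sum G V W a n) k (obj V (n + a))"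
proof (induct a arbitrary: n)
  case 0
  show ?case using submodule_trivial[OF cmodule_module[OF V]] by simp
next
  case (Suc a)
  show ?case
    using submodule_sum_image[OF cmodule_module[OF V] cmodule_module[OF V] cmodule_act[OF V face_closed]
      Suc[of "Suc n", simplified] csubmodule_submodule[OF W]] by (simp add: face_sum.simps(2))
qed


lemma face_in_face_sum:
  assumes V: "cmodule G k V" and W: "csubmodule G k V W" and "z \<le> a" and "y \<in> W (n + a)"
  shows "act V (n + a) (Suc (n + a)) (face G (n + a) z) y \<in> face_sum G V W (Suc a) n"
  using assms(3,4)
proof (induct a arbitrary: n)
  case 0
  interpret abelian_group "obj V (Suc n)" by (rule cmodule_abelian[OF V])
  have "y \<in> carrier (obj V n)" using 0 csubmodule_subset[OF W] by auto
  then have "act V n (Suc n) (face G n 0) y \<in> carrier (obj V (Suc n))" by (rule act_closed[OF V face_closed])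
  then show ?case using face_sum_SucI[of "\<zero>\<^bsub>obj V (Suc n)\<^esub>" V W 0 n y] 0 by simp
next
  case (Suc a)
  interpret abelian_group "obj V (Suc (n + Suc a))" by (rule cmodule_abelian[OF V])
  show ?case
  proof (cases "z = Suc a")
    case True
    have "y \<in> carrier (obj V (n + Suc a))" using Suc csubmodule_subset[OF W] by auto
    then have "act V (n + Suc a) (Suc (n + Suc a)) (face G (n + Suc a) z) y \<in> carrier (obj V (Suc (n + Suc a)))"
      by (rule act_closed[OF V face_closed])
    moreover have "\<zero>\<^bsub>obj V (Suc (n + Suc a))\<^esub> \<in> face_sum G V W (Suc a) (Suc n)"
      using submodule_zero[OF face_sum_submodule[OF V W, of "Suc a" "Suc n"]] by simp
    from face_sum_SucI[OF this Suc.prems(2)] calculation show ?thesis unfolding True by (simp only: l_zero)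
  next
    case False
    then have 1: "act V (n + Suc a) (Suc (n + Suc a)) (face G (n + Suc a) z) y \<in> face_sum G V W (Suc a) (Suc n)"
      using Suc.hyps[of "Suc n"] Suc.prems by simp
    then have "act V (n + Suc a) (Suc (n + Suc a)) (face G (n + Suc a) z) y \<in> carrier (obj V (Suc (n + Suc a)))"
      using submodule_subset[OF face_sum_submodule[OF V W, of "Suc a" "Suc n"]] by auto
    moreover have "\<zero>\<^bsub>obj V (n + Suc a)\<^esub> \<in> W (n + Suc a)"
      by (rule submodule_zero[OF csubmodule_submodule[OF W]])
    from face_sum_SucI[OF 1 this] calculation show ?thesis
      by (simp only: act_zero[OF V face_closed] r_zero)
  qed
qed

text \<open>A missed point among the first \<open>a\<close> lets \<open>\<beta>\<close> factor
  through one of the first \<open>a\<close> faces, and \<open>W\<close> is stable under the other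
  factor.\<close>

lemma missing_in_face_sum:
  assumes V: "cmodule G k V" and W: "csubmodule G k V W"
    and \<beta>: "\<beta> \<in> mor G j (n + a)" and miss: "\<not> {1..a} \<subseteq> mor_image j \<beta>" and y: "y \<in> W j"
  shows "act V j (n + a) \<beta> y \<in> face_sum G V W a n"
proof -
  obtain z' where "z' \<in> {1..a}" "z' \<notin> mor_image j \<beta>" using miss by blast
  moreover then obtain z where z': "z' = Suc z" by (cases z') auto
  moreover obtain b where a: "a = Suc b" using \<open>z' \<in> {1..a}\<close> by (cases a) auto
  ultimately have z: "z \<le> b" "Suc z \<notin> mor_image j \<beta>" by auto
  have "\<beta> \<in> mor G j (Suc (n + b))" "z \<le> n + b" using \<beta> a z by auto
  then obtain \<gamma> where \<gamma>: "\<gamma> \<in> mor G j (n + b)" "\<beta> = mor_comp G j (face G (n + b) z) \<gamma>"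
    using mor_missing_factor z(2) by blast
  have "act V j (n + a) \<beta> y = act V (n + b) (Suc (n + b)) (face G (n + b) z) (act V j (n + b) \<gamma> y)"
    unfolding \<gamma>(2) a add_Suc_right
    by (rule cmodule_comp[OF V \<gamma>(1) face_closed]) (use y csubmodule_subset[OF W] in auto)
  then show ?thesis
    using face_in_face_sum[OF V W z(1)] csubmodule_act[OF W \<gamma>(1) y] a by simp
qed

lemma face_sum_hom:
  assumes V: "cmodule G k V" and W: "csubmodule G k V W" and \<eta>: "cmod_hom G k V U \<eta>"
    and U: "cmodule G k U"
    and W': "\<And>n. \<eta> n ` W n \<subseteq> W' n" and "x \<in> face_sum G V W a n"
  shows "\<eta> (n + a) x \<in> face_sum G U W' a n"
  using assms(6)
proof (induct a arbitrary: n x)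
  case 0
  then show ?case using mod_hom_zero[OF cmodule_module[OF V] cmodule_module[OF U] cmod_hom_mod_hom[OF \<eta>]] by simp
next
  case (Suc a)
  then obtain u y where uy: "u \<in> face_sum G V W a (Suc n)" "y \<in> W (n + a)"
    "x = u \<oplus>\<^bsub>obj V (Suc (n + a))\<^esub> act V (n + a) (Suc (n + a)) (face G (n + a) a) y"
    by (blast elim: face_sum_SucE)
  have y: "y \<in> carrier (obj V (n + a))" and u: "u \<in> carrier (obj V (Suc (n + a)))"
    using uy csubmodule_subset[OF W] submodule_subset[OF face_sum_submodule[OF V W, of a "Suc n"]] by auto
  have "\<eta> (Suc (n + a)) x = \<eta> (Suc (n + a)) u \<oplus>\<^bsub>obj U (Suc (n + a))\<^esub>
      act U (n + a) (Suc (n + a)) (face G (n + a) a) (\<eta> (n + a) y)"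
    unfolding uy(3) mod_hom_add[OF cmod_hom_mod_hom[OF \<eta>] u act_closed[OF V face_closed y]]
      cmod_hom_act[OF \<eta> face_closed y] ..
  moreover have "\<eta> (Suc n + a) u \<in> face_sum G U W' a (Suc n)" by (rule Suc.hyps[OF uy(1)])
  moreover have "\<eta> (n + a) y \<in> W' (n + a)" using W' uy(2) by blast
  ultimately show ?case using face_sum_SucI by simp
qed

abbreviation full :: "('k, 'g, 'a) cmod \<Rightarrow> nat \<Rightarrow> 'a set" where
  "full V n \<equiv> carrier (obj V n)"

lemma deficient_gens_subset:
  "cmodule G k V \<Longrightarrow>
    (\<Union>j. \<Union>\<beta>\<in>{\<beta> \<in> mor G j m. \<not> Z \<subseteq> mor_image j \<beta>}. act V j m \<beta> ` carrier (obj V j)) \<subseteq> carrier (obj V m)"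
  using act_closed[of V _ _ m] by blast

lemma deficient_submodule: "cmodule G k V \<Longrightarrow> submodule (deficient G k V Z m) k (obj V m)"
  unfolding deficient_def by (rule mod_span_submodule[OF cmodule_module deficient_gens_subset])

lemma deficient_subset: "cmodule G k V \<Longrightarrow> deficient G k V Z m \<subseteq> carrier (obj V m)"
  by (rule submodule_subset[OF deficient_submodule])

lemma act_in_deficient:
  assumes "\<beta> \<in> mor G j m" "\<not> Z \<subseteq> mor_image j \<beta>" "y \<in> carrier (obj V j)"
  shows "act V j m \<beta> y \<in> deficient G k V Z m"
  unfolding deficient_def using assms by (intro subsetD[OF mod_span_superset]) blast

lemma deficient_least:
  assumes "submodule N k (obj V m)"
    and "\<And>j \<beta> y. \<beta> \<in> mor G j m \<Longrightarrow> \<not> Z \<subseteq> mor_image j \<beta> \<Longrightarrow> y \<in> carrier (obj V j) \<Longrightarrow> act V j m \<beta> y \<in> N"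
  shows "deficient G k V Z m \<subseteq> N"
  unfolding deficient_def
proof (rule mod_span_least[OF assms(1)], rule subsetI)
  fix x assume "x \<in> (\<Union>j. \<Union>\<beta>\<in>{\<beta> \<in> mor G j m. \<not> Z \<subseteq> mor_image j \<beta>}. act V j m \<beta> ` carrier (obj V j))"
  then obtain j \<beta> y where "\<beta> \<in> mor G j m" "\<not> Z \<subseteq> mor_image j \<beta>" "y \<in> carrier (obj V j)" "x = act V j m \<beta> y"
    by blast
  then show "x \<in> N" using assms(2) by blast
qed

lemma deficient_mono:
  assumes "cmodule G k V" "Z \<subseteq> Z'"
  shows "deficient G k V Z m \<subseteq> deficient G k V Z' m"
  by (rule deficient_least[OF deficient_submodule[OF assms(1)]], rule act_in_deficient) (use assms(2) in blast)+

text \<open>Links two views of the derivative: the recursive one fits the cone induction, the other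
  one depends on a set of points and can be moved by automorphisms.\<close>

lemma face_sum_eq_deficient:
  assumes V: "cmodule G k V"
  shows "face_sum G V (full V) a n = deficient G k V {1..a} (n + a)"
proof
  note W = csubmodule_carrier[OF V]
  show "deficient G k V {1..a} (n + a) \<subseteq> face_sum G V (full V) a n"
    by (rule deficient_least[OF face_sum_submodule[OF V W]]) (rule missing_in_face_sum[OF V W])
  show "face_sum G V (full V) a n \<subseteq> deficient G k V {1..a} (n + a)"
  proof (induct a arbitrary: n)
    case 0
    show ?case using submodule_zero[OF deficient_submodule[OF V]] by auto
  next
    case (Suc a)
    show ?case
    proof
      fix x assume "x \<in> face_sum G V (full V) (Suc a) n"
      then obtain u y where uy: "u \<in> face_sum G V (full V) a (Suc n)" "y \<in> full V (n + a)"
        "x = u \<oplus>\<^bsub>obj V (Suc (n + a))\<^esub> act V (n + a) (Suc (n + a)) (face G (n + a) a) y"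
        by (rule face_sum_SucE)
      have "u \<in> deficient G k V {1..a} (Suc (n + a))" using Suc[of "Suc n"] uy(1) by auto
      moreover have "deficient G k V {1..a} (Suc (n + a)) \<subseteq> deficient G k V {1..Suc a} (Suc (n + a))"
        by (rule deficient_mono[OF V]) auto
      moreover have "\<not> {1..Suc a} \<subseteq> mor_image (n + a) (face G (n + a) a)"
        unfolding face_image[OF le_add2] by (simp add: subset_Diff_insert)
      from act_in_deficient[OF face_closed this uy(2)] have "act V (n + a) (Suc (n + a)) (face G (n + a) a) y \<in> deficient G k V {1..Suc a} (Suc (n + a))" .
      ultimately show "x \<in> deficient G k V {1..Suc a} (n + Suc a)"
        using submodule_add[OF deficient_submodule[OF V]] uy(3) by auto
    qed
  qed
qed

lemma mor_image_full_iff: "\<beta> \<in> mor G j n \<Longrightarrow> {1..n} \<subseteq> mor_image j \<beta> \<longleftrightarrow> j = n"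
proof
  assume \<beta>: "\<beta> \<in> mor G j n" and "{1..n} \<subseteq> mor_image j \<beta>"
  then have "card {1..n} \<le> card (mor_image j \<beta>)" by (intro card_mono) auto
  then show "j = n" using mor_le[OF \<beta>] card_image[OF mor_inj[OF \<beta>]] by simp
next
  assume "\<beta> \<in> mor G j n" "j = n"
  then show "{1..n} \<subseteq> mor_image j \<beta>" using mor_image_self by blast
qed

text \<open>A morphism into \<open>[n]\<close> starts from a smaller object exactly when it misses a
  point. Thus \<open>H_0\<close> in degree \<open>n\<close> is the derivative along all
  \<open>n\<close> points.\<close>

lemma decomposables_eq_deficient:
  assumes V: "cmodule G k V"
  shows "decomposables G k V n = deficient G k V {1..n} n"
proof -
  have "(\<Union>i\<in>{..<n}. \<Union>\<alpha>\<in>mor G i n. act V i n \<alpha> ` carrier (obj V i)) =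
    (\<Union>j. \<Union>\<beta>\<in>{\<beta> \<in> mor G j n. \<not> {1..n} \<subseteq> mor_image j \<beta>}. act V j n \<beta> ` carrier (obj V j))"
    (is "?L = ?R")
  proof
    show "?L \<subseteq> ?R" using mor_image_full_iff by fastforce
    show "?R \<subseteq> ?L"
    proof
      fix x assume "x \<in> ?R"
      then obtain j \<beta> y where *: "\<beta> \<in> mor G j n" "\<not> {1..n} \<subseteq> mor_image j \<beta>" "y \<in> full V j" "x = act V j n \<beta> y"
        by blast
      then have "j < n" using mor_le[OF *(1)] mor_image_full_iff[OF *(1)] by linarith
      then show "x \<in> ?L" using * by blast
    qed
  qed
  then show ?thesis by (simp add: decomposables_def deficient_def)
qed

lemma decomposables_eq_face_sum: "cmodule G k V \<Longrightarrow> decomposables G k V n = face_sum G V (full V) n 0"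
  by (simp add: decomposables_eq_deficient face_sum_eq_deficient)

end

section \<open>The complex of a module\<close>

context face_system
begin

lemma BB_trans: "BB a (n + m) \<subseteq> BB (a + n) m"
proof (induct n arbitrary: a)
  case (Suc n)
  have "BB a (Suc (n + m)) \<subseteq> BB (Suc a) (n + m)"
  proof
    fix b assume "b \<in> BB a (Suc (n + m))"
    then show "b \<in> BB (Suc a) (n + m)"
      using BB_SucI[of b a "n + m" 0] A_sub by (simp add: add_subgroup_zero del: BB.simps)
  qed
  then show ?case using Suc[of "Suc a"] by auto
qed simp

text \<open>Converse to \<open>BB_boundary\<close>: the contribution of the first point is an image
  of \<open>d a\<close>, which lies in the denominators of all later derivatives.\<close>

lemma boundary_BB: "e \<in> chains (AA a) n 1 \<Longrightarrow> bnd d (replicate n False) a e \<in> BB (a + n) 0"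
proof (induct n arbitrary: a e)
  case 0
  then show ?case using BB_sub by (simp add: add_subgroup_zero)
next
  case (Suc n)
  have eF: "(\<lambda>m. e (False # m)) \<in> chains (AA (Suc a)) n 1" and eT: "(\<lambda>m. e (True # m)) \<in> chains (AA a) n 0"
    using Suc.prems by (auto simp: chains_Suc)
  have "e (True # replicate n False) \<in> AA a n"
    using chainsD[OF eT, of "replicate n False"] by (simp add: shape_p0)
  then have "0 + d a (e (True # replicate n False)) \<in> BB (Suc a) n"
    by (intro BB_SucI add_subgroup_zero BB_sub)
  then have "d a (e (True # replicate n False)) \<in> BB (Suc a + n) 0"
    using BB_trans[of "Suc a" n 0] by (simp del: BB.simps) blast
  then show ?case using Suc.hyps[OF eF] BB_sub by (simp add: add_subgroup_add del: BB.simps)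
qed

text \<open>Without torsion, \<open>acyclic_if_Suc\<close> reduces level \<open>n + 1\<close> to
  level \<open>n\<close> of the next derivative; in level 0 there are no nonzero chains of positive
  degree. Applied to free covers.\<close>

lemma acyclic_if_torsionfree:
  assumes "\<And>a n. torsionfree_at a n" and "p \<ge> 1"
  shows "acyclic_at a p n"
proof (induct n arbitrary: a)
  case 0
  show ?case
    unfolding acyclic_at_def
  proof (intro ballI impI bexI[of _ "\<lambda>l. 0"] chains_zero A_sub)
    fix c assume "c \<in> chains (AA a) 0 p"
    then have "c l = 0" for l using assms(2) by (auto simp: chains_0)
    then show "(\<lambda>l. c l - bnd d l a (\<lambda>l. 0)) \<in> chains (BB a) 0 p"
      using chains_zero[of "BB a", OF BB_sub] by simp
  qed
next
  case (Suc n)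
  show ?case by (rule acyclic_if_Suc[OF Suc assms(1)])
qed

end

section \<open>Formal sums of module elements as a face system\<close>

lemma bnd_hom:
  assumes "f 0 = 0" "\<And>x y. f (x + y) = f x + f y" "\<And>x. f (- x) = - f x" "\<And>i x. f (d i x) = d' i (f x)"
  shows "f (bnd d l a c) = bnd d' l a (\<lambda>m. f (c m))"
  by (induct l arbitrary: a c) (auto simp: assms)

text \<open>Each \<open>V\<^sub>n\<close> is the quotient of \<open>frags V n\<close> by the kernel of evaluation. In this way all \<open>V\<^sub>n\<close>
  become subquotients of one type of class \<^class>\<open>ab_group_add\<close>.\<close>

definition frags :: "('k, 'g, 'a) cmod \<Rightarrow> nat \<Rightarrow> (nat \<times> 'a, int) poly_mapping set" where
  "frags V n = {x. Poly_Mapping.keys x \<subseteq> {n} \<times> carrier (obj V n)}"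

lemma frags_subgroup: "add_subgroup (frags V n)"
  unfolding add_subgroup_def frags_def using keys_diff by fastforce

lemma frag_of_frags: "v \<in> carrier (obj V n) \<Longrightarrow> frag_of (n, v) \<in> frags V n"
  by (simp add: frags_def)

lemma frags_induct [consumes 1, case_names zero one diff]:
  assumes "x \<in> frags V n" and "P 0" and "\<And>v. v \<in> carrier (obj V n) \<Longrightarrow> P (frag_of (n, v))"
    and "\<And>x y. x \<in> frags V n \<Longrightarrow> y \<in> frags V n \<Longrightarrow> P x \<Longrightarrow> P y \<Longrightarrow> P (x - y)"
  shows "P x"
proof -
  have "x \<in> frags V n \<and> P x"
    using assms(1)[unfolded frags_def mem_Collect_eq]
  proof (induct x rule: frag_induction)
    case zero
    then show ?case using assms(2) frags_subgroup[of V n] by (simp add: add_subgroup_zero)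
  next
    case (one x)
    then show ?case using assms(3) by (auto simp: frag_of_frags)
  next
    case (diff a b)
    then show ?case using assms(4) frags_subgroup[of V n] by (simp add: add_subgroup_diff)
  qed
  then show ?thesis by simp
qed

lemma frag_hom_eqI:
  assumes "\<And>x y. f (x - y) = f x - f y" "\<And>x y. g (x - y) = g x - g y" "\<And>y. f (frag_of y) = g (frag_of y)"
  shows "f x = (g x :: 'b::ab_group_add)"
proof -
  have "f 0 = 0" "g 0 = 0" using assms(1)[of 0 0] assms(2)[of 0 0] by simp_all
  with subset_UNIV show ?thesis by (induct x rule: frag_induction) (simp_all add: assms)
qed

text \<open>The target is the additive group of a module record rather than a type of class
  \<open>ab_group_add\<close>, so the evaluation is chosen as a homomorphism given by the universal
  property of the free abelian group.\<close>

definition frag_eval :: "('k, 'g, 'a) cmod \<Rightarrow> nat \<Rightarrow> (nat \<times> 'a, int) poly_mapping \<Rightarrow> 'a" where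
  "frag_eval V n = (SOME h. (\<forall>x\<in>frags V n. h x \<in> carrier (obj V n)) \<and>
     (\<forall>x\<in>frags V n. \<forall>y\<in>frags V n. h (x + y) = h x \<oplus>\<^bsub>obj V n\<^esub> h y) \<and>
     (\<forall>v\<in>carrier (obj V n). h (frag_of (n, v)) = v))"

text \<open>Extension by 0 for \<open>i > n\<close> makes the identities of
  \<open>face_system\<close> hold for every index: in level \<open>n\<close>, for example, face
  \<open>n\<close> followed by transposition \<open>n\<close> and face \<open>n + 1\<close> are both
  0.\<close>

definition frag_face :: "('g, 'x) monoid_scheme \<Rightarrow> ('k, 'g, 'a) cmod \<Rightarrow> nat \<Rightarrow> (nat \<times> 'a, int) poly_mapping \<Rightarrow> (nat \<times> 'a, int) poly_mapping" where
  "frag_face G V i = frag_extend (\<lambda>(n, v). if v \<in> carrier (obj V n) \<and> i \<le> n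
     then frag_of (Suc n, act V n (Suc n) (face G n i) v) else 0)"

definition frag_swap :: "('g, 'x) monoid_scheme \<Rightarrow> ('k, 'g, 'a) cmod \<Rightarrow> nat \<Rightarrow> (nat \<times> 'a, int) poly_mapping \<Rightarrow> (nat \<times> 'a, int) poly_mapping" where
  "frag_swap G V i = frag_extend (\<lambda>(n, v). if v \<in> carrier (obj V n) \<and> i + 2 \<le> n
     then frag_of (n, act V n n (swap G n i) v) else 0)"

definition frag_map :: "('k, 'g, 'a) cmod \<Rightarrow> (nat \<Rightarrow> 'a \<Rightarrow> 'b) \<Rightarrow> (nat \<times> 'a, int) poly_mapping \<Rightarrow> (nat \<times> 'b, int) poly_mapping" where
  "frag_map V f = frag_extend (\<lambda>(n, v). if v \<in> carrier (obj V n) then frag_of (n, f n v) else 0)"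

definition frags_in :: "('k, 'g, 'a) cmod \<Rightarrow> (nat \<Rightarrow> 'a set) \<Rightarrow> nat \<Rightarrow> (nat \<times> 'a, int) poly_mapping set" where
  "frags_in V W n = {x \<in> frags V n. frag_eval V n x \<in> W n}"

abbreviation frags_ker :: "('k, 'g, 'a) cmod \<Rightarrow> nat \<Rightarrow> (nat \<times> 'a, int) poly_mapping set" where
  "frags_ker V \<equiv> frags_in V (\<lambda>n. {\<zero>\<^bsub>obj V n\<^esub>})"

context FIG
begin

lemma frag_eval_props:
  assumes V: "cmodule G k V"
  shows "x \<in> frags V n \<Longrightarrow> frag_eval V n x \<in> full V n"
    and "x \<in> frags V n \<Longrightarrow> y \<in> frags V n \<Longrightarrow>
      frag_eval V n (x + y) = frag_eval V n x \<oplus>\<^bsub>obj V n\<^esub> frag_eval V n y"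
    and "v \<in> full V n \<Longrightarrow> frag_eval V n (frag_of (n, v)) = v"
proof -
  interpret abelian_group "obj V n" by (rule cmodule_abelian[OF V])
  let ?S = "{n} \<times> full V n"
  obtain h where h: "h \<in> hom (free_Abelian_group ?S) (add_monoid (obj V n))" "\<And>x. x \<in> ?S \<Longrightarrow> h (frag_of x) = snd x"
    using comm_group.free_Abelian_group_universal[OF a_comm_group, of snd ?S] by auto
  have "\<exists>h. (\<forall>x\<in>frags V n. h x \<in> full V n) \<and>
     (\<forall>x\<in>frags V n. \<forall>y\<in>frags V n. h (x + y) = h x \<oplus>\<^bsub>obj V n\<^esub> h y) \<and>
     (\<forall>v\<in>full V n. h (frag_of (n, v)) = v)"
    using h by (intro exI[of _ h]) (auto simp: frags_def hom_def)
  from someI_ex[OF this, folded frag_eval_def]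
  show "x \<in> frags V n \<Longrightarrow> frag_eval V n x \<in> full V n"
    "x \<in> frags V n \<Longrightarrow> y \<in> frags V n \<Longrightarrow>
      frag_eval V n (x + y) = frag_eval V n x \<oplus>\<^bsub>obj V n\<^esub> frag_eval V n y"
    "v \<in> full V n \<Longrightarrow> frag_eval V n (frag_of (n, v)) = v" by blast+
qed

lemma frag_eval_zero:
  assumes V: "cmodule G k V"
  shows "frag_eval V n 0 = \<zero>\<^bsub>obj V n\<^esub>"
proof -
  interpret abelian_group "obj V n" by (rule cmodule_abelian[OF V])
  have "0 \<in> frags V n" by (simp add: frags_def)
  then show ?thesis using frag_eval_props(1)[OF V, of 0 n] frag_eval_props(2)[OF V, of 0 n 0] by simp
qed

lemma frag_eval_diff:
  assumes V: "cmodule G k V" and "x \<in> frags V n" "y \<in> frags V n"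
  shows "frag_eval V n (x - y) = frag_eval V n x \<ominus>\<^bsub>obj V n\<^esub> frag_eval V n y"
proof -
  interpret abelian_group "obj V n" by (rule cmodule_abelian[OF V])
  have 1: "x - y \<in> frags V n" using assms frags_subgroup add_subgroup_diff by blast
  then have "frag_eval V n x = frag_eval V n (x - y) \<oplus>\<^bsub>obj V n\<^esub> frag_eval V n y"
    using frag_eval_props(2)[OF V 1 assms(3)] by simp
  then show ?thesis using frag_eval_props(1)[OF V] 1 assms
    by (metis add.inv_solve_right minus_eq)
qed

lemma frag_face_diff: "frag_face G V i (x - y) = frag_face G V i x - frag_face G V i y"
  and frag_swap_diff: "frag_swap G V i (x - y) = frag_swap G V i x - frag_swap G V i y"
  and frag_map_diff: "frag_map V f (x - y) = frag_map V f x - frag_map V f y"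
  by (simp_all add: frag_face_def frag_swap_def frag_map_def frag_extend_diff)

lemma frag_face_add: "frag_face G V i (x + y) = frag_face G V i x + frag_face G V i y"
  and frag_swap_add: "frag_swap G V i (x + y) = frag_swap G V i x + frag_swap G V i y"
  by (simp_all add: frag_face_def frag_swap_def frag_extend_add)

lemma frag_face_0: "frag_face G V i 0 = 0"
  and frag_swap_0: "frag_swap G V i 0 = 0"
  and frag_map_0: "frag_map V f 0 = 0"
  by (simp_all add: frag_face_def frag_swap_def frag_map_def)

lemma frag_face_of:
  "v \<in> full V n \<Longrightarrow> frag_face G V i (frag_of (n, v)) = (if i \<le> n then frag_of (Suc n, act V n (Suc n) (face G n i) v) else 0)"
  and frag_swap_of:
  "v \<in> full V n \<Longrightarrow> frag_swap G V i (frag_of (n, v)) = (if i + 2 \<le> n then frag_of (n, act V n n (swap G n i) v) else 0)"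
  and frag_map_of: "v \<in> full V n \<Longrightarrow> frag_map V f (frag_of (n, v)) = frag_of (n, f n v)"
  by (simp_all add: frag_face_def frag_swap_def frag_map_def)

lemma frag_of_outside:
  "v \<notin> full V n \<Longrightarrow> frag_face G V i (frag_of (n, v)) = 0"
  "v \<notin> full V n \<Longrightarrow> frag_swap G V i (frag_of (n, v)) = 0"
  "v \<notin> full V n \<Longrightarrow> frag_map V f (frag_of (n, v)) = 0"
  by (auto simp: frag_face_def frag_swap_def frag_map_def)

lemmas frag_simps = frag_face_diff frag_swap_diff frag_map_diff frag_face_0 frag_swap_0 frag_map_0
  frag_face_of frag_swap_of frag_map_of frag_of_outside

lemma frag_face_face:
  assumes V: "cmodule G k V" and ij: "i \<le> j"
  shows "frag_face G V (Suc j) (frag_face G V i x) = frag_face G V i (frag_face G V j x)"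
proof (rule frag_hom_eqI[of _ _ x])
  fix y :: "nat \<times> 'a"
  obtain n v where y: "y = (n, v)" by (cases y)
  show "frag_face G V (Suc j) (frag_face G V i (frag_of y)) = frag_face G V i (frag_face G V j (frag_of y))"
  proof (cases "v \<in> full V n")
    case True
    have 1: "act V n (Suc n) (face G n i) v \<in> full V (Suc n)" for i by (rule act_closed[OF V face_closed True])
    show ?thesis
      using ij True 1 cmodule_comp[OF V face_closed face_closed True, symmetric]
      by (simp add: y frag_simps face_face)
  qed (simp add: y frag_simps)
qed (simp_all add: frag_simps)

lemma frag_swap_face:
  assumes V: "cmodule G k V"
  shows "frag_swap G V i (frag_face G V i x) = frag_face G V (Suc i) x"
proof (rule frag_hom_eqI[of _ _ x])
  fix y :: "nat \<times> 'a"
  obtain n v where y: "y = (n, v)" by (cases y)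
  show "frag_swap G V i (frag_face G V i (frag_of y)) = frag_face G V (Suc i) (frag_of y)"
  proof (cases "v \<in> full V n")
    case True
    have 1: "act V n (Suc n) (face G n i) v \<in> full V (Suc n)" for i by (rule act_closed[OF V face_closed True])
    have "act V (Suc n) (Suc n) (swap G (Suc n) i) (act V n (Suc n) (face G n i) v) = act V n (Suc n) (face G n (Suc i)) v"
      if "i < n" using that cmodule_comp[OF V face_closed swap_closed[of i "Suc n"] True, of i, symmetric]
      by (simp add: swap_face)
    then show ?thesis
      using True 1 by (simp add: y frag_simps)
  qed (simp add: y frag_simps)
qed (simp_all add: frag_simps)

lemma frag_swap_face':
  assumes V: "cmodule G k V" and ij: "i \<le> j"
  shows "frag_swap G V (Suc j) (frag_face G V i x) = frag_face G V i (frag_swap G V j x)"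
proof (rule frag_hom_eqI[of _ _ x])
  fix y :: "nat \<times> 'a"
  obtain n v where y: "y = (n, v)" by (cases y)
  show "frag_swap G V (Suc j) (frag_face G V i (frag_of y)) = frag_face G V i (frag_swap G V j (frag_of y))"
  proof (cases "v \<in> full V n \<and> j + 2 \<le> n")
    case True
    then have v: "v \<in> full V n" and j: "j + 2 \<le> n" by auto
    have 1: "act V n (Suc n) (face G n i) v \<in> full V (Suc n)" by (rule act_closed[OF V face_closed v])
    have 2: "act V n n (swap G n j) v \<in> full V n" by (rule act_closed[OF V swap_closed[OF j] v])
    have j': "Suc j + 2 \<le> Suc n" using j by simp
    have "act V (Suc n) (Suc n) (swap G (Suc n) (Suc j)) (act V n (Suc n) (face G n i) v) =
        act V n (Suc n) (face G n i) (act V n n (swap G n j) v)"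
      using cmodule_comp[OF V face_closed swap_closed[OF j'] v, of i]
        cmodule_comp[OF V swap_closed[OF j] face_closed v, of i] by (simp add: swap_face'[OF ij j])
    then show ?thesis
      using v 1 2 j ij by (simp add: y frag_simps)
  next
    case False
    then show ?thesis
      by (cases "v \<in> full V n") (use act_closed[OF V face_closed] in \<open>auto simp: y frag_simps\<close>)
  qed
qed (simp_all add: frag_simps)

lemma frag_face_frags:
  assumes V: "cmodule G k V" and x: "x \<in> frags V n"
  shows "frag_face G V i x \<in> frags V (Suc n) \<and> (i > n \<longrightarrow> frag_face G V i x = 0) \<and>
    (i \<le> n \<longrightarrow> frag_eval V (Suc n) (frag_face G V i x) = act V n (Suc n) (face G n i) (frag_eval V n x))"
  using x
proof (induct rule: frags_induct)
  case zero
  then show ?case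
    using frags_subgroup[of V "Suc n"] act_zero[OF V face_closed]
    by (simp add: frag_simps add_subgroup_zero frag_eval_zero[OF V])
next
  case (one v)
  then show ?case
    using frags_subgroup[of V "Suc n"] act_closed[OF V face_closed]
    by (simp add: frag_simps add_subgroup_zero frag_eval_props(3)[OF V] frag_of_frags)
next
  case (diff x y)
  then show ?case
    using frags_subgroup[of V "Suc n"]
    by (simp add: frag_simps add_subgroup_diff frag_eval_diff[OF V] frag_eval_props(1)[OF V]
      mod_hom_minus[OF cmodule_module[OF V] cmodule_module[OF V] cmodule_act[OF V face_closed]])
qed

lemma frag_swap_frags:
  assumes V: "cmodule G k V" and x: "x \<in> frags V n"
  shows "frag_swap G V i x \<in> frags V n \<and> (\<not> i + 2 \<le> n \<longrightarrow> frag_swap G V i x = 0) \<and>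
    (i + 2 \<le> n \<longrightarrow> frag_eval V n (frag_swap G V i x) = act V n n (swap G n i) (frag_eval V n x))"
  using x
proof (induct rule: frags_induct)
  case zero
  then show ?case
    using frags_subgroup[of V n] act_zero[OF V swap_closed]
    by (simp add: frag_simps add_subgroup_zero frag_eval_zero[OF V])
next
  case (one v)
  then show ?case
    using frags_subgroup[of V n] act_closed[OF V swap_closed]
    by (simp add: frag_simps add_subgroup_zero frag_eval_props(3)[OF V] frag_of_frags)
next
  case (diff x y)
  then show ?case
    using frags_subgroup[of V n]
    by (simp add: frag_simps add_subgroup_diff frag_eval_diff[OF V] frag_eval_props(1)[OF V]
      mod_hom_minus[OF cmodule_module[OF V] cmodule_module[OF V] cmodule_act[OF V swap_closed]])
qed

lemma frag_map_frags:
  assumes f: "\<And>v. v \<in> full V n \<Longrightarrow> f n v \<in> full U n" and x: "x \<in> frags V n"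
  shows "frag_map V f x \<in> frags U n"
  using x
proof (induct rule: frags_induct)
  case zero
  then show ?case using frags_subgroup[of U n] by (simp add: frag_simps add_subgroup_zero)
next
  case (one v)
  then show ?case using f by (simp add: frag_simps frag_of_frags)
next
  case (diff x y)
  then show ?case using frags_subgroup[of U n] by (simp add: frag_simps add_subgroup_diff)
qed

lemma frag_map_eval:
  assumes V: "cmodule G k V" and U: "cmodule G k U" and f: "f n \<in> mod_hom k (obj V n) (obj U n)"
    and x: "x \<in> frags V n"
  shows "frag_eval U n (frag_map V f x) = f n (frag_eval V n x)"
proof -
  have "frag_map V f x \<in> frags U n \<and> frag_eval U n (frag_map V f x) = f n (frag_eval V n x)"
    using x
  proof (induct rule: frags_induct)
    case zero
    then show ?case
      using frags_subgroup[of U n] mod_hom_zero[OF cmodule_module[OF V] cmodule_module[OF U] f]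
      by (simp add: frag_simps add_subgroup_zero frag_eval_zero V U)
  next
    case (one v)
    then show ?case using mod_hom_closed[OF f]
      by (simp add: frag_simps frag_of_frags frag_eval_props(3) V U)
  next
    case (diff x y)
    then show ?case using frags_subgroup[of U n]
      by (simp add: frag_simps add_subgroup_diff frag_eval_diff V U frag_eval_props(1)
        mod_hom_minus[OF cmodule_module[OF V] cmodule_module[OF U] f])
  qed
  then show ?thesis by simp
qed

lemma frag_map_face:
  assumes V: "cmodule G k V" and U: "cmodule G k U" and f: "cmod_hom G k V U f"
  shows "frag_map V f (frag_face G V i x) = frag_face G U i (frag_map V f x)"
proof (rule frag_hom_eqI[of _ _ x])
  fix y :: "nat \<times> 'a"
  obtain n v where y: "y = (n, v)" by (cases y)
  show "frag_map V f (frag_face G V i (frag_of y)) = frag_face G U i (frag_map V f (frag_of y))"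
  proof (cases "v \<in> full V n")
    case True
    then show ?thesis
      using act_closed[OF V face_closed True] mod_hom_closed[OF cmod_hom_mod_hom[OF f] True]
        cmod_hom_act[OF f face_closed True] by (simp add: y frag_simps)
  qed (simp add: y frag_simps)
qed (simp_all add: frag_simps)

lemma frag_map_frag_map:
  assumes "x \<in> frags U n" and "\<And>v. v \<in> full U n \<Longrightarrow> s n v \<in> full V n \<and> f n (s n v) = v"
  shows "frag_map V f (frag_map U s x) = x"
  using assms(1)
proof (induct rule: frags_induct)
  case (one v)
  then show ?case using assms(2) by (simp add: frag_simps)
qed (simp_all add: frag_simps)

lemma frags_in_subgroup:
  assumes V: "cmodule G k V" and W: "submodule (W n) k (obj V n)"
  shows "add_subgroup (frags_in V W n)"
  unfolding add_subgroup_def frags_in_def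
  using frags_subgroup[of V n] submodule_zero[OF W] submodule_minus[OF W]
  by (auto simp: add_subgroup_zero add_subgroup_diff frag_eval_zero[OF V] frag_eval_diff[OF V])

lemma csubmodule_zero: "cmodule G k V \<Longrightarrow> csubmodule G k V (\<lambda>n. {\<zero>\<^bsub>obj V n\<^esub>})"
  by (auto simp: csubmodule_def cmodule_module submodule_trivial act_zero)

lemma frag_face_frags_in:
  assumes V: "cmodule G k V" and W: "csubmodule G k V W" and x: "x \<in> frags_in V W n"
  shows "frag_face G V i x \<in> frags_in V W (Suc n)"
  using frag_face_frags[OF V, of x n i] x csubmodule_act[OF W face_closed]
    submodule_zero[OF csubmodule_submodule[OF W]] frag_eval_zero[OF V]
  by (cases "i \<le> n") (auto simp: frags_in_def)

lemma frag_swap_frags_in: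
  assumes V: "cmodule G k V" and W: "csubmodule G k V W" and x: "x \<in> frags_in V W n"
  shows "frag_swap G V i x \<in> frags_in V W n"
  using frag_swap_frags[OF V, of x n i] x csubmodule_act[OF W swap_closed]
    submodule_zero[OF csubmodule_submodule[OF W]] frag_eval_zero[OF V]
  by (cases "i + 2 \<le> n") (auto simp: frags_in_def)

text \<open>Evaluation identifies the quotient groups of this system with the values of
  \<open>W\<close>. Besides \<open>W = full V\<close>, the kernel of a free cover occurs as
  \<open>W\<close>.\<close>

lemma frag_system:
  assumes V: "cmodule G k V" and W: "csubmodule G k V W"
  shows "face_system (frag_face G V) (frag_swap G V) (frags_in V W) (frags_ker V)"
proof
  fix n x i
  show "frags_ker V n \<subseteq> frags_in V W n"
    using submodule_zero[OF csubmodule_submodule[OF W]] by (auto simp: frags_in_def)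
  show "add_subgroup (frags_in V W n)" "add_subgroup (frags_ker V n)"
    using frags_in_subgroup[where W = W, OF V csubmodule_submodule[OF W]]
      frags_in_subgroup[where W = "\<lambda>n. {\<zero>\<^bsub>obj V n\<^esub>}", OF V csubmodule_submodule[OF csubmodule_zero[OF V]]]
    by blast+
  show "x \<in> frags_in V W n \<Longrightarrow> frag_face G V i x \<in> frags_in V W (Suc n)"
    "x \<in> frags_ker V n \<Longrightarrow> frag_face G V i x \<in> frags_ker V (Suc n)"
    "x \<in> frags_in V W n \<Longrightarrow> frag_swap G V i x \<in> frags_in V W n"
    "x \<in> frags_ker V n \<Longrightarrow> frag_swap G V i x \<in> frags_ker V n"
    by (fact frag_face_frags_in[OF V W] frag_face_frags_in[OF V csubmodule_zero[OF V]]
      frag_swap_frags_in[OF V W] frag_swap_frags_in[OF V csubmodule_zero[OF V]])+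
qed (simp_all add: frag_face_face[OF V] frag_swap_face[OF V] frag_swap_face'[OF V] frag_face_add frag_swap_add)

abbreviation frag_BB :: "('k, 'g, 'a) cmod \<Rightarrow> (nat \<Rightarrow> 'a set) \<Rightarrow> nat \<Rightarrow> nat \<Rightarrow> (nat \<times> 'a, int) poly_mapping set" where
  "frag_BB V W \<equiv> face_system.BB (frag_face G V) (frags_in V W) (frags_ker V)"

text \<open>Both recursions add the image of one more face; conversely, an element of
  \<open>W\<close> lifts to a formal sum with a single term. Statements on systems thereby become
  statements on modules.\<close>

lemma frag_BB_iff:
  assumes V: "cmodule G k V" and W: "csubmodule G k V W"
  shows "x \<in> frag_BB V W a n \<longleftrightarrow> x \<in> frags V (n + a) \<and> frag_eval V (n + a) x \<in> face_sum G V W a n"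
proof -
  interpret face_system "frag_face G V" "frag_swap G V" "frags_in V W" "frags_ker V"
    by (rule frag_system[OF V W])
  show ?thesis
  proof (induct a arbitrary: n x)
    case 0
    show ?case unfolding BB.simps by (simp add: frags_in_def)
  next
    case (Suc a)
    interpret M: abelian_group "obj V (Suc (n + a))" by (rule cmodule_abelian[OF V])
    show ?case
    proof
      assume "x \<in> BB (Suc a) n"
      then obtain b y where b: "b \<in> BB a (Suc n)" and y: "y \<in> frags_in V W (n + a)" and x: "x = b + frag_face G V a y"
        by auto
      have b': "b \<in> frags V (Suc (n + a))" "frag_eval V (Suc (n + a)) b \<in> face_sum G V W a (Suc n)"
        using b Suc[of b "Suc n"] by simp_all
      have y': "y \<in> frags V (n + a)" "frag_eval V (n + a) y \<in> W (n + a)" using y by (auto simp: frags_in_def)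
      note dy = frag_face_frags[OF V y'(1), of a]
      show "x \<in> frags V (n + Suc a) \<and> frag_eval V (n + Suc a) x \<in> face_sum G V W (Suc a) n"
        using b' dy face_sum_SucI[OF b'(2) y'(2)] frags_subgroup[of V "Suc (n + a)"]
        by (simp add: x add_subgroup_add frag_eval_props(2)[OF V])
    next
      assume "x \<in> frags V (n + Suc a) \<and> frag_eval V (n + Suc a) x \<in> face_sum G V W (Suc a) n"
      then have x: "x \<in> frags V (Suc (n + a))" and "frag_eval V (Suc (n + a)) x \<in> face_sum G V W (Suc a) n" by auto
      then obtain u w where u: "u \<in> face_sum G V W a (Suc n)" and w: "w \<in> W (n + a)"
        and eq: "frag_eval V (Suc (n + a)) x = u \<oplus>\<^bsub>obj V (Suc (n + a))\<^esub> act V (n + a) (Suc (n + a)) (face G (n + a) a) w"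
        by (blast elim: face_sum_SucE)
      have w': "w \<in> full V (n + a)" using w csubmodule_subset[OF W] by auto
      define y where "y = frag_of (n + a, w)"
      have y: "y \<in> frags V (n + a)" "frag_eval V (n + a) y = w"
        using w' by (simp_all add: y_def frag_of_frags frag_eval_props(3)[OF V])
      note dy = frag_face_frags[OF V y(1), of a, unfolded y(2)]
      have uc: "u \<in> full V (Suc (n + a))"
        using u submodule_subset[OF face_sum_submodule[OF V W, of a "Suc n"]] by auto
      have "frag_eval V (Suc (n + a)) (x - frag_face G V a y) = u"
        using dy x eq uc act_closed[OF V face_closed w', of a]
        by (simp add: frag_eval_diff[OF V] M.minus_eq M.a_assoc M.r_neg)
      then have "x - frag_face G V a y \<in> BB a (Suc n)"
        using Suc[of "x - frag_face G V a y" "Suc n"] u x dy frags_subgroup[of V "Suc (n + a)"]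
        by (simp add: add_subgroup_diff)
      moreover have "y \<in> frags_in V W (n + a)" using y w by (simp add: frags_in_def)
      ultimately have "(x - frag_face G V a y) + frag_face G V a y \<in> BB (Suc a) n" by (rule BB_SucI)
      then show "x \<in> BB (Suc a) n" by simp
    qed
  qed
qed

section \<open>Torsion of the derivatives of a C-module\<close>

definition torsionfree :: "('k, 'g, 'a) cmod \<Rightarrow> nat \<Rightarrow> nat \<Rightarrow> bool" where
  "torsionfree V a n \<longleftrightarrow> (\<forall>v\<in>full V (n + a).
     act V (n + a) (Suc (n + a)) (face G (n + a) a) v \<in> face_sum G V (full V) a (Suc n) \<longrightarrow>
     v \<in> face_sum G V (full V) a n)"

abbreviation "frag_torsionfree V \<equiv> face_system.torsionfree_at (frag_face G V) (frags_in V (full V)) (frags_ker V)"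
abbreviation "frag_acyclic V \<equiv> face_system.acyclic_at (frag_face G V) (frags_in V (full V)) (frags_ker V)"

lemma frags_in_full: "cmodule G k V \<Longrightarrow> frags_in V (full V) = frags V"
  using frag_eval_props(1) by (fastforce simp: frags_in_def fun_eq_iff)

lemma mem_frags_in_full: "cmodule G k V \<Longrightarrow> x \<in> frags_in V (full V) n \<longleftrightarrow> x \<in> frags V n"
  by (simp add: frags_in_full)

lemma frag_torsionfree_iff:
  assumes V: "cmodule G k V"
  shows "frag_torsionfree V a n \<longleftrightarrow> torsionfree V a n"
proof -
  note W = csubmodule_carrier[OF V]
  interpret face_system "frag_face G V" "frag_swap G V" "frags_in V (full V)" "frags_ker V"
    by (rule frag_system[OF V W])
  note * = frag_BB_iff[OF V W] mem_frags_in_full[OF V]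
  show ?thesis
  proof
    assume t: "torsionfree_at a n"
    show "torsionfree V a n"
      unfolding torsionfree_def
    proof (intro ballI impI)
      fix v assume v: "v \<in> full V (n + a)"
        and d: "act V (n + a) (Suc (n + a)) (face G (n + a) a) v \<in> face_sum G V (full V) a (Suc n)"
      have "frag_of (n + a, v) \<in> frags V (n + a)" by (rule frag_of_frags[OF v])
      then show "v \<in> face_sum G V (full V) a n"
        using t[unfolded torsionfree_at_def Ball_def *] frag_face_frags[OF V, of "frag_of (n + a, v)" "n + a" a] v d
        by (auto simp: frag_eval_props(3)[OF V])
    qed
  next
    assume t: "torsionfree V a n"
    then show "torsionfree_at a n"
      unfolding torsionfree_at_def torsionfree_def Ball_def *
      using frag_face_frags[OF V, of _ "n + a" a] frag_eval_props(1)[OF V] by auto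
  qed
qed

text \<open>The second conclusion is the vanishing, in all levels, of the derivatives beyond the
  generation degree; it later bounds the length of the filtration.\<close>

lemma torsionfree_bounded_if_acyclic:
  assumes V: "cmodule G k V" and "\<And>n. n \<ge> D \<Longrightarrow> full V n \<subseteq> face_sum G V (full V) n 0"
    and "\<And>n. n \<ge> R \<Longrightarrow> frag_acyclic V 0 1 n"
  shows "\<exists>N. \<forall>a n. n \<ge> N \<longrightarrow> torsionfree V a n" "\<And>a n. a \<ge> D \<Longrightarrow> full V (n + a) \<subseteq> face_sum G V (full V) a n"
proof -
  note W = csubmodule_carrier[OF V]
  interpret face_system "frag_face G V" "frag_swap G V" "frags_in V (full V)" "frags_ker V"
    by (rule frag_system[OF V W])
  note * = frag_BB_iff[OF V W] mem_frags_in_full[OF V]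
  have ac0: "acyclic_at 0 0 n" if "n \<ge> D" for n
    unfolding acyclic_0_iff subset_iff * using assms(2)[OF that] frag_eval_props(1)[OF V] by auto
  show "\<exists>N. \<forall>a n. n \<ge> N \<longrightarrow> torsionfree V a n"
    using torsionfree_bounded[OF ac0 assms(3)] frag_torsionfree_iff[OF V] by blast
  fix a n assume a: "a \<ge> D"
  have "acyclic_at a 0 n" for n
    using acyclic_shift_bound[of D 0 a n] ac0 a by simp
  then have "frags_in V (full V) (n + a) \<subseteq> BB a n" by (rule AA_BB_if_acyclic)
  then show "full V (n + a) \<subseteq> face_sum G V (full V) a n"
    using frag_of_frags[of _ V "n + a"] frag_eval_props(3)[OF V, of _ "n + a"] unfolding subset_iff * by fastforce
qed

text \<open>This is the exact sequence \<open>H\<^sub>1(C(P)) \<rightarrow> H\<^sub>1(C(V)) \<rightarrow> H\<^sub>0(K) \<rightarrow> H\<^sub>0(P)\<close> for \<open>0 \<rightarrow> K \<rightarrow> P \<rightarrow> V \<rightarrow> 0\<close>.\<close>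

lemma acyclic_quotient:
  assumes P: "cmodule G k P" and V: "cmodule G k V" and \<epsilon>: "cmod_hom G k P V \<epsilon>"
    and surj: "\<And>n v. v \<in> full V n \<Longrightarrow> \<exists>p\<in>full P n. \<epsilon> n p = v"
    and tf: "\<And>a n. torsionfree P a n"
    and K: "csubmodule G k P K" and K_def: "\<And>n. K n = {p \<in> full P n. \<epsilon> n p = \<zero>\<^bsub>obj V n\<^esub>}"
    and E: "\<And>u. u \<in> K n \<Longrightarrow> u \<in> face_sum G P (full P) n 0 \<Longrightarrow> u \<in> face_sum G P K n 0"
  shows "frag_acyclic V 0 1 n"
proof -
  interpret SV: face_system "frag_face G V" "frag_swap G V" "frags_in V (full V)" "frags_ker V"
    by (rule frag_system[OF V csubmodule_carrier[OF V]])
  interpret SP: face_system "frag_face G P" "frag_swap G P" "frags_in P (full P)" "frags_ker P"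
    by (rule frag_system[OF P csubmodule_carrier[OF P]])
  interpret SK: face_system "frag_face G P" "frag_swap G P" "frags_in P K" "frags_ker P"
    by (rule frag_system[OF P K])
  have acP: "SP.acyclic_at 0 1 n"
    by (rule SP.acyclic_if_torsionfree) (simp_all add: frag_torsionfree_iff[OF P] tf)
  \<comment> \<open>A choice of preimages, not additive on \<open>V\<close>. On formal sums it
    extends additively, which lifts chains; commutation with the boundary is used for
    \<open>\<pi>\<close> alone.\<close>
  define sec where "sec n v = (SOME p. p \<in> full P n \<and> \<epsilon> n p = v)" for n v
  have sec: "sec n v \<in> full P n \<and> \<epsilon> n (sec n v) = v" if "v \<in> full V n" for n v
    unfolding sec_def by (rule someI_ex) (use surj[OF that] in blast)
  define \<sigma> where "\<sigma> = frag_map V sec"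
  define \<pi> where "\<pi> = frag_map P \<epsilon>"
  have \<pi>\<sigma>: "\<pi> (\<sigma> x) = x" if "x \<in> frags V m" for x m
    unfolding \<pi>_def \<sigma>_def using frag_map_frag_map[where s = sec and f = \<epsilon>, OF that] sec by blast
  have \<pi>_frags: "\<pi> x \<in> frags V m" if "x \<in> frags P m" for x m
    unfolding \<pi>_def using frag_map_frags[where f = \<epsilon>, OF _ that] mod_hom_closed[OF cmod_hom_mod_hom[OF \<epsilon>]] by blast
  have \<pi>_eval: "frag_eval V m (\<pi> x) = \<epsilon> m (frag_eval P m x)" if "x \<in> frags P m" for x m
    unfolding \<pi>_def by (rule frag_map_eval[where f = \<epsilon>, OF P V cmod_hom_mod_hom[OF \<epsilon>] that])
  have \<pi>_diff: "\<pi> (x - y) = \<pi> x - \<pi> y" and \<pi>_0: "\<pi> 0 = 0" for x y by (simp_all add: \<pi>_def frag_simps)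
  have \<pi>_minus: "\<pi> (- x) = - \<pi> x" for x using \<pi>_diff[of 0 x] \<pi>_0 by simp
  have \<pi>_add: "\<pi> (x + y) = \<pi> x + \<pi> y" for x y using \<pi>_diff[of x "- y"] \<pi>_minus by simp
  have \<pi>_bnd: "\<pi> (bnd (frag_face G P) l 0 c) = bnd (frag_face G V) l 0 (\<lambda>m. \<pi> (c m))" for l c
    by (rule bnd_hom[OF \<pi>_0 \<pi>_add \<pi>_minus]) (simp add: \<pi>_def frag_map_face[OF P V \<epsilon>])
  have \<pi>_B: "\<pi> x \<in> frags_ker V m" if "x \<in> frags_in P K m" for x m
    using that \<pi>_frags \<pi>_eval by (auto simp: frags_in_def K_def)
  have ker_K: "frags_ker P m \<subseteq> frags_in P K m" for m by (rule SK.BA)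
  have inP: "frags_in P (full P) = frags P" by (rule frags_in_full[OF P])
  have inV: "frags_in V (full V) = frags V" by (rule frags_in_full[OF V])
  have K_in: "frags_in P K m \<subseteq> frags P m" for m by (auto simp: frags_in_def)
  let ?F = "replicate n False"
  show ?thesis
    unfolding SV.acyclic_at_def
  proof (intro ballI impI)
    fix c assume "c \<in> chains (SV.AA 0) n 1" and bc: "(\<lambda>l. bnd (frag_face G V) l 0 c) \<in> chains (SV.BB 0) n (1 - 1)"
    then have c: "c \<in> chains (frags V) n 1" by (simp add: inV)
    define c' where "c' l = \<sigma> (c l)" for l
    have c': "c' \<in> chains (frags P) n 1"
      unfolding c'_def[abs_def]
    proof (rule chains_map[OF _ _ c])
      show "\<sigma> 0 = 0" by (simp add: \<sigma>_def frag_simps)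
      show "\<sigma> x \<in> frags P m" if "x \<in> frags V m" for m x
        unfolding \<sigma>_def using frag_map_frags[where f = sec, OF _ that] sec by blast
    qed
    have \<pi>c': "\<pi> (c' l) = c l" for l
    proof (cases "shape n 1 l")
      case True
      show ?thesis unfolding c'_def by (rule \<pi>\<sigma>[OF chainsD[OF c True]])
    next
      case False
      show ?thesis using chains_outside[OF c False] by (simp add: c'_def \<sigma>_def \<pi>_def frag_simps)
    qed
    \<comment> \<open>A 0-chain has just one component, at the empty subset, so the boundary of the
      lifted chain is this single element.\<close>
    define w where "w = bnd (frag_face G P) ?F 0 c'"
    have c'A: "c' \<in> chains (SP.AA 0) n 1" using c' by (simp add: inP)
    have wBB: "w \<in> SP.BB n 0" using SP.boundary_BB[OF c'A] by (simp add: w_def)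
    then have w: "w \<in> frags P n" and u: "frag_eval P n w \<in> face_sum G P (full P) n 0"
      using frag_BB_iff[OF P csubmodule_carrier[OF P], of w n 0] by simp_all
    have "\<pi> w \<in> frags_ker V n"
      using chainsD[OF bc, of ?F] by (simp add: w_def \<pi>_bnd \<pi>c' shape_p0)
    then have "\<epsilon> n (frag_eval P n w) = \<zero>\<^bsub>obj V n\<^esub>" using \<pi>_eval[OF w] by (auto simp: frags_in_def)
    then have "frag_eval P n w \<in> K n" using frag_eval_props(1)[OF P w] by (simp add: K_def)
    then have "frag_eval P n w \<in> face_sum G P K n 0" using E u by blast
    then have "w \<in> SK.BB n 0" using frag_BB_iff[OF P K, of w n 0] w by simp
    \<comment> \<open>As \<open>w\<close> is decomposable within \<open>K\<close>, the chain
      bounding it can be taken with values in \<open>K\<close>. Subtracting it makes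
      \<open>c'\<close> a cycle of \<open>P\<close> and changes its image in \<open>V\<close> only
      by denominators.\<close>
    then obtain e where e: "e \<in> chains (frags_in P K) n 1"
      and we: "w - bnd (frag_face G P) ?F 0 e \<in> frags_ker P n"
      using SK.BB_boundary[of w 0 n] by auto
    have eP: "e \<in> chains (frags P) n 1" by (rule chains_mono[OF K_in e])
    define c2 where "c2 l = c' l - e l" for l
    have c2: "c2 \<in> chains (SP.AA 0) n 1"
      unfolding c2_def[abs_def] using chains_add_subgroup(2)[OF frags_subgroup c' eP] by (simp add: inP)
    have "(\<lambda>l. bnd (frag_face G P) l 0 c2) \<in> chains (SP.BB 0) n (1 - 1)"
    proof (rule chainsI)
      fix l
      show "bnd (frag_face G P) l 0 c2 \<in> SP.BB 0 (count_list l False)" if "shape n (1 - 1) l"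
        using that we by (simp add: shape_p0 c2_def[abs_def] SP.bnd_diff w_def)
      show "bnd (frag_face G P) l 0 c2 = 0" if "\<not> shape n (1 - 1) l"
        using chains_outside[OF SP.bnd_AA[OF c2, of 0] that] .
    qed
    then obtain f where f: "f \<in> chains (SP.AA 0) n (1 + 1)"
      and c2f: "(\<lambda>l. c2 l - bnd (frag_face G P) l 0 f) \<in> chains (SP.BB 0) n 1"
      using acP c2 unfolding SP.acyclic_at_def by blast
    have "(\<lambda>l. \<pi> (f l)) \<in> chains (SV.AA 0) n (1 + 1)"
      by (rule chains_map[where f = \<pi>, OF \<pi>_0 _ f]) (simp add: inV inP \<pi>_frags)
    moreover have "(\<lambda>l. c l - bnd (frag_face G V) l 0 (\<lambda>l. \<pi> (f l))) \<in> chains (SV.BB 0) n 1"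
    proof -
      have "(\<lambda>l. \<pi> (c2 l - bnd (frag_face G P) l 0 f)) \<in> chains (frags_ker V) n 1"
        by (rule chains_map[where f = \<pi>, OF \<pi>_0 _ c2f]) (use \<pi>_B ker_K in auto)
      moreover have "(\<lambda>l. \<pi> (e l)) \<in> chains (frags_ker V) n 1"
        by (rule chains_map[where f = \<pi>, OF \<pi>_0 _ e]) (rule \<pi>_B)
      ultimately have "(\<lambda>l. \<pi> (c2 l - bnd (frag_face G P) l 0 f) + \<pi> (e l)) \<in> chains (frags_ker V) n 1"
        by (rule chains_add_subgroup(1)[OF SV.B_sub])
      moreover have "\<pi> (c2 l - bnd (frag_face G P) l 0 f) + \<pi> (e l) = c l - bnd (frag_face G V) l 0 (\<lambda>l. \<pi> (f l))" for l
        by (simp add: \<pi>_diff \<pi>_bnd c2_def \<pi>c')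
      ultimately have "(\<lambda>l. c l - bnd (frag_face G V) l 0 (\<lambda>l. \<pi> (f l))) \<in> chains (frags_ker V) n 1" by simp
      then show ?thesis by (rule chains_mono[rotated]) simp
    qed
    ultimately show "\<exists>e\<in>chains (SV.AA 0) n (1 + 1). (\<lambda>l. c l - bnd (frag_face G V) l 0 e) \<in> chains (SV.BB 0) n 1"
      by blast
  qed
qed

end

section \<open>Free modules\<close>

lemma mod_hom_comp: "f \<in> mod_hom k M N \<Longrightarrow> g \<in> mod_hom k N P \<Longrightarrow> (\<lambda>x. g (f x)) \<in> mod_hom k M P"
  by (rule mod_homI) (simp_all add: mod_hom_closed mod_hom_add[of f] mod_hom_add[of g] mod_hom_smult[of f] mod_hom_smult[of g])

context FIG
begin

section \<open>Free modules over the base ring\<close>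

lemma mod_free_iff:
  "c \<in> carrier (mod_free k X) \<longleftrightarrow> finite {x. c x \<noteq> \<zero>\<^bsub>k\<^esub>} \<and> (\<forall>x. c x \<in> carrier k) \<and> {x. c x \<noteq> \<zero>\<^bsub>k\<^esub>} \<subseteq> X"
proof -
  interpret cring k by (rule kcring)
  show ?thesis unfolding mod_free_def by simp (metis (mono_tags, lifting) mem_Collect_eq subset_iff zero_closed)
qed

lemma mod_free_coeff: "c \<in> carrier (mod_free k X) \<Longrightarrow> c x \<in> carrier k"
  by (simp add: mod_free_iff)

lemma mod_free_simps [simp]:
  "c \<oplus>\<^bsub>mod_free k X\<^esub> d = (\<lambda>x. c x \<oplus>\<^bsub>k\<^esub> d x)" "\<zero>\<^bsub>mod_free k X\<^esub> = (\<lambda>x. \<zero>\<^bsub>k\<^esub>)"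
  "a \<odot>\<^bsub>mod_free k X\<^esub> c = (\<lambda>x. a \<otimes>\<^bsub>k\<^esub> c x)"
  by (simp_all add: mod_free_def)

lemma mod_free_module: "Module.module k (mod_free k X)"
proof -
  interpret cring k by (rule kcring)
  have fin: "finite {x. c x \<oplus>\<^bsub>k\<^esub> d x \<noteq> \<zero>\<^bsub>k\<^esub>}" "{x. c x \<oplus>\<^bsub>k\<^esub> d x \<noteq> \<zero>\<^bsub>k\<^esub>} \<subseteq> X"
    if "c \<in> carrier (mod_free k X)" "d \<in> carrier (mod_free k X)" for c d
  proof -
    have *: "{x. c x \<oplus>\<^bsub>k\<^esub> d x \<noteq> \<zero>\<^bsub>k\<^esub>} \<subseteq> {x. c x \<noteq> \<zero>\<^bsub>k\<^esub>} \<union> {x. d x \<noteq> \<zero>\<^bsub>k\<^esub>}" by auto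
    show "finite {x. c x \<oplus>\<^bsub>k\<^esub> d x \<noteq> \<zero>\<^bsub>k\<^esub>}"
      by (rule finite_subset[OF *]) (use that in \<open>auto simp: mod_free_iff\<close>)
    show "{x. c x \<oplus>\<^bsub>k\<^esub> d x \<noteq> \<zero>\<^bsub>k\<^esub>} \<subseteq> X"
      using * that unfolding mod_free_iff by blast
  qed
  have sm: "finite {x. a \<otimes>\<^bsub>k\<^esub> c x \<noteq> \<zero>\<^bsub>k\<^esub>}" "{x. a \<otimes>\<^bsub>k\<^esub> c x \<noteq> \<zero>\<^bsub>k\<^esub>} \<subseteq> X"
    if "a \<in> carrier k" "c \<in> carrier (mod_free k X)" for a c
  proof -
    have *: "{x. a \<otimes>\<^bsub>k\<^esub> c x \<noteq> \<zero>\<^bsub>k\<^esub>} \<subseteq> {x. c x \<noteq> \<zero>\<^bsub>k\<^esub>}" using that by auto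
    show "finite {x. a \<otimes>\<^bsub>k\<^esub> c x \<noteq> \<zero>\<^bsub>k\<^esub>}"
      by (rule finite_subset[OF *]) (use that in \<open>auto simp: mod_free_iff\<close>)
    show "{x. a \<otimes>\<^bsub>k\<^esub> c x \<noteq> \<zero>\<^bsub>k\<^esub>} \<subseteq> X"
      using * that unfolding mod_free_iff by blast
  qed
  have addc: "c \<oplus>\<^bsub>mod_free k X\<^esub> d \<in> carrier (mod_free k X)"
    if "c \<in> carrier (mod_free k X)" "d \<in> carrier (mod_free k X)" for c d
    using fin[OF that] that by (auto simp: mod_free_iff)
  have smc: "a \<odot>\<^bsub>mod_free k X\<^esub> c \<in> carrier (mod_free k X)"
    if "a \<in> carrier k" "c \<in> carrier (mod_free k X)" for a c
    using sm[OF that] that by (auto simp: mod_free_iff)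
  have zc: "\<zero>\<^bsub>mod_free k X\<^esub> \<in> carrier (mod_free k X)" by (simp add: mod_free_iff)
  have "abelian_group (mod_free k X)"
  proof (rule abelian_groupI)
    fix c assume c: "c \<in> carrier (mod_free k X)"
    show "\<exists>d\<in>carrier (mod_free k X). d \<oplus>\<^bsub>mod_free k X\<^esub> c = \<zero>\<^bsub>mod_free k X\<^esub>"
    proof (rule bexI[of _ "\<lambda>x. \<ominus>\<^bsub>k\<^esub> c x"])
      show "(\<lambda>x. \<ominus>\<^bsub>k\<^esub> c x) \<oplus>\<^bsub>mod_free k X\<^esub> c = \<zero>\<^bsub>mod_free k X\<^esub>"
        using c by (simp add: mod_free_coeff l_neg)
      have "{x. \<ominus>\<^bsub>k\<^esub> c x \<noteq> \<zero>\<^bsub>k\<^esub>} = {x. c x \<noteq> \<zero>\<^bsub>k\<^esub>}"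
        using mod_free_coeff[OF c] by (intro Collect_cong) (metis minus_minus minus_zero)
      then show "(\<lambda>x. \<ominus>\<^bsub>k\<^esub> c x) \<in> carrier (mod_free k X)"
        using c by (simp add: mod_free_iff)
    qed
  qed (rule addc, assumption+, simp_all add: mod_free_coeff a_ac zc[simplified])
  then show ?thesis
    by (rule moduleI[OF kcring]) (rule smc, assumption+, simp_all add: mod_free_coeff l_distr r_distr m_assoc)
qed

lemma free_gen_closed: "x \<in> X \<Longrightarrow> free_gen k x \<in> carrier (mod_free k X)"
proof -
  interpret cring k by (rule kcring)
  have "{y. free_gen k x y \<noteq> \<zero>\<^bsub>k\<^esub>} \<subseteq> {x}" by (auto simp: free_gen_def)
  then show "x \<in> X \<Longrightarrow> free_gen k x \<in> carrier (mod_free k X)"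
    using finite_subset by (auto simp: mod_free_iff free_gen_def)
qed

text \<open>Induction over a finite set containing the support, splitting off one coefficient at a
  time. Linear statements on free modules are checked on generators through this lemma.\<close>

lemma mod_free_subset_submodule:
  assumes N: "submodule N k (mod_free k X)" and gens: "\<And>x. x \<in> X \<Longrightarrow> free_gen k x \<in> N"
  shows "carrier (mod_free k X) \<subseteq> N"
proof
  interpret cring k by (rule kcring)
  have *: "c \<in> N" if "finite Y" "c \<in> carrier (mod_free k X)" "{x. c x \<noteq> \<zero>\<^bsub>k\<^esub>} \<subseteq> Y" for Y c
    using that
  proof (induct Y arbitrary: c rule: finite_induct)
    case empty
    then have "c = (\<lambda>x. \<zero>\<^bsub>k\<^esub>)" by auto
    then show ?case using submodule_zero[OF N] by simp
  next
    case (insert y Y)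
    define d where "d x = (if x = y then \<zero>\<^bsub>k\<^esub> else c x)" for x
    have "{x. d x \<noteq> \<zero>\<^bsub>k\<^esub>} \<subseteq> {x. c x \<noteq> \<zero>\<^bsub>k\<^esub>}" by (auto simp: d_def)
    moreover from this have "finite {x. d x \<noteq> \<zero>\<^bsub>k\<^esub>}"
      by (rule finite_subset) (use insert in \<open>auto simp: mod_free_iff\<close>)
    ultimately have "d \<in> carrier (mod_free k X)"
      using insert(4) by (auto simp: mod_free_iff d_def)
    moreover have "{x. d x \<noteq> \<zero>\<^bsub>k\<^esub>} \<subseteq> Y" using insert(5) by (auto simp: d_def)
    ultimately have d: "d \<in> N" by (rule insert(3))
    show ?case
    proof (cases "c y = \<zero>\<^bsub>k\<^esub>")
      case True
      then have "c = d" by (auto simp: d_def)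
      then show ?thesis using d by simp
    next
      case False
      then have "y \<in> X" using insert(4) by (auto simp: mod_free_iff)
      then have "c y \<odot>\<^bsub>mod_free k X\<^esub> free_gen k y \<in> N"
        using submodule_smult[OF N] gens mod_free_coeff[OF insert(4)] by blast
      then have "c y \<odot>\<^bsub>mod_free k X\<^esub> free_gen k y \<oplus>\<^bsub>mod_free k X\<^esub> d \<in> N" using d submodule_add[OF N] by blast
      moreover have "c y \<odot>\<^bsub>mod_free k X\<^esub> free_gen k y \<oplus>\<^bsub>mod_free k X\<^esub> d = c"
        using mod_free_coeff[OF insert(4)] by (auto simp: d_def free_gen_def)
      ultimately show ?thesis by simp
    qed
  qed
  fix c assume "c \<in> carrier (mod_free k X)"
  then show "c \<in> N" using * by (auto simp: mod_free_iff)
qed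

lemma mod_free_hom_eq:
  assumes M: "Module.module k M" and f: "f \<in> mod_hom k (mod_free k X) M" and g: "g \<in> mod_hom k (mod_free k X) M"
    and eq: "\<And>x. x \<in> X \<Longrightarrow> f (free_gen k x) = g (free_gen k x)" and c: "c \<in> carrier (mod_free k X)"
  shows "f c = g c"
proof -
  interpret M: Module.module k M by (rule M)
  interpret F: Module.module k "mod_free k X" by (rule mod_free_module)
  have "submodule {c \<in> carrier (mod_free k X). f c = g c} k (mod_free k X)"
    by (rule submoduleI'[OF mod_free_module])
      (auto simp only: mem_Collect_eq mod_hom_add[OF f] mod_hom_add[OF g] mod_hom_smult[OF f] mod_hom_smult[OF g]
        mod_hom_zero[OF mod_free_module M f] mod_hom_zero[OF mod_free_module M g]
        F.zero_closed F.add.m_closed F.smult_closed)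
  then have "carrier (mod_free k X) \<subseteq> {c \<in> carrier (mod_free k X). f c = g c}"
    by (rule mod_free_subset_submodule) (simp add: eq free_gen_closed)
  then show ?thesis using c by auto
qed

text \<open>Along an injective map no coefficients are added up, so \<open>free_map\<close> only
  relabels the basis. The basis maps below are injective: postcomposition with any morphism is, and
  so is precomposition with an automorphism.\<close>

lemma free_map_image:
  assumes inj: "inj_on f X" and c: "c \<in> carrier (mod_free k X)" and x: "x \<in> X"
  shows "free_map k f c (f x) = c x"
proof -
  interpret cring k by (rule kcring)
  have "{x'. c x' \<noteq> \<zero>\<^bsub>k\<^esub> \<and> f x' = f x} = (if c x = \<zero>\<^bsub>k\<^esub> then {} else {x})"
    using c inj x by (auto simp: mod_free_iff dest: inj_onD)
  then show ?thesis using mod_free_coeff[OF c] by (simp add: free_map_def)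
qed

lemma free_map_outside:
  assumes c: "c \<in> carrier (mod_free k X)" and y: "y \<notin> f ` X"
  shows "free_map k f c y = \<zero>\<^bsub>k\<^esub>"
proof -
  interpret cring k by (rule kcring)
  have e: "{x. c x \<noteq> \<zero>\<^bsub>k\<^esub> \<and> f x = y} = {}" using c y by (auto simp: mod_free_iff)
  show ?thesis unfolding free_map_def e by simp
qed

lemma free_map_support:
  assumes "inj_on f X" and "c \<in> carrier (mod_free k X)"
  shows "{y. free_map k f c y \<noteq> \<zero>\<^bsub>k\<^esub>} = f ` {x. c x \<noteq> \<zero>\<^bsub>k\<^esub>}"
proof -
  have sub: "{x. c x \<noteq> \<zero>\<^bsub>k\<^esub>} \<subseteq> X" using assms by (simp add: mod_free_iff)
  show ?thesis
  proof (intro equalityI subsetI)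
    fix y assume y: "y \<in> {y. free_map k f c y \<noteq> \<zero>\<^bsub>k\<^esub>}"
    then have "y \<in> f ` X" using free_map_outside[OF assms(2), of y f] by auto
    then obtain x where "x \<in> X" "y = f x" by blast
    then show "y \<in> f ` {x. c x \<noteq> \<zero>\<^bsub>k\<^esub>}" using y free_map_image[OF assms] by simp
  next
    fix y assume "y \<in> f ` {x. c x \<noteq> \<zero>\<^bsub>k\<^esub>}"
    then obtain x where "c x \<noteq> \<zero>\<^bsub>k\<^esub>" "y = f x" by blast
    then show "y \<in> {y. free_map k f c y \<noteq> \<zero>\<^bsub>k\<^esub>}" using sub free_map_image[OF assms, of x] by auto
  qed
qed

lemma free_map_hom:
  assumes inj: "inj_on f X" and f: "f ` X \<subseteq> Y"
  shows "free_map k f \<in> mod_hom k (mod_free k X) (mod_free k Y)"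
proof -
  interpret cring k by (rule kcring)
  interpret F: Module.module k "mod_free k X" by (rule mod_free_module)
  show ?thesis
  proof (rule mod_homI)
    fix c assume c: "c \<in> carrier (mod_free k X)"
    have "free_map k f c y \<in> carrier k" for y
      using free_map_image[OF inj c] free_map_outside[OF c, of y f] mod_free_coeff[OF c] by (cases "y \<in> f ` X") auto
    moreover have "f ` {x. c x \<noteq> \<zero>\<^bsub>k\<^esub>} \<subseteq> Y"
      using c f unfolding mod_free_iff by (meson image_mono order_trans)
    ultimately show "free_map k f c \<in> carrier (mod_free k Y)"
      using c free_map_support[OF inj c] by (simp add: mod_free_iff)
    fix d assume d: "d \<in> carrier (mod_free k X)"
    have cd: "c \<oplus>\<^bsub>mod_free k X\<^esub> d \<in> carrier (mod_free k X)" using c d by (rule F.add.m_closed)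
    show "free_map k f (c \<oplus>\<^bsub>mod_free k X\<^esub> d) = free_map k f c \<oplus>\<^bsub>mod_free k Y\<^esub> free_map k f d"
    proof
      fix y show "free_map k f (c \<oplus>\<^bsub>mod_free k X\<^esub> d) y = (free_map k f c \<oplus>\<^bsub>mod_free k Y\<^esub> free_map k f d) y"
        by (cases "y \<in> f ` X") (use inj in \<open>auto simp: free_map_image[OF inj c] free_map_image[OF inj d] free_map_image[OF inj cd, unfolded mod_free_simps] free_map_outside[OF c] free_map_outside[OF d] free_map_outside[OF cd, unfolded mod_free_simps]\<close>)
    qed
  next
    fix a c assume a: "a \<in> carrier k" and c: "c \<in> carrier (mod_free k X)"
    have ac: "a \<odot>\<^bsub>mod_free k X\<^esub> c \<in> carrier (mod_free k X)" using a c by (rule F.smult_closed)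
    show "free_map k f (a \<odot>\<^bsub>mod_free k X\<^esub> c) = a \<odot>\<^bsub>mod_free k Y\<^esub> free_map k f c"
    proof
      fix y show "free_map k f (a \<odot>\<^bsub>mod_free k X\<^esub> c) y = (a \<odot>\<^bsub>mod_free k Y\<^esub> free_map k f c) y"
        by (cases "y \<in> f ` X") (use a in \<open>auto simp: free_map_image[OF inj c] free_map_image[OF inj ac, unfolded mod_free_simps] free_map_outside[OF c] free_map_outside[OF ac, unfolded mod_free_simps]\<close>)
    qed
  qed
qed

lemma free_map_gen:
  assumes inj: "inj_on f X" and x: "x \<in> X"
  shows "free_map k f (free_gen k x) = free_gen k (f x)"
proof
  fix y show "free_map k f (free_gen k x) y = free_gen k (f x) y"
  proof (cases "y \<in> f ` X")
    case True
    then obtain x' where "x' \<in> X" "y = f x'" by blast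
    then show ?thesis using free_map_image[OF inj free_gen_closed[OF x]] inj x
      by (auto simp: free_gen_def dest: inj_onD)
  next
    case False
    then show ?thesis using free_map_outside[OF free_gen_closed[OF x] False] x by (auto simp: free_gen_def)
  qed
qed

lemma free_eval_superset:
  assumes M: "Module.module k M" and f: "\<And>x. x \<in> X \<Longrightarrow> f x \<in> carrier M" and c: "c \<in> carrier (mod_free k X)"
    and Y: "finite Y" "{x. c x \<noteq> \<zero>\<^bsub>k\<^esub>} \<subseteq> Y" "Y \<subseteq> X"
  shows "free_eval k M f c = (\<Oplus>\<^bsub>M\<^esub>x\<in>Y. c x \<odot>\<^bsub>M\<^esub> f x)"
proof -
  interpret M: Module.module k M by (rule M)
  show ?thesis unfolding free_eval_def
    by (rule M.add.finprod_mono_neutral_cong_left[OF Y(1,2)])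
      (use f Y(3) mod_free_coeff[OF c] in \<open>auto\<close>)
qed

lemma free_eval_hom:
  assumes M: "Module.module k M" and f: "\<And>x. x \<in> X \<Longrightarrow> f x \<in> carrier M"
  shows "free_eval k M f \<in> mod_hom k (mod_free k X) M"
proof -
  interpret M: Module.module k M by (rule M)
  interpret F: Module.module k "mod_free k X" by (rule mod_free_module)
  let ?s = "\<lambda>c. {x. c x \<noteq> \<zero>\<^bsub>k\<^esub>}"
  have fin: "finite (?s c)" "?s c \<subseteq> X" if "c \<in> carrier (mod_free k X)" for c
    using that by (auto simp: mod_free_iff)
  have cl: "(\<lambda>x. c x \<odot>\<^bsub>M\<^esub> f x) \<in> Y \<rightarrow> carrier M" if "c \<in> carrier (mod_free k X)" "Y \<subseteq> X" for c Y
    by (rule Pi_I) (use f that(2) mod_free_coeff[OF that(1)] in auto)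
  show ?thesis
  proof (rule mod_homI)
    fix c assume c: "c \<in> carrier (mod_free k X)"
    show "free_eval k M f c \<in> carrier M"
      unfolding free_eval_def by (rule M.finsum_closed[OF cl[OF c fin(2)[OF c]]])
    fix d assume d: "d \<in> carrier (mod_free k X)"
    have cd: "c \<oplus>\<^bsub>mod_free k X\<^esub> d \<in> carrier (mod_free k X)" using c d by (rule F.add.m_closed)
    let ?Y = "?s c \<union> ?s d"
    have Y: "finite ?Y" "?Y \<subseteq> X" using fin[OF c] fin[OF d] by auto
    have "?s (c \<oplus>\<^bsub>mod_free k X\<^esub> d) \<subseteq> ?Y" by auto
    from free_eval_superset[OF M f cd Y(1) this Y(2)]
    have "free_eval k M f (c \<oplus>\<^bsub>mod_free k X\<^esub> d) = (\<Oplus>\<^bsub>M\<^esub>x\<in>?Y. (c x \<oplus>\<^bsub>k\<^esub> d x) \<odot>\<^bsub>M\<^esub> f x)" by simp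
    also have "\<dots> = (\<Oplus>\<^bsub>M\<^esub>x\<in>?Y. c x \<odot>\<^bsub>M\<^esub> f x \<oplus>\<^bsub>M\<^esub> d x \<odot>\<^bsub>M\<^esub> f x)"
      by (rule M.finsum_cong'[OF refl])
        (use f[OF subsetD[OF Y(2)]] mod_free_coeff[OF c] mod_free_coeff[OF d] in \<open>simp_all add: M.smult_l_distr Pi_iff\<close>)
    also have "\<dots> = (\<Oplus>\<^bsub>M\<^esub>x\<in>?Y. c x \<odot>\<^bsub>M\<^esub> f x) \<oplus>\<^bsub>M\<^esub> (\<Oplus>\<^bsub>M\<^esub>x\<in>?Y. d x \<odot>\<^bsub>M\<^esub> f x)"
      by (rule M.finsum_addf[OF cl[OF c Y(2)] cl[OF d Y(2)]])
    also have "\<dots> = free_eval k M f c \<oplus>\<^bsub>M\<^esub> free_eval k M f d"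
      using free_eval_superset[OF M f c Y(1) _ Y(2)] free_eval_superset[OF M f d Y(1) _ Y(2)] by simp
    finally show "free_eval k M f (c \<oplus>\<^bsub>mod_free k X\<^esub> d) = free_eval k M f c \<oplus>\<^bsub>M\<^esub> free_eval k M f d" .
  next
    fix a c assume a: "a \<in> carrier k" and c: "c \<in> carrier (mod_free k X)"
    have ac: "a \<odot>\<^bsub>mod_free k X\<^esub> c \<in> carrier (mod_free k X)" using a c by (rule F.smult_closed)
    have "?s (a \<odot>\<^bsub>mod_free k X\<^esub> c) \<subseteq> ?s c" using a by (auto simp: cring.cring_simprules[OF kcring])
    from free_eval_superset[OF M f ac fin(1)[OF c] this fin(2)[OF c]]
    have "free_eval k M f (a \<odot>\<^bsub>mod_free k X\<^esub> c) = (\<Oplus>\<^bsub>M\<^esub>x\<in>?s c. (a \<otimes>\<^bsub>k\<^esub> c x) \<odot>\<^bsub>M\<^esub> f x)" by simp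
    also have "\<dots> = (\<Oplus>\<^bsub>M\<^esub>x\<in>?s c. a \<odot>\<^bsub>M\<^esub> (c x \<odot>\<^bsub>M\<^esub> f x))"
      by (rule M.finsum_cong'[OF refl])
        (use f[OF subsetD[OF fin(2)[OF c]]] a mod_free_coeff[OF c] in \<open>simp_all add: M.smult_assoc1 Pi_iff\<close>)
    also have "\<dots> = a \<odot>\<^bsub>M\<^esub> free_eval k M f c"
      unfolding free_eval_def by (rule M.finsum_smult_ldistr[symmetric, OF fin(1)[OF c] a cl[OF c fin(2)[OF c]]])
    finally show "free_eval k M f (a \<odot>\<^bsub>mod_free k X\<^esub> c) = a \<odot>\<^bsub>M\<^esub> free_eval k M f c" .
  qed
qed

lemma free_eval_gen:
  assumes M: "Module.module k M" and "f x \<in> carrier M"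
  shows "free_eval k M f (free_gen k x) = f x"
proof -
  interpret M: Module.module k M by (rule M)
  have "free_eval k M f (free_gen k x) = (\<Oplus>\<^bsub>M\<^esub>y\<in>{x}. free_gen k x y \<odot>\<^bsub>M\<^esub> f y)"
    by (rule free_eval_superset[OF M _ free_gen_closed[of x "{x}"]]) (use assms in \<open>auto simp: free_gen_def\<close>)
  then show ?thesis using assms by (simp add: free_gen_def)
qed

section \<open>Free C-modules\<close>

abbreviation free_basis :: "(nat \<Rightarrow> 'b set) \<Rightarrow> nat \<Rightarrow> (nat \<times> 'g mor \<times> 'b) set" where
  "free_basis X n \<equiv> {(m, \<phi>, x). \<phi> \<in> mor G m n \<and> x \<in> X m}"

lemma cmod_free_obj: "obj (cmod_free G k X) n = mod_free k (free_basis X n)"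
  and cmod_free_act: "act (cmod_free G k X) n n' \<psi> = free_map k (\<lambda>(m, \<phi>, x). (m, mor_comp G m \<psi> \<phi>, x))"
  by (simp_all add: cmod_free_def)

lemma free_basis_inj:
  assumes "\<psi> \<in> mor G n n'"
  shows "inj_on (\<lambda>(m, \<phi>, x). (m, mor_comp G m \<psi> \<phi>, x)) (free_basis X n)"
  using mor_left_cancel[OF assms] by (auto intro!: inj_onI)

lemma free_basis_closed:
  assumes "\<psi> \<in> mor G n n'"
  shows "(\<lambda>(m, \<phi>, x). (m, mor_comp G m \<psi> \<phi>, x)) ` free_basis X n \<subseteq> free_basis X n'"
  using mor_comp_closed[OF assms] by auto

lemma cmod_free_cmodule: "cmodule G k (cmod_free G k X)"
  unfolding cmodule_def cmod_free_obj cmod_free_act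
proof (intro conjI allI ballI)
  fix n c assume c: "c \<in> carrier (mod_free k (free_basis X n))"
  have id: "(\<lambda>c. c) \<in> mod_hom k (mod_free k (free_basis X n)) (mod_free k (free_basis X n))"
    by (simp add: mod_hom_def)
  show "free_map k (\<lambda>(m, \<phi>, x). (m, mor_comp G m (mor_id G n) \<phi>, x)) c = c"
    by (rule mod_free_hom_eq[OF mod_free_module free_map_hom[OF free_basis_inj[OF mor_id_closed]
        free_basis_closed[OF mor_id_closed]] id _ c])
      (auto simp: free_map_gen[OF free_basis_inj[OF mor_id_closed]] mor_comp_id_left)
next
  fix l m n \<psi> \<phi> c assume \<psi>: "\<psi> \<in> mor G l m" and \<phi>: "\<phi> \<in> mor G m n" and c: "c \<in> carrier (mod_free k (free_basis X l))"
  note \<phi>\<psi> = mor_comp_closed[OF \<phi> \<psi>]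
  note h = free_map_hom[OF free_basis_inj free_basis_closed]
  show "free_map k (\<lambda>(p, \<chi>, x). (p, mor_comp G p (mor_comp G l \<phi> \<psi>) \<chi>, x)) c =
     free_map k (\<lambda>(p, \<chi>, x). (p, mor_comp G p \<phi> \<chi>, x)) (free_map k (\<lambda>(p, \<chi>, x). (p, mor_comp G p \<psi> \<chi>, x)) c)"
  proof (rule mod_free_hom_eq[OF mod_free_module h[OF \<phi>\<psi> \<phi>\<psi>] mod_hom_comp[OF h[OF \<psi> \<psi>] h[OF \<phi> \<phi>]] _ c])
    fix b assume "b \<in> free_basis X l"
    then obtain p \<chi> x where b: "b = (p, \<chi>, x)" "\<chi> \<in> mor G p l" "x \<in> X p" by auto
    have b': "(p, mor_comp G p \<psi> \<chi>, x) \<in> free_basis X m" using b mor_comp_closed[OF \<psi>] by auto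
    show "free_map k (\<lambda>(p, \<chi>, x). (p, mor_comp G p (mor_comp G l \<phi> \<psi>) \<chi>, x)) (free_gen k b) =
     free_map k (\<lambda>(p, \<chi>, x). (p, mor_comp G p \<phi> \<chi>, x)) (free_map k (\<lambda>(p, \<chi>, x). (p, mor_comp G p \<psi> \<chi>, x)) (free_gen k b))"
      using free_map_gen[OF free_basis_inj[OF \<phi>\<psi>] \<open>b \<in> _\<close>] free_map_gen[OF free_basis_inj[OF \<psi>] \<open>b \<in> _\<close>]
        free_map_gen[OF free_basis_inj[OF \<phi>] b'] b mor_comp_assoc[OF \<phi> \<psi> b(2)] by simp
  qed
next
  fix m n \<psi> assume \<psi>: "\<psi> \<in> mor G m n"
  show "free_map k (\<lambda>(m, \<phi>, x). (m, mor_comp G m \<psi> \<phi>, x))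
      \<in> mod_hom k (mod_free k (free_basis X m)) (mod_free k (free_basis X n))"
    by (rule free_map_hom[OF free_basis_inj[OF \<psi>] free_basis_closed[OF \<psi>]])
qed (rule mod_free_module)

lemma cmod_hom_free_eval:
  assumes W: "cmodule G k W" and f: "\<And>m x. x \<in> X m \<Longrightarrow> f m x \<in> full W m"
  shows "cmod_hom G k (cmod_free G k X) W (\<lambda>n. free_eval k (obj W n) (\<lambda>(m, \<phi>, x). act W m n \<phi> (f m x)))"
proof -
  have cl: "(\<lambda>(m, \<phi>, x). act W m n \<phi> (f m x)) b \<in> full W n" if "b \<in> free_basis X n" for b n
    using that act_closed[OF W] f by auto
  note h = free_eval_hom[OF cmodule_module[OF W] cl]
  show ?thesis
    unfolding cmod_hom_def cmod_free_obj cmod_free_act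
  proof (intro conjI allI ballI)
    fix m n \<phi> c assume \<phi>: "\<phi> \<in> mor G m n" and c: "c \<in> carrier (mod_free k (free_basis X m))"
    note fh = free_map_hom[OF free_basis_inj[OF \<phi>] free_basis_closed[OF \<phi>]]
    show "free_eval k (obj W n) (\<lambda>(m, \<phi>, x). act W m n \<phi> (f m x)) (free_map k (\<lambda>(p, \<chi>, x). (p, mor_comp G p \<phi> \<chi>, x)) c)
       = act W m n \<phi> (free_eval k (obj W m) (\<lambda>(p, \<phi>, x). act W p m \<phi> (f p x)) c)"
    proof (rule mod_free_hom_eq[OF cmodule_module[OF W] mod_hom_comp[OF fh h] mod_hom_comp[OF h cmodule_act[OF W \<phi>]] _ c])
      fix b assume b: "b \<in> free_basis X m"
      then obtain p \<chi> x where *: "b = (p, \<chi>, x)" "\<chi> \<in> mor G p m" "x \<in> X p" by auto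
      have b': "(p, mor_comp G p \<phi> \<chi>, x) \<in> free_basis X n" using * mor_comp_closed[OF \<phi>] by auto
      show "free_eval k (obj W n) (\<lambda>(m, \<phi>, x). act W m n \<phi> (f m x)) (free_map k (\<lambda>(p, \<chi>, x). (p, mor_comp G p \<phi> \<chi>, x)) (free_gen k b))
       = act W m n \<phi> (free_eval k (obj W m) (\<lambda>(p, \<phi>, x). act W p m \<phi> (f p x)) (free_gen k b))"
        using free_map_gen[OF free_basis_inj[OF \<phi>] b] cl[OF b'] cl[OF b] *
          cmodule_comp[OF W *(2) \<phi> f[OF *(3)]] by (simp add: free_eval_gen[OF cmodule_module[OF W]])
    qed
  qed (rule h)
qed

end

section \<open>Quotients, transport and the standard cover\<close>

lemma abelian_group_cosets:
  assumes M: "Module.module k M" and N: "submodule N k M"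
  shows "x \<in> carrier M \<Longrightarrow> x \<in> N +>\<^bsub>M\<^esub> x"
    and "x \<in> carrier M \<Longrightarrow> y \<in> N +>\<^bsub>M\<^esub> x \<longleftrightarrow> (\<exists>h\<in>N. y = h \<oplus>\<^bsub>M\<^esub> x)"
    and "x \<in> N \<Longrightarrow> N +>\<^bsub>M\<^esub> x = N"
    and "x \<in> carrier M \<Longrightarrow> y \<in> carrier M \<Longrightarrow> N +>\<^bsub>M\<^esub> x = N +>\<^bsub>M\<^esub> y \<longleftrightarrow> x \<ominus>\<^bsub>M\<^esub> y \<in> N"
proof -
  interpret M: Module.module k M by (rule M)
  note sub = subsetD[OF submodule_subset[OF N]]
  show mem: "y \<in> N +>\<^bsub>M\<^esub> x \<longleftrightarrow> (\<exists>h\<in>N. y = h \<oplus>\<^bsub>M\<^esub> x)" if "x \<in> carrier M" for x y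
    by (auto simp: a_r_coset_def')
  show self: "x \<in> N +>\<^bsub>M\<^esub> x" if "x \<in> carrier M" for x
    unfolding mem[OF that] using submodule_zero[OF N] that by (intro bexI[of _ "\<zero>\<^bsub>M\<^esub>"]) simp_all
  have le: "N +>\<^bsub>M\<^esub> x \<subseteq> N +>\<^bsub>M\<^esub> y" if xy: "x \<in> carrier M" "y \<in> carrier M" "x \<ominus>\<^bsub>M\<^esub> y \<in> N" for x y
  proof
    fix z assume "z \<in> N +>\<^bsub>M\<^esub> x"
    then obtain h where h: "h \<in> N" "z = h \<oplus>\<^bsub>M\<^esub> x" using mem xy by auto
    have "z = (h \<oplus>\<^bsub>M\<^esub> (x \<ominus>\<^bsub>M\<^esub> y)) \<oplus>\<^bsub>M\<^esub> y"
      using h sub[of h] xy by (simp add: M.minus_eq M.a_assoc M.l_neg)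
    moreover have "h \<oplus>\<^bsub>M\<^esub> (x \<ominus>\<^bsub>M\<^esub> y) \<in> N" using submodule_add[OF N h(1) xy(3)] .
    ultimately show "z \<in> N +>\<^bsub>M\<^esub> y" using mem xy by auto
  qed
  show eq: "N +>\<^bsub>M\<^esub> x = N +>\<^bsub>M\<^esub> y \<longleftrightarrow> x \<ominus>\<^bsub>M\<^esub> y \<in> N" if xy: "x \<in> carrier M" "y \<in> carrier M" for x y
  proof
    assume "N +>\<^bsub>M\<^esub> x = N +>\<^bsub>M\<^esub> y"
    then obtain h where h: "h \<in> N" "x = h \<oplus>\<^bsub>M\<^esub> y" using self[of x] mem[of y x] xy by auto
    then have "x \<ominus>\<^bsub>M\<^esub> y = h" using sub[of h] xy by (simp add: M.minus_eq M.a_assoc M.r_neg)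
    then show "x \<ominus>\<^bsub>M\<^esub> y \<in> N" using h by simp
  next
    assume d: "x \<ominus>\<^bsub>M\<^esub> y \<in> N"
    have "y \<ominus>\<^bsub>M\<^esub> x = \<ominus>\<^bsub>M\<^esub> (x \<ominus>\<^bsub>M\<^esub> y)"
      using xy by (simp add: M.minus_eq M.minus_add M.a_comm)
    then have "y \<ominus>\<^bsub>M\<^esub> x \<in> N" using submodule_a_inv[OF N d] by simp
    then show "N +>\<^bsub>M\<^esub> x = N +>\<^bsub>M\<^esub> y" using le d xy by blast
  qed
  have z: "N +>\<^bsub>M\<^esub> \<zero>\<^bsub>M\<^esub> = N"
    using sub by (auto simp: a_r_coset_def')
  show "N +>\<^bsub>M\<^esub> x = N" if "x \<in> N"
    using eq[OF sub[OF that] M.zero_closed] z submodule_minus[OF N that submodule_zero[OF N]] by simp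
qed

text \<open>All members of the coset are sent into one and the same target coset, so the union in
  \<open>coset_map\<close> ranges over equal sets.\<close>

lemma coset_map_coset:
  assumes M: "Module.module k M" and N: "submodule N k M" and M': "Module.module k M'" and N': "submodule N' k M'"
    and f: "f \<in> mod_hom k M M'" and sub: "f ` N \<subseteq> N'" and x: "x \<in> carrier M"
  shows "coset_map M' N' f (N +>\<^bsub>M\<^esub> x) = N' +>\<^bsub>M'\<^esub> f x"
proof -
  interpret M: Module.module k M by (rule M)
  interpret M': Module.module k M' by (rule M')
  have "N' +>\<^bsub>M'\<^esub> f y = N' +>\<^bsub>M'\<^esub> f x" if y: "y \<in> N +>\<^bsub>M\<^esub> x" for y
  proof -
    obtain h where h: "h \<in> N" "y = h \<oplus>\<^bsub>M\<^esub> x" using y abelian_group_cosets(2)[OF M N x] by auto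
    have hc: "h \<in> carrier M" using h(1) submodule_subset[OF N] by auto
    have "f y = f h \<oplus>\<^bsub>M'\<^esub> f x" using h hc x by (simp add: mod_hom_add[OF f])
    then have "f y \<ominus>\<^bsub>M'\<^esub> f x = f h"
      using mod_hom_closed[OF f] hc x by (simp add: M'.minus_eq M'.a_assoc M'.r_neg)
    moreover have "f h \<in> N'" using h sub by auto
    moreover have "f y \<in> carrier M'" "f x \<in> carrier M'" using h hc x mod_hom_closed[OF f] by auto
    ultimately show ?thesis using abelian_group_cosets(4)[OF M' N'] by simp
  qed
  then show ?thesis
    unfolding coset_map_def using abelian_group_cosets(1)[OF M N x] by blast
qed

lemma module_image:
  assumes M: "Module.module k M" and car: "carrier M' = h ` carrier M"
    and add: "\<And>x y. x \<in> carrier M \<Longrightarrow> y \<in> carrier M \<Longrightarrow> h x \<oplus>\<^bsub>M'\<^esub> h y = h (x \<oplus>\<^bsub>M\<^esub> y)"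
    and zero: "\<zero>\<^bsub>M'\<^esub> = h \<zero>\<^bsub>M\<^esub>"
    and smult: "\<And>a x. a \<in> carrier k \<Longrightarrow> x \<in> carrier M \<Longrightarrow> a \<odot>\<^bsub>M'\<^esub> h x = h (a \<odot>\<^bsub>M\<^esub> x)"
  shows "Module.module k M'"
proof -
  interpret M: Module.module k M by (rule M)
  have "abelian_group M'"
  proof (rule abelian_groupI)
    fix x assume "x \<in> carrier M'"
    then obtain y where y: "y \<in> carrier M" "x = h y" using car by blast
    then show "\<exists>y\<in>carrier M'. y \<oplus>\<^bsub>M'\<^esub> x = \<zero>\<^bsub>M'\<^esub>"
      using car by (intro bexI[of _ "h (\<ominus>\<^bsub>M\<^esub> y)"]) (simp_all add: add zero M.l_neg)
  qed (use car in \<open>auto simp: add zero M.a_ac\<close>)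
  then show ?thesis
    by (rule moduleI[OF M.R.is_cring])
      (use car in \<open>auto simp: add smult M.smult_l_distr M.smult_r_distr M.smult_assoc1\<close>)
qed

lemma mod_quot_simps [simp]:
  "carrier (mod_quot M N) = a_rcosets\<^bsub>M\<^esub> N" "\<zero>\<^bsub>mod_quot M N\<^esub> = N"
  "X \<oplus>\<^bsub>mod_quot M N\<^esub> Y = set_add M X Y" "a \<odot>\<^bsub>mod_quot M N\<^esub> X = coset_map M N (\<lambda>x. a \<odot>\<^bsub>M\<^esub> x) X"
  by (simp_all add: mod_quot_def)

lemma a_rcosets_image: "a_rcosets\<^bsub>M\<^esub> N = (\<lambda>x. N +>\<^bsub>M\<^esub> x) ` carrier M"
  by (auto simp: A_RCOSETS_def')

lemma mod_quot_image:
  assumes M: "Module.module k M" and N: "submodule N k M"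
  shows "x \<in> carrier M \<Longrightarrow> y \<in> carrier M \<Longrightarrow>
      (N +>\<^bsub>M\<^esub> x) \<oplus>\<^bsub>mod_quot M N\<^esub> (N +>\<^bsub>M\<^esub> y) = N +>\<^bsub>M\<^esub> (x \<oplus>\<^bsub>M\<^esub> y)"
    and "\<zero>\<^bsub>mod_quot M N\<^esub> = N +>\<^bsub>M\<^esub> \<zero>\<^bsub>M\<^esub>"
    and "a \<in> carrier k \<Longrightarrow> x \<in> carrier M \<Longrightarrow> a \<odot>\<^bsub>mod_quot M N\<^esub> (N +>\<^bsub>M\<^esub> x) = N +>\<^bsub>M\<^esub> (a \<odot>\<^bsub>M\<^esub> x)"
proof -
  interpret M: Module.module k M by (rule M)
  have "subgroup N (add_monoid M)" using N by (rule submodule.axioms)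
  then interpret N: abelian_subgroup N M
    by (intro abelian_subgroupI3 additive_subgroup.intro M.abelian_group_axioms)
  show "(N +>\<^bsub>M\<^esub> x) \<oplus>\<^bsub>mod_quot M N\<^esub> (N +>\<^bsub>M\<^esub> y) = N +>\<^bsub>M\<^esub> (x \<oplus>\<^bsub>M\<^esub> y)"
    if "x \<in> carrier M" "y \<in> carrier M" using N.a_rcos_sum[OF that] by simp
  show "\<zero>\<^bsub>mod_quot M N\<^esub> = N +>\<^bsub>M\<^esub> \<zero>\<^bsub>M\<^esub>"
    using abelian_group_cosets(3)[OF M N submodule_zero[OF N]] by simp
  assume a: "a \<in> carrier k" and x: "x \<in> carrier M"
  have "(\<lambda>x. a \<odot>\<^bsub>M\<^esub> x) \<in> mod_hom k M M"
    using a by (intro mod_homI)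
      (simp_all add: M.smult_r_distr M.smult_assoc1[symmetric] M.R.m_comm)
  moreover have "(\<lambda>x. a \<odot>\<^bsub>M\<^esub> x) ` N \<subseteq> N" using submodule_smult[OF N a] by blast
  ultimately show "a \<odot>\<^bsub>mod_quot M N\<^esub> (N +>\<^bsub>M\<^esub> x) = N +>\<^bsub>M\<^esub> (a \<odot>\<^bsub>M\<^esub> x)"
    using coset_map_coset[OF M N M N _ _ x] by simp
qed

lemma mod_quot_module:
  assumes M: "Module.module k M" and N: "submodule N k M"
  shows "Module.module k (mod_quot M N)"
  by (rule module_image[where h = "\<lambda>x. N +>\<^bsub>M\<^esub> x", OF M _ mod_quot_image[OF M N]])
    (simp_all only: mod_quot_simps(1) a_rcosets_image)

lemma submodule_restrict_module: "Module.module k M \<Longrightarrow> submodule N k M \<Longrightarrow> Module.module k (M\<lparr>carrier := N\<rparr>)"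
  by (rule submodule.submodule_is_module)

lemma restrict_obj [simp]: "obj (cmod_restrict V A) n = (obj V n)\<lparr>carrier := A n\<rparr>"
  and restrict_act [simp]: "act (cmod_restrict V A) = act V"
  by (simp_all add: cmod_restrict_def)

lemma quot_obj [simp]: "obj (cmod_quot V B) n = mod_quot (obj V n) (B n)"
  and quot_act [simp]: "act (cmod_quot V B) m n \<phi> = coset_map (obj V n) (B n) (act V m n \<phi>)"
  by (simp_all add: cmod_quot_def)

context FIG
begin

text \<open>The axioms pass along any family of surjections compatible with the operations. This
  covers quotients, along the coset maps, and transport of structure.\<close>

lemma cmodule_image:
  assumes V: "cmodule G k V" and car: "\<And>n. full U n = h n ` full V n"
    and add: "\<And>n x y. x \<in> full V n \<Longrightarrow> y \<in> full V n \<Longrightarrow> h n x \<oplus>\<^bsub>obj U n\<^esub> h n y = h n (x \<oplus>\<^bsub>obj V n\<^esub> y)"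
    and zero: "\<And>n. \<zero>\<^bsub>obj U n\<^esub> = h n \<zero>\<^bsub>obj V n\<^esub>"
    and smult: "\<And>n a x. a \<in> carrier k \<Longrightarrow> x \<in> full V n \<Longrightarrow> a \<odot>\<^bsub>obj U n\<^esub> h n x = h n (a \<odot>\<^bsub>obj V n\<^esub> x)"
    and act: "\<And>m n \<phi> v. \<phi> \<in> mor G m n \<Longrightarrow> v \<in> full V m \<Longrightarrow> act U m n \<phi> (h m v) = h n (act V m n \<phi> v)"
  shows "cmodule G k U" "cmod_hom G k V U h"
proof -
  have M: "Module.module k (obj V n)" for n by (rule cmodule_module[OF V])
  have h: "h n \<in> mod_hom k (obj V n) (obj U n)" for n
    by (rule mod_homI) (use car in \<open>simp_all add: add smult\<close>)
  show "cmod_hom G k V U h" using h act by (simp add: cmod_hom_def)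
  have MU: "Module.module k (obj U n)" for n
    by (rule module_image[OF M car add zero smult])
  have mh: "act U m n \<phi> \<in> mod_hom k (obj U m) (obj U n)" if \<phi>: "\<phi> \<in> mor G m n" for m n \<phi>
  proof (rule mod_homI)
    interpret Vm: Module.module k "obj V m" by (rule M)
    fix x assume "x \<in> full U m"
    then obtain v where v: "v \<in> full V m" "x = h m v" using car by blast
    show "act U m n \<phi> x \<in> full U n" using v car act[OF \<phi>] act_closed[OF V \<phi>] by simp
    fix a assume a: "a \<in> carrier k"
    show "act U m n \<phi> (a \<odot>\<^bsub>obj U m\<^esub> x) = a \<odot>\<^bsub>obj U n\<^esub> act U m n \<phi> x"
      using v a act_closed[OF V \<phi>] by (simp add: smult act[OF \<phi>] mod_hom_smult[OF cmodule_act[OF V \<phi>]])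
  next
    interpret Vm: Module.module k "obj V m" by (rule M)
    fix x y assume "x \<in> full U m" "y \<in> full U m"
    then obtain v w where v: "v \<in> full V m" "x = h m v" "w \<in> full V m" "y = h m w" using car by blast
    show "act U m n \<phi> (x \<oplus>\<^bsub>obj U m\<^esub> y) = act U m n \<phi> x \<oplus>\<^bsub>obj U n\<^esub> act U m n \<phi> y"
      using v act_closed[OF V \<phi>] by (simp add: add act[OF \<phi>] mod_hom_add[OF cmodule_act[OF V \<phi>]])
  qed
  show "cmodule G k U"
    unfolding cmodule_def
  proof (intro conjI allI ballI)
    fix n x assume "x \<in> full U n"
    then obtain v where "v \<in> full V n" "x = h n v" using car by blast
    then show "act U n n (mor_id G n) x = x" using act[OF mor_id_closed] cmodule_id[OF V] by simp
  next
    fix l m n \<psi> \<phi> x assume \<psi>: "\<psi> \<in> mor G l m" and \<phi>: "\<phi> \<in> mor G m n" and "x \<in> full U l"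
    then obtain v where v: "v \<in> full V l" "x = h l v" using car by blast
    then show "act U l n (mor_comp G l \<phi> \<psi>) x = act U m n \<phi> (act U l m \<psi> x)"
      by (simp add: act[OF mor_comp_closed[OF \<phi> \<psi>]] act[OF \<phi>] act[OF \<psi>] act_closed[OF V \<psi>]
          cmodule_comp[OF V \<psi> \<phi>])
  qed (use MU mh in auto)
qed

lemma cmod_quot_cmodule:
  assumes V: "cmodule G k V" and B: "csubmodule G k V B"
  shows "cmodule G k (cmod_quot V B)" "cmod_hom G k V (cmod_quot V B) (\<lambda>n x. B n +>\<^bsub>obj V n\<^esub> x)"
proof -
  note M = cmodule_module[OF V] and N = csubmodule_submodule[OF B]
  have a: "act (cmod_quot V B) m n \<phi> (B m +>\<^bsub>obj V m\<^esub> v) = B n +>\<^bsub>obj V n\<^esub> act V m n \<phi> v"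
    if "\<phi> \<in> mor G m n" "v \<in> full V m" for m n \<phi> v
  proof -
    have "act V m n \<phi> ` B m \<subseteq> B n" using csubmodule_act[OF B that(1)] by blast
    from coset_map_coset[OF M N M N cmodule_act[OF V that(1)] this that(2)] show ?thesis by simp
  qed
  show "cmodule G k (cmod_quot V B)" "cmod_hom G k V (cmod_quot V B) (\<lambda>n x. B n +>\<^bsub>obj V n\<^esub> x)"
    by (rule cmodule_image[OF V _ _ _ _ a]; simp only: quot_obj mod_quot_simps(1) a_rcosets_image mod_quot_image[OF M N])+
qed

lemma cmod_restrict_cmodule:
  assumes V: "cmodule G k V" and A: "csubmodule G k V A"
  shows "cmodule G k (cmod_restrict V A)"
proof -
  note sub = subsetD[OF csubmodule_subset[OF A]]
  show ?thesis
    unfolding cmodule_def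
  proof (intro conjI allI ballI)
    fix m n \<phi> assume \<phi>: "\<phi> \<in> mor G m n"
    show "act (cmod_restrict V A) m n \<phi> \<in> mod_hom k (obj (cmod_restrict V A) m) (obj (cmod_restrict V A) n)"
      by (rule mod_homI) (simp_all add: csubmodule_act[OF A \<phi>] mod_hom_add[OF cmodule_act[OF V \<phi>]]
        mod_hom_smult[OF cmodule_act[OF V \<phi>]] sub)
  qed (simp_all add: submodule_restrict_module[OF cmodule_module[OF V] csubmodule_submodule[OF A]]
      sub cmodule_id[OF V] cmodule_comp[OF V])
qed

lemma cmod_hom_restrict_target:
  assumes "csubmodule G k P K" and "cmod_hom G k V (cmod_restrict P K) \<eta>"
  shows "cmod_hom G k V P \<eta>" "\<And>n. \<eta> n ` full V n \<subseteq> K n"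
proof -
  show K: "\<eta> n ` full V n \<subseteq> K n" for n
    using mod_hom_closed[OF cmod_hom_mod_hom[OF assms(2)], of _ n] by auto
  have "\<eta> n \<in> mod_hom k (obj V n) (obj P n)" for n
  proof (rule mod_homI)
    note h = cmod_hom_mod_hom[OF assms(2), of n]
    show "\<eta> n x \<in> full P n" if "x \<in> full V n" for x
      using K[of n] csubmodule_subset[OF assms(1)] that by blast
    show "\<eta> n (x \<oplus>\<^bsub>obj V n\<^esub> y) = \<eta> n x \<oplus>\<^bsub>obj P n\<^esub> \<eta> n y" if "x \<in> full V n" "y \<in> full V n" for x y
      using mod_hom_add[OF h that] by simp
    show "\<eta> n (a \<odot>\<^bsub>obj V n\<^esub> x) = a \<odot>\<^bsub>obj P n\<^esub> \<eta> n x" if "a \<in> carrier k" "x \<in> full V n" for a x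
      using mod_hom_smult[OF h that] by simp
  qed
  then show "cmod_hom G k V P \<eta>" using cmod_hom_act[OF assms(2)] by (simp add: cmod_hom_def)
qed

lemma cmod_hom_comp:
  assumes "cmod_hom G k U V f" "cmod_hom G k V W g"
  shows "cmod_hom G k U W (\<lambda>n x. g n (f n x))"
  unfolding cmod_hom_def
proof (intro conjI allI ballI)
  show "(\<lambda>x. g n (f n x)) \<in> mod_hom k (obj U n) (obj W n)" for n
    by (rule mod_hom_comp[OF cmod_hom_mod_hom[OF assms(1)] cmod_hom_mod_hom[OF assms(2)]])
qed (simp add: cmod_hom_act[OF assms(1)] cmod_hom_act[OF assms(2)] mod_hom_closed[OF cmod_hom_mod_hom[OF assms(1)]])

lemma cmod_hom_kernel:
  assumes V: "cmodule G k V" and U: "cmodule G k U" and \<eta>: "cmod_hom G k V U \<eta>"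
  shows "csubmodule G k V (\<lambda>n. {v \<in> full V n. \<eta> n v = \<zero>\<^bsub>obj U n\<^esub>})"
proof -
  have "submodule {v \<in> full V n. \<eta> n v = \<zero>\<^bsub>obj U n\<^esub>} k (obj V n)" for n
    using submodule_preimage[OF cmodule_module[OF V] cmodule_module[OF U] cmod_hom_mod_hom[OF \<eta>]
      submodule_trivial[OF cmodule_module[OF U]]] by simp
  then show ?thesis
    unfolding csubmodule_def by (auto simp: act_closed[OF V] cmod_hom_act[OF \<eta>] act_zero[OF U])
qed

lemma cmod_transport_cmodule:
  assumes V: "cmodule G k V" and inj: "\<And>n. inj_on h (full V n)"
  shows "cmodule G k (cmod_transport h V)" "cmod_hom G k V (cmod_transport h V) (\<lambda>n. h)"
    "cmod_hom G k (cmod_transport h V) V (\<lambda>n. inv_into (full V n) h)"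
proof -
  interpret M: abelian_group "obj V n" for n by (rule cmodule_abelian[OF V])
  have u: "inv_into (full V n) h (h x) = x" if "x \<in> full V n" for n x
    using inj that by simp
  have sm: "a \<odot>\<^bsub>obj V n\<^esub> x \<in> full V n" if "a \<in> carrier k" "x \<in> full V n" for a n x
    using module.smult_closed[OF cmodule_module[OF V] that] .
  have car: "full (cmod_transport h V) n = h ` full V n" for n by (simp add: cmod_transport_def Let_def)
  show t: "cmodule G k (cmod_transport h V)" "cmod_hom G k V (cmod_transport h V) (\<lambda>n. h)"
    by (rule cmodule_image[OF V car]; simp add: cmod_transport_def Let_def u)+
  show "cmod_hom G k (cmod_transport h V) V (\<lambda>n. inv_into (full V n) h)"
    unfolding cmod_hom_def
  proof (intro conjI allI ballI)
    show "inv_into (full V n) h \<in> mod_hom k (obj (cmod_transport h V) n) (obj V n)" for n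
      by (rule mod_homI) (auto simp: cmod_transport_def Let_def u sm)
    show "inv_into (full V n) h (act (cmod_transport h V) m n \<phi> v) = act V m n \<phi> (inv_into (full V m) h v)"
      if "\<phi> \<in> mor G m n" "v \<in> full (cmod_transport h V) m" for m n \<phi> v
      using that act_closed[OF V that(1)] by (auto simp: cmod_transport_def Let_def u)
  qed
qed

section \<open>The standard cover and the derivatives of free modules\<close>

lemma comb_inj: "inj_on (comb k) (carrier (mod_free k X))"
proof (rule inj_onI)
  fix c d assume cd: "c \<in> carrier (mod_free k X)" "d \<in> carrier (mod_free k X)" "comb k c = comb k d"
  have "(\<lambda>x. (x, c x)) ` {x. c x \<noteq> \<zero>\<^bsub>k\<^esub>} = (\<lambda>x. (x, d x)) ` {x. d x \<noteq> \<zero>\<^bsub>k\<^esub>}"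
    using cd by (auto simp: comb_def Abs_fset_inject mod_free_iff)
  then have *: "(x, y) \<in> (\<lambda>x. (x, c x)) ` {x. c x \<noteq> \<zero>\<^bsub>k\<^esub>} \<longleftrightarrow> (x, y) \<in> (\<lambda>x. (x, d x)) ` {x. d x \<noteq> \<zero>\<^bsub>k\<^esub>}" for x y
    by simp
  have "c x = d x" for x
    using *[of x "c x"] *[of x "d x"] by (auto simp: image_iff)
  then show "c = d" by blast
qed

text \<open>A preimage of \<open>w\<close> is the generator given by \<open>w\<close> and the
  identity. The last three facts present the cover as a retract of a free module, in a form suited
  to \<open>torsionfree_transfer\<close>.\<close>

lemma cover_facts:
  fixes W :: "('k, 'g, ('k, 'g, 'a) formal) cmod"
  assumes W: "cmodule G k W"
  defines "F \<equiv> cmod_free G k (\<lambda>m. full W m)"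
  shows "cmodule G k (cover G k W)" "cmod_hom G k (cover G k W) W (cover_map G k W)"
    "\<And>n w. w \<in> full W n \<Longrightarrow> \<exists>u\<in>full (cover G k W) n. cover_map G k W n u = w"
    "cmod_hom G k F (cover G k W) (\<lambda>n. comb k)"
    "cmod_hom G k (cover G k W) F (\<lambda>n. inv_into (full F n) (comb k))"
    "\<And>n u. u \<in> full (cover G k W) n \<Longrightarrow> comb k (inv_into (full F n) (comb k) u) = u"
proof -
  have F: "cmodule G k F" unfolding F_def by (rule cmod_free_cmodule)
  have inj: "inj_on (comb k) (full F n)" for n unfolding F_def cmod_free_obj by (rule comb_inj)
  note t = cmod_transport_cmodule[where h = "comb k", OF F inj]
  have cov: "cover G k W = cmod_transport (comb k) F" by (simp add: cover_def F_def)
  show "cmodule G k (cover G k W)" "cmod_hom G k F (cover G k W) (\<lambda>n. comb k)"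
    and inv: "cmod_hom G k (cover G k W) F (\<lambda>n. inv_into (full F n) (comb k))"
    unfolding cov by (rule t)+
  have car: "full (cover G k W) n = comb k ` full F n" for n by (simp add: cov cmod_transport_def Let_def)
  show "comb k (inv_into (full F n) (comb k) u) = u" if "u \<in> full (cover G k W) n" for n u
    using that unfolding car by (rule f_inv_into_f)
  have ev: "cmod_hom G k F W (\<lambda>n. free_eval k (obj W n) (\<lambda>(m, \<phi>, x). act W m n \<phi> x))"
    unfolding F_def by (rule cmod_hom_free_eval[OF W, where f = "\<lambda>m x. x"])
  have cm: "cover_map G k W = (\<lambda>n u. free_eval k (obj W n) (\<lambda>(m, \<phi>, x). act W m n \<phi> x) (inv_into (full F n) (comb k) u))"
    by (simp add: cover_map_def F_def fun_eq_iff)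
  show "cmod_hom G k (cover G k W) W (cover_map G k W)"
    unfolding cm by (rule cmod_hom_comp[OF inv ev])
  fix n w assume w: "w \<in> full W n"
  have g: "free_gen k (n, mor_id G n, w) \<in> full F n"
    unfolding F_def cmod_free_obj by (rule free_gen_closed) (use w mor_id_closed in auto)
  have "inv_into (full F n) (comb k) (comb k (free_gen k (n, mor_id G n, w))) = free_gen k (n, mor_id G n, w)"
    using g inj by simp
  then have "cover_map G k W n (comb k (free_gen k (n, mor_id G n, w))) = w"
    unfolding cm using free_eval_gen[OF cmodule_module[OF W], of "\<lambda>(m, \<phi>, x). act W m n \<phi> x"] cmodule_id[OF W w] w by simp
  then show "\<exists>u\<in>full (cover G k W) n. cover_map G k W n u = w"
    unfolding car using g by blast
qed

text \<open>A composite misses every point missed by its outer factor, which bounds the deficient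
  part from above; conversely a generator \<open>(j, \<phi>, x)\<close> is the image under
  \<open>\<phi>\<close> of the generator at the identity of \<open>[j]\<close>.\<close>

lemma deficient_cmod_free:
  "deficient G k (cmod_free G k X) Z m = carrier (mod_free k {b \<in> free_basis X m. \<not> Z \<subseteq> mor_image (fst b) (fst (snd b))})"
  (is "?D = carrier (mod_free k ?Y)")
proof
  let ?F = "cmod_free G k X"
  have F: "cmodule G k ?F" by (rule cmod_free_cmodule)
  have YX: "carrier (mod_free k ?Y) \<subseteq> full ?F m" unfolding cmod_free_obj by (auto simp: mod_free_iff)
  have incl: "(\<lambda>c. c) \<in> mod_hom k (mod_free k ?Y) (obj ?F m)"
    using YX by (auto simp: mod_hom_def cmod_free_obj)
  have "carrier (mod_free k ?Y) \<subseteq> {c \<in> carrier (mod_free k ?Y). c \<in> ?D}"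
  proof (rule mod_free_subset_submodule[OF submodule_preimage[OF mod_free_module cmodule_module[OF F] incl deficient_submodule[OF F]]])
    fix b assume b: "b \<in> ?Y"
    obtain j \<phi> x where bb: "b = (j, \<phi>, x)" by (cases b) auto
    then have *: "b = (j, \<phi>, x)" "\<phi> \<in> mor G j m" "x \<in> X j" "\<not> Z \<subseteq> mor_image j \<phi>" using b by simp_all
    have b': "(j, mor_id G j, x) \<in> free_basis X j" using * mor_id_closed by auto
    have "act ?F j m \<phi> (free_gen k (j, mor_id G j, x)) = free_gen k b"
      unfolding cmod_free_act using free_map_gen[OF free_basis_inj[OF *(2)] b'] * by (simp add: mor_comp_id_right)
    moreover have "act ?F j m \<phi> (free_gen k (j, mor_id G j, x)) \<in> ?D"
      by (rule act_in_deficient[OF *(2,4)]) (simp only: cmod_free_obj free_gen_closed[OF b'])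
    ultimately show "free_gen k b \<in> {c \<in> carrier (mod_free k ?Y). c \<in> ?D}" using free_gen_closed[OF b] by simp
  qed
  then show "carrier (mod_free k ?Y) \<subseteq> ?D" by blast
  interpret FM: Module.module k "obj ?F m" by (rule cmodule_module[OF F])
  show "?D \<subseteq> carrier (mod_free k ?Y)"
  proof (rule deficient_least)
    interpret Y: Module.module k "mod_free k ?Y" by (rule mod_free_module)
    show "submodule (carrier (mod_free k ?Y)) k (obj ?F m)"
    proof (rule submoduleI'[OF cmodule_module[OF F] YX])
      show "\<zero>\<^bsub>obj ?F m\<^esub> \<in> carrier (mod_free k ?Y)" using Y.zero_closed by (simp add: cmod_free_obj)
      show "x \<oplus>\<^bsub>obj ?F m\<^esub> y \<in> carrier (mod_free k ?Y)" if "x \<in> carrier (mod_free k ?Y)" "y \<in> carrier (mod_free k ?Y)" for x y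
        using Y.add.m_closed[OF that] by (simp add: cmod_free_obj)
      show "a \<odot>\<^bsub>obj ?F m\<^esub> x \<in> carrier (mod_free k ?Y)" if "a \<in> carrier k" "x \<in> carrier (mod_free k ?Y)" for a x
        using Y.smult_closed[OF that] by (simp add: cmod_free_obj)
    qed
    fix j \<beta> y assume \<beta>: "\<beta> \<in> mor G j m" and miss: "\<not> Z \<subseteq> mor_image j \<beta>" and y: "y \<in> full ?F j"
    let ?g = "\<lambda>(l, \<phi>, x). (l, mor_comp G l \<beta> \<phi>, x)"
    have "?g ` free_basis X j \<subseteq> ?Y"
    proof
      fix b assume "b \<in> ?g ` free_basis X j"
      then obtain l \<phi> x where b: "b = (l, mor_comp G l \<beta> \<phi>, x)" "\<phi> \<in> mor G l j" "x \<in> X l" by auto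
      have "mor_image l (mor_comp G l \<beta> \<phi>) \<subseteq> mor_image j \<beta>"
      proof (rule image_subsetI)
        fix i assume i: "i \<in> {1..l}"
        show "fst (mor_comp G l \<beta> \<phi>) i \<in> mor_image j \<beta>"
          unfolding mor_comp_fst[OF i] by (rule imageI[OF mor_fst[OF b(2) i]])
      qed
      then have "\<not> Z \<subseteq> mor_image l (mor_comp G l \<beta> \<phi>)" using miss by (meson order_trans)
      then show "b \<in> ?Y" using b mor_comp_closed[OF \<beta> b(2)] by simp
    qed
    from mod_hom_closed[OF free_map_hom[OF free_basis_inj[OF \<beta>] this]] y
    show "act ?F j m \<beta> y \<in> carrier (mod_free k ?Y)" by (simp only: cmod_free_obj cmod_free_act)
  qed
qed

text \<open>Face \<open>a\<close> fixes the points \<open>1, ..., a\<close>: if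
  \<open>\<phi>\<close> meets all of them, so does its composite with the face. Coefficients are
  carried over unchanged, hence a combination with deficient image has only deficient generators in
  its support.\<close>

lemma torsionfree_cmod_free: "torsionfree (cmod_free G k X) a n"
proof -
  let ?F = "cmod_free G k X"
  have F: "cmodule G k ?F" by (rule cmod_free_cmodule)
  let ?f = "face G (n + a) a"
  show ?thesis
    unfolding torsionfree_def face_sum_eq_deficient[OF F]
  proof (intro ballI impI)
    fix v assume v: "v \<in> full ?F (n + a)"
      and d: "act ?F (n + a) (Suc (n + a)) ?f v \<in> deficient G k ?F {1..a} (Suc n + a)"
    have v': "v \<in> carrier (mod_free k (free_basis X (n + a)))" using v by (simp only: cmod_free_obj)
    have "\<not> {1..a} \<subseteq> mor_image (fst b) (fst (snd b))" if vb: "v b \<noteq> \<zero>\<^bsub>k\<^esub>" for b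
    proof -
      have b: "b \<in> free_basis X (n + a)" using v' vb by (auto simp: mod_free_iff)
      then obtain j \<phi> x where *: "b = (j, \<phi>, x)" "\<phi> \<in> mor G j (n + a)" by auto
      have "act ?F (n + a) (Suc (n + a)) ?f v (j, mor_comp G j ?f \<phi>, x) = v b"
        unfolding cmod_free_act using free_map_image[OF free_basis_inj[OF face_closed] v' b] * by simp
      then have nsub: "\<not> {1..a} \<subseteq> mor_image j (mor_comp G j ?f \<phi>)"
      proof -
        assume e: "act ?F (n + a) (Suc (n + a)) ?f v (j, mor_comp G j ?f \<phi>, x) = v b"
        have "(j, mor_comp G j ?f \<phi>, x) \<in> {b \<in> free_basis X (Suc n + a). \<not> {1..a} \<subseteq> mor_image (fst b) (fst (snd b))}"
          using d[unfolded deficient_cmod_free mod_free_iff, THEN conjunct2, THEN conjunct2]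
          by (rule subsetD) (use e vb in simp)
        then show ?thesis by simp
      qed
      show ?thesis
      proof
        assume sub: "{1..a} \<subseteq> mor_image (fst b) (fst (snd b))"
        have "{1..a} \<subseteq> mor_image j (mor_comp G j ?f \<phi>)"
        proof
          fix z assume z: "z \<in> {1..a}"
          then obtain i where i: "i \<in> {1..j}" "fst \<phi> i = z" using sub * by auto
          have "fst (mor_comp G j ?f \<phi>) i = z"
            unfolding mor_comp_fst[OF i(1)] i(2) using z by (simp add: face_def)
          then show "z \<in> mor_image j (mor_comp G j ?f \<phi>)" using i(1) by (metis imageI)
        qed
        with nsub show False by simp
      qed
    qed
    then show "v \<in> deficient G k ?F {1..a} (n + a)"
      using v' unfolding deficient_cmod_free mod_free_iff by auto
  qed
qed

text \<open>A retract argument: the torsion relation is carried to \<open>V\<close> by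
  \<open>\<theta>\<close>, resolved there, and the result is brought back by
  \<open>\<eta>\<close>.\<close>

lemma torsionfree_transfer:
  assumes V: "cmodule G k V" and U: "cmodule G k U" and \<eta>: "cmod_hom G k V U \<eta>" and \<theta>: "cmod_hom G k U V \<theta>"
    and inv: "\<And>v. v \<in> full U (n + a) \<Longrightarrow> \<eta> (n + a) (\<theta> (n + a) v) = v" and tf: "torsionfree V a n"
  shows "torsionfree U a n"
  unfolding torsionfree_def
proof (intro ballI impI)
  fix v assume v: "v \<in> full U (n + a)"
    and d: "act U (n + a) (Suc (n + a)) (face G (n + a) a) v \<in> face_sum G U (full U) a (Suc n)"
  have fV: "\<eta> m ` full V m \<subseteq> full U m" "\<theta> m ` full U m \<subseteq> full V m" for m
    using mod_hom_closed[OF cmod_hom_mod_hom[OF \<eta>]] mod_hom_closed[OF cmod_hom_mod_hom[OF \<theta>]] by blast+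
  have "\<theta> (Suc n + a) (act U (n + a) (Suc (n + a)) (face G (n + a) a) v) \<in> face_sum G V (full V) a (Suc n)"
    by (rule face_sum_hom[OF U csubmodule_carrier[OF U] \<theta> V fV(2) d])
  then have "act V (n + a) (Suc (n + a)) (face G (n + a) a) (\<theta> (n + a) v) \<in> face_sum G V (full V) a (Suc n)"
    by (simp add: cmod_hom_act[OF \<theta> face_closed v])
  then have "\<theta> (n + a) v \<in> face_sum G V (full V) a n"
    using tf fV(2) v unfolding torsionfree_def by blast
  from face_sum_hom[OF V csubmodule_carrier[OF V] \<eta> U fV(1) this]
  show "v \<in> face_sum G U (full U) a n" using inv[OF v] by simp
qed

end

section \<open>Modules presented in finite degrees\<close>

lemma top_degree_bounded:
  assumes "top_degree V < \<infinity>"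
  obtains R where "\<And>n. n \<ge> R \<Longrightarrow> carrier (obj V n) = {\<zero>\<^bsub>obj V n\<^esub>}"
proof -
  obtain R :: nat where R: "top_degree V < ereal (real R)"
    using assms less_PInf_Ex_of_nat[of "top_degree V"] by auto
  have "carrier (obj V n) = {\<zero>\<^bsub>obj V n\<^esub>}" if n: "n \<ge> R" for n
  proof (rule ccontr)
    assume "carrier (obj V n) \<noteq> {\<zero>\<^bsub>obj V n\<^esub>}"
    then have "ereal (real n) \<le> top_degree V"
      unfolding top_degree_def by (intro Sup_upper) auto
    from le_less_trans[OF this R] have "ereal (real n) < ereal (real R)" .
    with n show False by simp
  qed
  then show ?thesis using that by blast
qed

context FIG
begin

lemma generated_if_gen_deg:
  assumes V: "cmodule G k V" and "gen_deg G k V < \<infinity>"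
  obtains D where "\<And>n. n \<ge> D \<Longrightarrow> full V n \<subseteq> face_sum G V (full V) n 0"
proof -
  obtain D where D: "\<And>n. n \<ge> D \<Longrightarrow> full (H0 G k V) n = {\<zero>\<^bsub>obj (H0 G k V) n\<^esub>}"
    using top_degree_bounded assms(2) unfolding gen_deg_def by blast
  have "full V n \<subseteq> decomposables G k V n" if "n \<ge> D" for n
  proof
    fix v assume v: "v \<in> full V n"
    have N: "submodule (decomposables G k V n) k (obj V n)"
      unfolding decomposables_eq_deficient[OF V] by (rule deficient_submodule[OF V])
    have "decomposables G k V n +>\<^bsub>obj V n\<^esub> v = decomposables G k V n"
      using D[OF that] v by (auto simp: H0_def a_rcosets_image)
    then show "v \<in> decomposables G k V n"
      using abelian_group_cosets(1)[OF cmodule_module[OF V] N v] by simp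
  qed
  then show ?thesis using that unfolding decomposables_eq_face_sum[OF V] by blast
qed

lemma face_sum_0_submodule:
  "cmodule G k V \<Longrightarrow> submodule (face_sum G V (full V) n 0) k (obj V n)"
  using face_sum_submodule[OF _ csubmodule_carrier, of V n 0] by simp

text \<open>\<open>H\<^sub>1(V)\<^sub>n = 0\<close> is applied to the class of a basis element of \<open>P\<^sub>1\<close> that maps to \<open>u\<close>.\<close>

theorem relations_if_hom_deg:
  fixes V :: "('k, 'g, 'a) cmod"
  assumes V: "cmodule G k V" and "hom_deg G k 1 V < \<infinity>"
  defines "W \<equiv> syzygy G k V 0" and "P \<equiv> resol G k V 0"
  defines "K \<equiv> \<lambda>n. {u \<in> full P n. cover_map G k W n u = \<zero>\<^bsub>obj W n\<^esub>}"
  shows "\<exists>R. \<forall>n\<ge>R. \<forall>u\<in>K n. u \<in> face_sum G P (full P) n 0 \<longrightarrow> u \<in> face_sum G P K n 0"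
proof -
  have W: "cmodule G k W"
    unfolding W_def syzygy.simps by (rule cmod_transport_cmodule(1)[OF V]) (simp add: inj_on_def)
  have P_eq: "P = cover G k W" by (simp add: P_def W_def resol_def)
  have P: "cmodule G k P" unfolding P_eq by (rule cover_facts(1)[OF W])
  have K: "csubmodule G k P K"
    unfolding K_def P_eq by (rule cmod_hom_kernel[OF cover_facts(1)[OF W] W cover_facts(2)[OF W]])
  define S1 where "S1 = syzygy G k V (Suc 0)"
  have S1_eq: "S1 = cmod_restrict P K" by (simp add: S1_def K_def P_eq W_def)
  have S1: "cmodule G k S1" unfolding S1_eq by (rule cmod_restrict_cmodule[OF P K])
  define P1 where "P1 = resol G k V (Suc 0)"
  have P1_eq: "P1 = cover G k S1" by (simp add: P1_def S1_def resol_def del: syzygy.simps)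
  have P1: "cmodule G k P1" unfolding P1_eq by (rule cover_facts(1)[OF S1])
  define d0 where "d0 = resol_diff G k V 0"
  have d0_eq: "d0 = cover_map G k S1" by (simp add: d0_def S1_def resol_diff_def del: syzygy.simps)
  have d0_S1: "cmod_hom G k P1 (cmod_restrict P K) d0"
    unfolding d0_eq P1_eq S1_eq[symmetric] by (rule cover_facts(2)[OF S1])
  note d0 = cmod_hom_restrict_target[OF K d0_S1]
  define L where "L n = {e \<in> full P1 n. d0 n e = \<zero>\<^bsub>obj P n\<^esub>}" for n
  have L: "csubmodule G k P1 L"
    unfolding L_def by (rule cmod_hom_kernel[OF P1 P d0(1)])
  define S2 where "S2 = syzygy G k V (Suc (Suc 0))"
  have S2_eq: "S2 = cmod_restrict P1 L"
    unfolding S2_def syzygy.simps(2)[of G k V "Suc 0"] S1_def[symmetric] P1_eq[symmetric] d0_eq[symmetric] L_def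
    by (simp add: S1_eq)
  have S2: "cmodule G k S2" unfolding S2_eq by (rule cmod_restrict_cmodule[OF P1 L])
  define P2 where "P2 = resol G k V (Suc (Suc 0))"
  have P2_eq: "P2 = cover G k S2" by (simp add: P2_def S2_def resol_def del: syzygy.simps)
  have P2: "cmodule G k P2" unfolding P2_eq by (rule cover_facts(1)[OF S2])
  define d1 where "d1 = resol_diff G k V (Suc 0)"
  have d1_eq: "d1 = cover_map G k S2" by (simp add: d1_def S2_def resol_diff_def del: syzygy.simps)
  have d1_S2: "cmod_hom G k P2 (cmod_restrict P1 L) d1"
    unfolding d1_eq P2_eq S2_eq[symmetric] by (rule cover_facts(2)[OF S2])
  note d1 = cmod_hom_restrict_target[OF L d1_S2]
  obtain R where R: "\<And>n. n \<ge> R \<Longrightarrow> full (H G k (Suc 0) V) n = {\<zero>\<^bsub>obj (H G k (Suc 0) V) n\<^esub>}"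
    using top_degree_bounded assms(2) unfolding hom_deg_def One_nat_def by blast
  have "u \<in> face_sum G P K n 0"
    if n: "n \<ge> R" and uK: "u \<in> K n" and u: "u \<in> face_sum G P (full P) n 0" for n u
  proof -
    let ?D0 = "decomposables G k P n" and ?D1 = "decomposables G k P1 n" and ?D2 = "decomposables G k P2 n"
    have eq: "?D0 = face_sum G P (full P) n 0" "?D1 = face_sum G P1 (full P1) n 0" "?D2 = face_sum G P2 (full P2) n 0"
      by (rule decomposables_eq_face_sum[OF P] decomposables_eq_face_sum[OF P1] decomposables_eq_face_sum[OF P2])+
    have D0: "submodule ?D0 k (obj P n)" and D1: "submodule ?D1 k (obj P1 n)" and D2: "submodule ?D2 k (obj P2 n)"
      unfolding eq by (rule face_sum_0_submodule[OF P] face_sum_0_submodule[OF P1] face_sum_0_submodule[OF P2])+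
    note MP = cmodule_module[OF P, of n] and M1 = cmodule_module[OF P1, of n] and M2 = cmodule_module[OF P2, of n]
    interpret M1: Module.module k "obj P1 n" by (rule M1)
    interpret MP: Module.module k "obj P n" by (rule MP)
    \<comment> \<open>The differential takes values in \<open>K\<close>, so decomposables of
      \<open>P1\<close> go to decomposables of \<open>K\<close>, not merely of \<open>P\<close>. The
      conclusion comes from this.\<close>
    have d0D: "d0 n x \<in> face_sum G P K n 0" if "x \<in> ?D1" for x
      using face_sum_hom[OF P1 csubmodule_carrier[OF P1] d0(1) P d0(2) that[unfolded eq]] by simp
    have KP: "face_sum G P K n 0 \<subseteq> ?D0"
    proof
      fix x assume x: "x \<in> face_sum G P K n 0"
      have id: "cmod_hom G k P P (\<lambda>n x. x)" by (simp add: cmod_hom_def mod_hom_def)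
      have "(\<lambda>x. x) ` K n \<subseteq> full P n" for n using csubmodule_subset[OF K] by blast
      from face_sum_hom[OF P K id P this x] show "x \<in> ?D0" by (simp add: eq)
    qed
    have d0D0: "d0 n ` ?D1 \<subseteq> ?D0" using d0D KP by blast
    have d1D1: "d1 n ` ?D2 \<subseteq> ?D1"
    proof (rule image_subsetI)
      fix x assume x: "x \<in> ?D2"
      have "d1 m ` full P2 m \<subseteq> full P1 m" for m using mod_hom_closed[OF cmod_hom_mod_hom[OF d1(1)]] by blast
      from face_sum_hom[OF P2 csubmodule_carrier[OF P2] d1(1) P1 this x[unfolded eq]]
      show "d1 n x \<in> ?D1" by (simp add: eq)
    qed
    obtain e where e: "e \<in> full P1 n" "d0 n e = u"
      using cover_facts(3)[OF S1, of u n] uK by (auto simp: P1_eq d0_eq S1_eq)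
    define z where "z = ?D1 +>\<^bsub>obj P1 n\<^esub> e"
    have z_in: "z \<in> full (H0 G k P1) n" using e by (auto simp: z_def H0_def a_rcosets_image)
    have "H0_map G k P d0 n z = ?D0 +>\<^bsub>obj P n\<^esub> d0 n e"
      unfolding H0_map_def z_def
      by (rule coset_map_coset[OF M1 D1 MP D0 cmod_hom_mod_hom[OF d0(1)] d0D0 e(1)])
    also have "\<dots> = ?D0" by (rule abelian_group_cosets(3)[OF MP D0]) (use e u eq in simp)
    finally have z_cyc: "z \<in> H_cycles G k V (Suc 0) n"
      using z_in by (simp add: P_def P1_def d0_def H0_def)
    define B where "B = H_boundaries G k V (Suc 0) n"
    have B_eq: "B = H0_map G k P1 d1 n ` full (H0 G k P2) n"
      by (simp add: B_def H_boundaries_def P1_def P2_def d1_def)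
    let ?R = "(obj (H0 G k P1) n)\<lparr>carrier := H_cycles G k V (Suc 0) n\<rparr>"
    have "full (H G k (Suc 0) V) n = a_rcosets\<^bsub>?R\<^esub> B" "\<zero>\<^bsub>obj (H G k (Suc 0) V) n\<^esub> = B"
      by (simp_all add: H_def P1_def B_def del: H_cycles.simps)
    then have "B +>\<^bsub>?R\<^esub> z = B"
      using R[OF n] z_cyc by (auto simp: a_rcosets_image)
    then have Bz: "h \<oplus>\<^bsub>obj (H0 G k P1) n\<^esub> z \<in> B" if "h \<in> B" for h
      using that by (auto simp: a_r_coset_def')
    have cls: "H0_map G k P1 d1 n (?D2 +>\<^bsub>obj P2 n\<^esub> x) = ?D1 +>\<^bsub>obj P1 n\<^esub> d1 n x" if "x \<in> full P2 n" for x
      unfolding H0_map_def by (rule coset_map_coset[OF M2 D2 M1 D1 cmod_hom_mod_hom[OF d1(1)] d1D1 that])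
    have fullH0: "full (H0 G k P2) n = (\<lambda>x. ?D2 +>\<^bsub>obj P2 n\<^esub> x) ` full P2 n"
      by (simp add: H0_def a_rcosets_image)
    \<comment> \<open>That the class of \<open>z\<close> is trivial is known as an equality of a
      coset with \<open>B\<close>; adding an arbitrary element of \<open>B\<close>, here the class
      of \<open>d1 n x\<close>, turns it into a membership.\<close>
    obtain x where x: "x \<in> full P2 n" using submodule_zero[OF submodule_carrier[OF M2]] by blast
    have "?D1 +>\<^bsub>obj P1 n\<^esub> d1 n x \<in> B" unfolding B_eq fullH0 using cls[OF x] x by force
    from Bz[OF this] obtain x' where x': "x' \<in> full P2 n"
      and eqz: "(?D1 +>\<^bsub>obj P1 n\<^esub> d1 n x) \<oplus>\<^bsub>obj (H0 G k P1) n\<^esub> z = ?D1 +>\<^bsub>obj P1 n\<^esub> d1 n x'"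
      unfolding B_eq fullH0 using cls by auto
    have dx: "d1 n x \<in> full P1 n" "d1 n x' \<in> full P1 n" "d0 n (d1 n x) = \<zero>\<^bsub>obj P n\<^esub>" "d0 n (d1 n x') = \<zero>\<^bsub>obj P n\<^esub>"
      using d1(2)[of n] x x' by (auto simp: L_def)
    have "?D1 +>\<^bsub>obj P1 n\<^esub> (d1 n x \<oplus>\<^bsub>obj P1 n\<^esub> e) = ?D1 +>\<^bsub>obj P1 n\<^esub> d1 n x'"
      using eqz mod_quot_image(1)[OF M1 D1 dx(1) e(1)] by (simp add: z_def H0_def)
    then have "(d1 n x \<oplus>\<^bsub>obj P1 n\<^esub> e) \<ominus>\<^bsub>obj P1 n\<^esub> d1 n x' \<in> ?D1"
      using abelian_group_cosets(4)[OF M1 D1] dx e by simp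
    \<comment> \<open>\<open>d0\<close> kills both terms coming from \<open>d1\<close>, and what
      remains is \<open>u\<close>.\<close>
    from d0D[OF this] show ?thesis
      using dx e mod_hom_closed[OF cmod_hom_mod_hom[OF d0(1)] e(1)]
      by (simp add: mod_hom_minus[OF M1 MP cmod_hom_mod_hom[OF d0(1)]] mod_hom_add[OF cmod_hom_mod_hom[OF d0(1)]] MP.minus_eq
        MP.minus_equality[OF MP.l_zero[OF MP.zero_closed] MP.zero_closed MP.zero_closed])
  qed
  then show ?thesis by blast
qed

text \<open>The standard resolution lives in the type \<open>formal\<close>, so the argument runs
  for the copy \<open>W\<close> of \<open>V\<close> in that type, and the bounds are carried back
  along the isomorphism \<open>Elem\<close>.\<close>

theorem torsionfree_if_presented:
  assumes V: "cmodule G k V" and pres: "presented_in_finite_degrees G k V"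
  shows "\<exists>N D. (\<forall>a n. n \<ge> N \<longrightarrow> torsionfree V a n) \<and> (\<forall>a n. a \<ge> D \<longrightarrow> full V (n + a) \<subseteq> face_sum G V (full V) a n)"
proof -
  define W where "W = syzygy G k V 0"
  define P where "P = resol G k V 0"
  define K where "K n = {u \<in> full P n. cover_map G k W n u = \<zero>\<^bsub>obj W n\<^esub>}" for n
  have inj: "inj_on Elem (full V n)" for n by (simp add: inj_on_def)
  have WV: "cmodule G k W" "cmod_hom G k V W (\<lambda>n. Elem)" "cmod_hom G k W V (\<lambda>n. inv_into (full V n) Elem)"
    unfolding W_def syzygy.simps by (rule cmod_transport_cmodule[OF V inj])+
  note W = WV(1)
  have P_eq: "P = cover G k W" by (simp add: P_def W_def resol_def)
  have P: "cmodule G k P" unfolding P_eq by (rule cover_facts(1)[OF W])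
  have K: "csubmodule G k P K"
    unfolding K_def P_eq by (rule cmod_hom_kernel[OF cover_facts(1)[OF W] W cover_facts(2)[OF W]])
  obtain D where D: "\<And>n. n \<ge> D \<Longrightarrow> full V n \<subseteq> face_sum G V (full V) n 0"
    using generated_if_gen_deg[OF V] pres unfolding presented_in_finite_degrees_def by blast
  obtain R where R: "\<And>n u. n \<ge> R \<Longrightarrow> u \<in> K n \<Longrightarrow> u \<in> face_sum G P (full P) n 0 \<Longrightarrow> u \<in> face_sum G P K n 0"
    using relations_if_hom_deg[OF V] pres unfolding presented_in_finite_degrees_def W_def P_def K_def by blast
  have tfP: "torsionfree P a n" for a n
    unfolding P_eq
    by (rule torsionfree_transfer[OF cmod_free_cmodule cover_facts(1)[OF W] cover_facts(4)[OF W] cover_facts(5)[OF W]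
      cover_facts(6)[OF W] torsionfree_cmod_free])
  have ac: "frag_acyclic W 0 1 n" if "n \<ge> R" for n
    by (rule acyclic_quotient[OF P W _ _ tfP K])
      (use cover_facts(2,3)[OF W] R[OF that] in \<open>simp_all add: P_eq K_def\<close>)
  have fW: "full W n = Elem ` full V n" for n by (simp add: W_def cmod_transport_def Let_def)
  have D': "full W n \<subseteq> face_sum G W (full W) n 0" if "n \<ge> D" for n
  proof
    fix w assume "w \<in> full W n"
    then obtain v where v: "v \<in> full V n" "w = Elem v" unfolding fW by blast
    have "v \<in> face_sum G V (full V) n 0" using D[OF that] v by blast
    from face_sum_hom[OF V csubmodule_carrier[OF V] WV(2) W _ this] show "w \<in> face_sum G W (full W) n 0"
      by (simp add: fW v)
  qed
  have WVf: "inv_into (full V n) Elem ` full W n \<subseteq> full V n" for n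
    using mod_hom_closed[OF cmod_hom_mod_hom[OF WV(3)]] by blast
  have inv: "inv_into (full V n) Elem (Elem v) = v" if "v \<in> full V n" for n v
    using inv_into_f_f[OF inj that] .
  obtain N where N: "\<And>a n. n \<ge> N \<Longrightarrow> torsionfree W a n"
    using torsionfree_bounded_if_acyclic(1)[OF W D' ac] by blast
  have "torsionfree V a n" if "n \<ge> N" for a n
    by (rule torsionfree_transfer[OF W V WV(3) WV(2) _ N[OF that]]) (rule inv)
  moreover have "full V (n + a) \<subseteq> face_sum G V (full V) a n" if "a \<ge> D" for a n
  proof
    fix v assume v: "v \<in> full V (n + a)"
    then have "Elem v \<in> full W (n + a)" by (simp add: fW)
    with torsionfree_bounded_if_acyclic(2)[OF W D' ac that] have "Elem v \<in> face_sum G W (full W) a n"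
      by (rule subsetD)
    from face_sum_hom[OF W csubmodule_carrier[OF W] WV(3) V WVf this] show "v \<in> face_sum G V (full V) a n"
      by (simp add: inv[OF v])
  qed
  ultimately show ?thesis by blast
qed

end

section \<open>The shift functor\<close>

text \<open>The \<open>r\<close>-fold iterate of face \<open>a\<close>: a block of \<open>r\<close>
  missed points directly behind the first \<open>a\<close> points.\<close>

definition gap :: "('g, 'x) monoid_scheme \<Rightarrow> nat \<Rightarrow> nat \<Rightarrow> nat \<Rightarrow> 'g mor" where
  "gap G p a r = (\<lambda>j\<in>{1..p}. if j \<le> a then j else j + r, \<lambda>j\<in>{1..p}. \<one>\<^bsub>G\<^esub>)"

context FIG
begin

lemma gap_closed: "gap G p a r \<in> mor G p (p + r)"
  unfolding gap_def using group.is_monoid[OF grp]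
  by (intro restrict_morI inj_onI) (auto simp: monoid.one_closed split: if_split_asm)

lemma gap_0: "gap G p a 0 = mor_id G p"
  unfolding gap_def mor_id_def by (intro arg_cong2[where f = Pair] restrict_ext) auto

lemma gap_Suc: "gap G p a (Suc r) = mor_comp G p (face G (p + r) a) (gap G p a r)"
  unfolding gap_def mor_comp_def face_def using group.is_monoid[OF grp]
  by (intro arg_cong2[where f = Pair] restrict_ext) (auto simp: monoid.l_one)

lemma gap_image: "a \<le> p \<Longrightarrow> fst (gap G p a r) ` {1..a} = {1..a}"
  by (force simp: gap_def image_iff)

lemma mor_with_image:
  assumes "S \<subseteq> {1..m}"
  shows "\<exists>\<phi>\<in>mor G (card S) m. mor_image (card S) \<phi> = S"
proof -
  have "finite S" using assms finite_subset by blast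
  then obtain h where h: "bij_betw h {1..card S} S" using ex_bij_betw_nat_finite_1 by blast
  have "(\<lambda>i\<in>{1..card S}. h i, \<lambda>i\<in>{1..card S}. \<one>\<^bsub>G\<^esub>) \<in> mor G (card S) m"
  proof (rule restrict_morI)
    show "h i \<in> {1..m}" if "i \<in> {1..card S}" for i using bij_betw_apply[OF h that] assms by blast
  qed (use h group.is_monoid[OF grp] in \<open>simp_all add: bij_betw_def monoid.one_closed\<close>)
  moreover have "mor_image (card S) (\<lambda>i\<in>{1..card S}. h i, \<lambda>i\<in>{1..card S}. \<one>\<^bsub>G\<^esub>) = S"
    unfolding fst_conv image_restrict_eq by (rule bij_betw_imp_surj_on[OF h])
  ultimately show ?thesis by blast
qed

lemma mor_comp_image: "Y \<subseteq> {1..l} \<Longrightarrow> fst (mor_comp G l \<phi> \<psi>) ` Y = fst \<phi> ` fst \<psi> ` Y"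
proof -
  assume "Y \<subseteq> {1..l}"
  then have "fst (mor_comp G l \<phi> \<psi>) i = fst \<phi> (fst \<psi> i)" if "i \<in> Y" for i
    using mor_comp_fst[of i l G \<phi> \<psi>] that by blast
  then show ?thesis unfolding image_image by (rule image_cong[OF refl])
qed

lemma mor_id_image: "Y \<subseteq> {1..m} \<Longrightarrow> fst (mor_id G m) ` Y = Y"
proof -
  assume "Y \<subseteq> {1..m}"
  then have "fst (mor_id G m) i = i" if "i \<in> Y" for i using that by (auto simp: mor_id_def)
  then show ?thesis by simp
qed

text \<open>Reduces an arbitrary set of points to an initial segment, where \<open>deficient\<close>
  can be compared with \<open>face_sum\<close>.\<close>

lemma automorphism_to_initial:
  assumes "Z \<subseteq> {1..m}"
  obtains \<tau> \<tau>' where "\<tau> \<in> mor G m m" "\<tau>' \<in> mor G m m" "mor_comp G m \<tau> \<tau>' = mor_id G m"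
    "fst \<tau>' ` Z = {1..card Z}" "fst \<tau> ` {1..card Z} = Z"
proof -
  let ?a = "card Z"
  have a: "?a \<le> m" using card_mono[OF _ assms] by simp
  obtain \<zeta> where \<zeta>: "\<zeta> \<in> mor G ?a m" "mor_image ?a \<zeta> = Z" using mor_with_image[OF assms] by blast
  have "{1..?a} \<subseteq> {1..m}" using a by auto
  then obtain \<iota> where \<iota>: "\<iota> \<in> mor G ?a m" "mor_image ?a \<iota> = {1..?a}" using mor_with_image[of "{1..?a}" m] by auto
  obtain \<tau>' where \<tau>': "\<tau>' \<in> mor G m m" "mor_comp G ?a \<tau>' \<zeta> = \<iota>" using mor_extend[OF \<zeta>(1) \<iota>(1)] by blast
  obtain \<tau> where \<tau>: "\<tau> \<in> mor G m m" "mor_comp G m \<tau> \<tau>' = mor_id G m" using mor_inverse[OF \<tau>'(1)] by blast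
  have im: "fst \<tau>' ` Z = {1..?a}"
    using mor_comp_image[of "{1..?a}" ?a \<tau>' \<zeta>] \<zeta>(2) \<iota>(2) \<tau>'(2) by simp
  have "fst \<tau> ` fst \<tau>' ` Z = Z"
    using mor_comp_image[OF assms, of \<tau> \<tau>'] mor_id_image[OF assms] \<tau>(2) by simp
  then show ?thesis using that[OF \<tau>(1) \<tau>'(1) \<tau>(2)] im by simp
qed

text \<open>By injectivity, \<open>\<phi>\<close> sends a point of \<open>Y\<close> missed by
  \<open>\<beta>\<close> to a point missed by the composite.\<close>

lemma act_deficient:
  assumes V: "cmodule G k V" and \<phi>: "\<phi> \<in> mor G m m'" and Y: "Y \<subseteq> {1..m}" and v: "v \<in> deficient G k V Y m"
  shows "act V m m' \<phi> v \<in> deficient G k V (fst \<phi> ` Y) m'"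
proof -
  have "deficient G k V Y m \<subseteq> {v \<in> full V m. act V m m' \<phi> v \<in> deficient G k V (fst \<phi> ` Y) m'}"
  proof (rule deficient_least[OF submodule_preimage[OF cmodule_module[OF V] cmodule_module[OF V] cmodule_act[OF V \<phi>]
        deficient_submodule[OF V]]])
    fix j \<beta> y assume \<beta>: "\<beta> \<in> mor G j m" and miss: "\<not> Y \<subseteq> mor_image j \<beta>" and y: "y \<in> full V j"
    have sub: "mor_image j \<beta> \<subseteq> {1..m}" using mor_fst[OF \<beta>] by blast
    obtain z where z: "z \<in> Y" "z \<notin> mor_image j \<beta>" using miss by blast
    have "fst \<phi> z \<notin> fst \<phi> ` mor_image j \<beta>"
    proof
      assume "fst \<phi> z \<in> fst \<phi> ` mor_image j \<beta>"
      then obtain w where w: "w \<in> mor_image j \<beta>" "fst \<phi> z = fst \<phi> w" by blast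
      have "z = w" by (rule inj_onD[OF mor_inj[OF \<phi>] w(2)]) (use Y z sub w in blast)+
      with w z show False by simp
    qed
    then have "\<not> fst \<phi> ` Y \<subseteq> fst \<phi> ` mor_image j \<beta>" using z(1) by blast
    then have "\<not> fst \<phi> ` Y \<subseteq> mor_image j (mor_comp G j \<phi> \<beta>)" unfolding mor_comp_image[OF subset_refl] .
    from act_in_deficient[OF mor_comp_closed[OF \<phi> \<beta>] this y]
    show "act V j m \<beta> y \<in> {v \<in> full V m. act V m m' \<phi> v \<in> deficient G k V (fst \<phi> ` Y) m'}"
      using act_closed[OF V \<beta> y] by (simp add: cmodule_comp[OF V \<beta> \<phi> y])
  qed
  then show ?thesis using v by blast
qed

text \<open>The case \<open>Z = {}\<close> is injectivity of the maps \<open>V\<^sub>m \<rightarrow> V\<^sub>n\<close>; in general, it is the same property of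
  the derivative of \<open>V\<close> along \<open>Z\<close>.\<close>

definition injective_from :: "nat \<Rightarrow> ('k, 'g, 'a) cmod \<Rightarrow> bool" where
  "injective_from N V \<longleftrightarrow> (\<forall>m m'. \<forall>\<theta>\<in>mor G m m'. \<forall>Z\<subseteq>{1..m}. card Z + N \<le> m \<longrightarrow>
     (\<forall>v\<in>full V m. act V m m' \<theta> v \<in> deficient G k V (fst \<theta> ` Z) m' \<longrightarrow> v \<in> deficient G k V Z m))"

text \<open>Vanishing of all derivatives of order at least \<open>D\<close>. By
  \<open>low_full\<close> it implies generation in degrees below \<open>D\<close>, and in this form
  the bound is directly inherited by the shift.\<close>

definition degree_less :: "nat \<Rightarrow> ('k, 'g, 'a) cmod \<Rightarrow> bool" where
  "degree_less D V \<longleftrightarrow> (\<forall>m. \<forall>Z\<subseteq>{1..m}. D \<le> card Z \<longrightarrow> full V m \<subseteq> deficient G k V Z m)"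

lemma torsionfree_gap:
  assumes V: "cmodule G k V" and tf: "\<And>n'. n' \<ge> n \<Longrightarrow> torsionfree V a n'"
    and x: "x \<in> full V (n + a)" and "act V (n + a) (n + a + r) (gap G (n + a) a r) x \<in> deficient G k V {1..a} (n + a + r)"
  shows "x \<in> deficient G k V {1..a} (n + a)"
  using assms(4)
proof (induct r)
  case 0
  then show ?case by (simp add: gap_0 cmodule_id[OF V x])
next
  case (Suc r)
  let ?y = "act V (n + a) (n + a + r) (gap G (n + a) a r) x"
  have ar: "n + a + r = (n + r) + a" by simp
  have y: "?y \<in> full V (n + a + r)" by (rule act_closed[OF V gap_closed x])
  have "act V (n + a) (Suc (n + a + r)) (gap G (n + a) a (Suc r)) x =
      act V (n + a + r) (Suc (n + a + r)) (face G (n + a + r) a) ?y"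
    unfolding gap_Suc by (rule cmodule_comp[OF V gap_closed face_closed x])
  then have "act V (n + a + r) (Suc (n + a + r)) (face G (n + a + r) a) ?y \<in> deficient G k V {1..a} (Suc (n + a + r))"
    using Suc.prems by simp
  with tf[of "n + r"] y have "?y \<in> deficient G k V {1..a} (n + a + r)"
    unfolding torsionfree_def face_sum_eq_deficient[OF V] ar by simp
  then show ?case by (rule Suc.hyps)
qed

text \<open>Automorphisms on both sides turn \<open>\<theta>\<close> into a gap:
  \<open>\<tau>'\<close> moves \<open>Z\<close> to an initial segment and \<open>\<sigma>\<close>
  exists by transitivity. A gap is an iterated face of index \<open>card Z\<close>, so
  torsion-freeness of the derivative of that order applies, in levels from \<open>m - card Z\<close>
  on.\<close>

lemma injective_from_if_torsionfree:
  assumes V: "cmodule G k V" and tf: "\<And>a n. n \<ge> N \<Longrightarrow> torsionfree V a n"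
  shows "injective_from N V"
  unfolding injective_from_def
proof (intro allI ballI impI)
  fix m m' \<theta> Z v
  assume \<theta>: "\<theta> \<in> mor G m m'" and Z: "Z \<subseteq> {1..m}" and N: "card Z + N \<le> m" and v: "v \<in> full V m"
    and d: "act V m m' \<theta> v \<in> deficient G k V (fst \<theta> ` Z) m'"
  define a n r where "a = card Z" and "n = m - card Z" and "r = m' - m"
  have m: "m = n + a" and m': "m' = n + a + r" and n: "n \<ge> N"
    using N mor_le[OF \<theta>] by (auto simp: a_def n_def r_def)
  obtain \<tau> \<tau>' where \<tau>: "\<tau> \<in> mor G m m" "\<tau>' \<in> mor G m m" "mor_comp G m \<tau> \<tau>' = mor_id G m"
    "fst \<tau>' ` Z = {1..a}" "fst \<tau> ` {1..a} = Z"
    using automorphism_to_initial[OF Z] unfolding a_def by blast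
  have g: "gap G m a r \<in> mor G m m'" using gap_closed[of m a r] by (simp add: m m')
  have e: "mor_comp G m (gap G m a r) \<tau>' \<in> mor G m m'" by (rule mor_comp_closed[OF g \<tau>(2)])
  obtain \<sigma> where \<sigma>: "\<sigma> \<in> mor G m' m'" "mor_comp G m \<sigma> \<theta> = mor_comp G m (gap G m a r) \<tau>'"
    using mor_extend[OF \<theta> e] by blast
  let ?x = "act V m m \<tau>' v"
  have x: "?x \<in> full V m" by (rule act_closed[OF V \<tau>(2) v])
  have sub: "fst \<theta> ` Z \<subseteq> {1..m'}" using mor_fst[OF \<theta>] Z by blast
  have "fst \<sigma> ` fst \<theta> ` Z = fst (gap G m a r) ` {1..a}"
    using mor_comp_image[OF Z, of \<sigma> \<theta>] mor_comp_image[OF Z, of "gap G m a r" \<tau>'] \<sigma>(2) \<tau>(4) by simp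
  also have "\<dots> = {1..a}" by (rule gap_image) (simp add: m)
  finally have im: "fst \<sigma> ` fst \<theta> ` Z = {1..a}" .
  have "act V m m' (gap G m a r) ?x = act V m' m' \<sigma> (act V m m' \<theta> v)"
    using cmodule_comp[OF V \<tau>(2) g v] cmodule_comp[OF V \<theta> \<sigma>(1) v] \<sigma>(2) by simp
  with act_deficient[OF V \<sigma>(1) sub d] have "act V m m' (gap G m a r) ?x \<in> deficient G k V {1..a} m'"
    unfolding im by simp
  then have "?x \<in> deficient G k V {1..a} m"
    using torsionfree_gap[where n = n and a = a and r = r and x = ?x, OF V tf[OF order_trans[OF n]]] x
    unfolding m m' by simp
  moreover have "{1..a} \<subseteq> {1..m}" by (auto simp: m)
  ultimately have "act V m m \<tau> ?x \<in> deficient G k V Z m"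
    using act_deficient[OF V \<tau>(1), of "{1..a}"] unfolding \<tau>(5) by blast
  then show "v \<in> deficient G k V Z m"
    using cmodule_comp[OF V \<tau>(2) \<tau>(1) v] cmodule_id[OF V v] \<tau>(3) by simp
qed

lemma degree_less_if_generated:
  assumes V: "cmodule G k V" and gen: "\<And>a n. a \<ge> D \<Longrightarrow> full V (n + a) \<subseteq> face_sum G V (full V) a n"
  shows "degree_less D V"
  unfolding degree_less_def
proof (intro allI impI subsetI)
  fix m Z v assume Z: "Z \<subseteq> {1..m}" and D: "D \<le> card Z" and v: "v \<in> full V m"
  have a: "card Z \<le> m" using card_mono[OF _ Z] by simp
  obtain \<tau> \<tau>' where \<tau>: "\<tau> \<in> mor G m m" "\<tau>' \<in> mor G m m" "mor_comp G m \<tau> \<tau>' = mor_id G m"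
    "fst \<tau>' ` Z = {1..card Z}" "fst \<tau> ` {1..card Z} = Z"
    using automorphism_to_initial[OF Z] by blast
  have "act V m m \<tau>' v \<in> deficient G k V {1..card Z} m"
    using gen[OF D, of "m - card Z"] act_closed[OF V \<tau>(2) v] a unfolding face_sum_eq_deficient[OF V] by auto
  moreover have "{1..card Z} \<subseteq> {1..m}" using a by auto
  ultimately have "act V m m \<tau> (act V m m \<tau>' v) \<in> deficient G k V Z m"
    using act_deficient[OF V \<tau>(1), of "{1..card Z}"] unfolding \<tau>(5) by blast
  then show "v \<in> deficient G k V Z m"
    using cmodule_comp[OF V \<tau>(2) \<tau>(1) v] cmodule_id[OF V v] \<tau>(3) by simp
qed

section \<open>Compatibility of derivatives with the shift\<close>

lemma mor_shift_closed: "\<phi> \<in> mor G m n \<Longrightarrow> mor_shift G m \<phi> \<in> mor G (Suc m) (Suc n)"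
proof -
  assume \<phi>: "\<phi> \<in> mor G m n"
  have f: "i - 1 \<in> {1..m}" if "i \<in> {1..Suc m}" "i \<noteq> 1" for i using that by auto
  show ?thesis
    unfolding mor_shift_def
  proof (rule restrict_morI)
    fix i assume i: "i \<in> {1..Suc m}"
    show "(if i = 1 then 1 else fst \<phi> (i - 1) + 1) \<in> {1..Suc n}" using mor_fst[OF \<phi> f[OF i]] by auto
    show "(if i = 1 then \<one>\<^bsub>G\<^esub> else snd \<phi> (i - 1)) \<in> carrier G"
      using mor_snd[OF \<phi> f[OF i]] group.is_monoid[OF grp] by (auto simp: monoid.one_closed)
  next
    show "inj_on (\<lambda>i. if i = 1 then 1 else fst \<phi> (i - 1) + 1) {1..Suc m}"
    proof (rule inj_onI)
      fix x y assume xy: "x \<in> {1..Suc m}" "y \<in> {1..Suc m}"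
        "(if x = 1 then 1 else fst \<phi> (x - 1) + 1) = (if y = 1 then 1 else fst \<phi> (y - 1) + 1)"
      show "x = y"
        using xy mor_fst[OF \<phi> f[OF xy(1)]] mor_fst[OF \<phi> f[OF xy(2)]] inj_onD[OF mor_inj[OF \<phi>] _ f[OF xy(1)] f[OF xy(2)]]
        by (cases "x = 1"; cases "y = 1") auto
    qed
  qed
qed

lemma mor_shift_id: "mor_shift G m (mor_id G m) = mor_id G (Suc m)"
  unfolding mor_shift_def mor_id_def by (intro arg_cong2[where f = Pair] restrict_ext) auto

lemma mor_shift_comp:
  assumes "\<phi> \<in> mor G m n" "\<psi> \<in> mor G l m"
  shows "mor_shift G l (mor_comp G l \<phi> \<psi>) = mor_comp G (Suc l) (mor_shift G m \<phi>) (mor_shift G l \<psi>)"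
proof -
  interpret group G by (rule grp)
  have f: "fst \<psi> (i - 1) \<in> {1..m}" "i - 1 \<in> {1..l}" if "i \<in> {1..Suc l}" "i \<noteq> 1" for i
  proof -
    show i: "i - 1 \<in> {1..l}" using that by auto
    show "fst \<psi> (i - 1) \<in> {1..m}" by (rule mor_fst[OF assms(2) i])
  qed
  show ?thesis
    unfolding mor_shift_def mor_comp_def fst_conv snd_conv
  proof (intro arg_cong2[where f = Pair] restrict_ext)
    fix i assume i: "i \<in> {1..Suc l}"
    show "(if i = 1 then 1 else (\<lambda>i\<in>{1..l}. fst \<phi> (fst \<psi> i)) (i - 1) + 1) =
      (\<lambda>i\<in>{1..Suc m}. if i = 1 then 1 else fst \<phi> (i - 1) + 1)
        ((\<lambda>i\<in>{1..Suc l}. if i = 1 then 1 else fst \<psi> (i - 1) + 1) i)"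
      using f[OF i] i by auto
    show "(if i = 1 then \<one>\<^bsub>G\<^esub> else (\<lambda>i\<in>{1..l}. snd \<phi> (fst \<psi> i) \<otimes>\<^bsub>G\<^esub> snd \<psi> i) (i - 1)) =
      (\<lambda>i\<in>{1..Suc m}. if i = 1 then \<one>\<^bsub>G\<^esub> else snd \<phi> (i - 1))
        ((\<lambda>i\<in>{1..Suc l}. if i = 1 then 1 else fst \<psi> (i - 1) + 1) i) \<otimes>\<^bsub>G\<^esub>
      (\<lambda>i\<in>{1..Suc l}. if i = 1 then \<one>\<^bsub>G\<^esub> else snd \<psi> (i - 1)) i"
      using f[OF i] i by auto
  qed
qed

lemma mor_shift_image: "Z \<subseteq> {1..m} \<Longrightarrow> fst (mor_shift G m \<phi>) ` Suc ` Z = Suc ` fst \<phi> ` Z"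
proof -
  assume "Z \<subseteq> {1..m}"
  then have "fst (mor_shift G m \<phi>) (Suc z) = Suc (fst \<phi> z)" if "z \<in> Z" for z
    using that by (auto simp: mor_shift_def)
  then show ?thesis unfolding image_image by (rule image_cong[OF refl])
qed

lemma mor_shift_full_image: "mor_image (Suc m) (mor_shift G m \<phi>) = insert 1 (Suc ` mor_image m \<phi>)"
proof -
  have "{1..Suc m} = insert 1 (Suc ` {1..m})" by (auto simp: image_Suc_atLeastAtMost)
  moreover have "fst (mor_shift G m \<phi>) 1 = 1" by (simp add: mor_shift_def)
  ultimately show ?thesis using mor_shift_image[OF subset_refl, of m \<phi>] by (simp only: image_insert)
qed

lemma shift_simps [simp]:
  "obj (cmod_shift G V) n = obj V (Suc n)"
  "act (cmod_shift G V) m n \<phi> = act V (Suc m) (Suc n) (mor_shift G m \<phi>)"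
  by (simp_all add: cmod_shift_def)

lemma cmod_shift_cmodule:
  assumes V: "cmodule G k V"
  shows "cmodule G k (cmod_shift G V)"
  unfolding cmodule_def shift_simps
  by (intro conjI allI ballI)
    (simp_all add: cmodule_module[OF V] cmodule_act[OF V mor_shift_closed] mor_shift_id cmodule_id[OF V]
      mor_shift_comp cmodule_comp[OF V mor_shift_closed mor_shift_closed])

text \<open>Shifting commutes with derivatives along points other than the new one. A morphism
  missing \<open>z + 1\<close> need not fix the point 1 and so need not be a shifted one, but it
  factors through the face missing only \<open>z + 1\<close>, and that face is shifted.\<close>

lemma deficient_shift:
  assumes V: "cmodule G k V" and Z: "Z \<subseteq> {1..m}"
  shows "deficient G k V (Suc ` Z) (Suc m) = deficient G k (cmod_shift G V) Z m"
proof
  note S = cmod_shift_cmodule[OF V]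
  show "deficient G k (cmod_shift G V) Z m \<subseteq> deficient G k V (Suc ` Z) (Suc m)"
  proof (rule deficient_least)
    show "submodule (deficient G k V (Suc ` Z) (Suc m)) k (obj (cmod_shift G V) m)"
      using deficient_submodule[OF V, of "Suc ` Z" "Suc m"] by simp
    fix j \<beta> y assume \<beta>: "\<beta> \<in> mor G j m" and miss: "\<not> Z \<subseteq> mor_image j \<beta>" and y: "y \<in> full (cmod_shift G V) j"
    obtain z where z: "z \<in> Z" "z \<notin> mor_image j \<beta>" using miss by blast
    then have "Suc z \<notin> insert 1 (Suc ` mor_image j \<beta>)" using Z by auto
    then have "\<not> Suc ` Z \<subseteq> mor_image (Suc j) (mor_shift G j \<beta>)"
      unfolding mor_shift_full_image using z(1) by blast
    from act_in_deficient[OF mor_shift_closed[OF \<beta>] this] y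
    show "act (cmod_shift G V) j m \<beta> y \<in> deficient G k V (Suc ` Z) (Suc m)" by simp
  qed
  show "deficient G k V (Suc ` Z) (Suc m) \<subseteq> deficient G k (cmod_shift G V) Z m"
  proof (rule deficient_least)
    show "submodule (deficient G k (cmod_shift G V) Z m) k (obj V (Suc m))"
      using deficient_submodule[OF S, of Z m] by simp
    fix j \<beta> y assume \<beta>: "\<beta> \<in> mor G j (Suc m)" and miss: "\<not> Suc ` Z \<subseteq> mor_image j \<beta>" and y: "y \<in> full V j"
    obtain z where z: "z \<in> Z" "Suc z \<notin> mor_image j \<beta>" using miss by blast
    have z1: "z \<in> {1..m}" using z Z by blast
    then obtain m0 where m0: "m = Suc m0" by (cases m) auto
    have z2: "z - 1 \<le> m0" "Suc (z - 1) = z" using z1 m0 by auto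
    let ?f = "face G m0 (z - 1)"
    have fim: "mor_image m0 ?f = {1..m} - {z}" using face_image[OF z2(1)] z2(2) m0 by simp
    have sc: "mor_shift G m0 ?f \<in> mor G m (Suc m)" using mor_shift_closed[OF face_closed] m0 by simp
    have "mor_image m (mor_shift G m0 ?f) = insert 1 (Suc ` ({1..m} - {z}))"
      using mor_shift_full_image[of m0 ?f] unfolding fim m0[symmetric] .
    also have "\<dots> = {1..Suc m} - {Suc z}"
    proof (intro equalityI subsetI)
      fix x assume "x \<in> {1..Suc m} - {Suc z}"
      then show "x \<in> insert 1 (Suc ` ({1..m} - {z}))" by (cases x) auto
    qed (use z1 in auto)
    finally have im: "mor_image m (mor_shift G m0 ?f) = {1..Suc m} - {Suc z}" .
    have "mor_image j \<beta> \<subseteq> {1..Suc m}" using mor_fst[OF \<beta>] by blast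
    then have "mor_image j \<beta> \<subseteq> mor_image m (mor_shift G m0 ?f)"
      unfolding im subset_Diff_insert using z(2) by simp
    from mor_factor[OF \<beta> sc this] obtain \<gamma> where \<gamma>: "\<gamma> \<in> mor G j m" "\<beta> = mor_comp G j (mor_shift G m0 ?f) \<gamma>" by blast
    have "\<not> Z \<subseteq> mor_image m0 ?f" unfolding fim using z(1) by blast
    moreover have "?f \<in> mor G m0 m" using face_closed[of m0 "z - 1"] m0 by simp
    moreover have "act V j m \<gamma> y \<in> full (cmod_shift G V) m0" using act_closed[OF V \<gamma>(1) y] m0 by simp
    ultimately have "act (cmod_shift G V) m0 m ?f (act V j m \<gamma> y) \<in> deficient G k (cmod_shift G V) Z m"
      by (intro act_in_deficient)
    then show "act V j (Suc m) \<beta> y \<in> deficient G k (cmod_shift G V) Z m"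
      using cmodule_comp[OF V \<gamma>(1) sc y] \<gamma>(2) m0 by simp
  qed
qed

text \<open>The added point 1 raises the degree by one without entering the image of
  \<open>Z\<close>, so one unit of the bound is gained; a bound of 0 stays 0.\<close>

lemma injective_from_shift:
  assumes V: "cmodule G k V" and inj: "injective_from N V"
  shows "injective_from (N - 1) (cmod_shift G V)"
  unfolding injective_from_def
proof (intro allI ballI impI)
  fix m m' \<theta> Z v
  assume \<theta>: "\<theta> \<in> mor G m m'" and Z: "Z \<subseteq> {1..m}" and N: "card Z + (N - 1) \<le> m" and v: "v \<in> full (cmod_shift G V) m"
    and d: "act (cmod_shift G V) m m' \<theta> v \<in> deficient G k (cmod_shift G V) (fst \<theta> ` Z) m'"
  have \<theta>Z: "fst \<theta> ` Z \<subseteq> {1..m'}" using mor_fst[OF \<theta>] Z by blast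
  have "act V (Suc m) (Suc m') (mor_shift G m \<theta>) v \<in> deficient G k V (fst (mor_shift G m \<theta>) ` Suc ` Z) (Suc m')"
    using d unfolding mor_shift_image[OF Z] deficient_shift[OF V \<theta>Z] by simp
  moreover have "Suc ` Z \<subseteq> {1..Suc m}" using Z by auto
  moreover have "card (Suc ` Z) + N \<le> Suc m" using N by (simp add: card_image)
  ultimately have "v \<in> deficient G k V (Suc ` Z) (Suc m)"
    using inj mor_shift_closed[OF \<theta>] v unfolding injective_from_def by simp
  then show "v \<in> deficient G k (cmod_shift G V) Z m" unfolding deficient_shift[OF V Z] .
qed

lemma degree_less_shift:
  assumes V: "cmodule G k V" and deg: "degree_less D V"
  shows "degree_less D (cmod_shift G V)"
  unfolding degree_less_def
proof (intro allI impI)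
  fix m and Z :: "nat set" assume Z: "Z \<subseteq> {1..m}" and D: "D \<le> card Z"
  have "Suc ` Z \<subseteq> {1..Suc m}" using Z by auto
  moreover have "D \<le> card (Suc ` Z)" using D by (simp add: card_image)
  ultimately have "full V (Suc m) \<subseteq> deficient G k V (Suc ` Z) (Suc m)"
    using deg unfolding degree_less_def by blast
  then show "full (cmod_shift G V) m \<subseteq> deficient G k (cmod_shift G V) Z m" unfolding deficient_shift[OF V Z] by simp
qed

lemma iterated_shift:
  assumes V: "cmodule G k V" and "injective_from N V" and "degree_less D V"
  shows "cmodule G k ((cmod_shift G ^^ n) V) \<and> injective_from (N - n) ((cmod_shift G ^^ n) V)
    \<and> degree_less D ((cmod_shift G ^^ n) V)"
proof (induct n)
  case (Suc n)
  let ?U = "(cmod_shift G ^^ n) V"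
  have *: "cmodule G k ?U" "injective_from (N - n) ?U" "degree_less D ?U" using Suc by auto
  have "injective_from (N - n - 1) (cmod_shift G ?U)" by (rule injective_from_shift[OF *(1,2)])
  moreover have "N - n - 1 = N - Suc n" by simp
  ultimately show ?case
    using cmod_shift_cmodule[OF *(1)] degree_less_shift[OF *(1,3)] by (simp only: funpow.simps o_apply simp_thms)
qed (use assms in simp)

end

section \<open>Induced modules\<close>

lemma module_minus_eq_zero_iff:
  assumes M: "Module.module k M" and u: "u \<in> carrier M" and v: "v \<in> carrier M"
  shows "u \<ominus>\<^bsub>M\<^esub> v = \<zero>\<^bsub>M\<^esub> \<longleftrightarrow> u = v"
proof -
  interpret M: Module.module k M by (rule M)
  have "u = (u \<ominus>\<^bsub>M\<^esub> v) \<oplus>\<^bsub>M\<^esub> v" using u v by (simp add: M.minus_eq M.a_assoc M.l_neg)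
  then show ?thesis using u v by (auto simp: M.minus_eq M.r_neg)
qed

lemma mod_hom_sum:
  assumes N: "Module.module k N" and f: "f \<in> mod_hom k M N" and g: "g \<in> mod_hom k M N"
  shows "(\<lambda>x. f x \<oplus>\<^bsub>N\<^esub> g x) \<in> mod_hom k M N"
proof -
  interpret N: Module.module k N by (rule N)
  note c = mod_hom_closed[OF f] mod_hom_closed[OF g]
  show ?thesis
    by (rule mod_homI)
      (simp_all add: c mod_hom_add[OF f] mod_hom_add[OF g] mod_hom_smult[OF f] mod_hom_smult[OF g] N.smult_r_distr N.a_ac)
qed

lemma mod_hom_scale:
  assumes N: "Module.module k N" and f: "f \<in> mod_hom k M N" and a: "a \<in> carrier k"
  shows "(\<lambda>x. a \<odot>\<^bsub>N\<^esub> f x) \<in> mod_hom k M N"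
proof -
  interpret N: Module.module k N by (rule N)
  show ?thesis
    by (rule mod_homI)
      (use a in \<open>simp_all add: mod_hom_closed[OF f] mod_hom_add[OF f] mod_hom_smult[OF f] N.smult_r_distr
        N.smult_assoc1[symmetric] N.R.m_comm\<close>)
qed

lemma submodule_image:
  assumes M: "Module.module k M" and N: "Module.module k N" and f: "f \<in> mod_hom k M N"
  shows "submodule (f ` carrier M) k N"
proof (rule submoduleI'[OF N])
  interpret M: Module.module k M by (rule M)
  show "f ` carrier M \<subseteq> carrier N" using mod_hom_closed[OF f] by blast
  show "\<zero>\<^bsub>N\<^esub> \<in> f ` carrier M" using mod_hom_zero[OF M N f] M.zero_closed by (metis imageI)
  fix u assume "u \<in> f ` carrier M"
  then obtain x where x: "x \<in> carrier M" "u = f x" by blast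
  show "a \<odot>\<^bsub>N\<^esub> u \<in> f ` carrier M" if a: "a \<in> carrier k" for a
    unfolding x(2) mod_hom_smult[OF f a x(1), symmetric] by (rule imageI[OF M.smult_closed[OF a x(1)]])
  fix v assume "v \<in> f ` carrier M"
  then obtain y where y: "y \<in> carrier M" "v = f y" by blast
  show "u \<oplus>\<^bsub>N\<^esub> v \<in> f ` carrier M"
    unfolding x(2) y(2) mod_hom_add[OF f x(1) y(1), symmetric] by (rule imageI[OF M.add.m_closed[OF x(1) y(1)]])
qed

section \<open>Evaluation of the induced module of a value\<close>

locale induction_data = FIG G k for G :: "('g, 'x) monoid_scheme" and k :: "('k, 'y) ring_scheme" +
  fixes Q :: "('k, 'g, 'b) cmod" and i :: nat
  assumes Q: "cmodule G k Q"
begin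

abbreviation "T \<equiv> obj Q i"
abbreviation "\<rho> \<equiv> act Q i i"

definition X :: "nat \<Rightarrow> ('k, 'g mor \<Rightarrow> 'k) module" where
  "X q = mod_free k (mor G i q)"

definition F :: "nat \<Rightarrow> ('k, ('g mor \<Rightarrow> 'k) \<times> 'b \<Rightarrow> 'k) module" where
  "F q = mod_free k (carrier (X q) \<times> carrier T)"

definition R :: "nat \<Rightarrow> (('g mor \<Rightarrow> 'k) \<times> 'b \<Rightarrow> 'k) set" where
  "R q = tensor_sub k (mor G i i) (X q) (mor_right G k i) T \<rho>"

definition ev :: "nat \<Rightarrow> ('g mor \<Rightarrow> 'k) \<Rightarrow> 'b \<Rightarrow> 'b" where
  "ev q x t = free_eval k (obj Q q) (\<lambda>\<phi>. act Q i q \<phi> t) x"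

text \<open>The counit from the module induced by \<open>Q\<close> in degree \<open>i\<close> to
  \<open>Q\<close>, taken before division by the tensor relations so that it can be computed on
  generators.\<close>

definition eps :: "nat \<Rightarrow> (('g mor \<Rightarrow> 'k) \<times> 'b \<Rightarrow> 'k) \<Rightarrow> 'b" where
  "eps q = free_eval k (obj Q q) (\<lambda>(x, t). ev q x t)"

definition pure :: "('g mor \<Rightarrow> 'k) \<Rightarrow> 'b \<Rightarrow> (('g mor \<Rightarrow> 'k) \<times> 'b \<Rightarrow> 'k)" where
  "pure x t = free_gen k (x, t)"

lemma MX: "Module.module k (X q)" and MF: "Module.module k (F q)" and MQ: "Module.module k (obj Q q)"
  by (simp_all add: X_def F_def mod_free_module cmodule_module[OF Q])

lemma group_rep: "group_rep G k i T \<rho>"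
  using Q by (simp add: group_rep_def cmodule_def)

lemma X_gen: "\<phi> \<in> mor G i q \<Longrightarrow> free_gen k \<phi> \<in> carrier (X q)"
  by (simp only: X_def free_gen_closed)

lemma pure_closed: "x \<in> carrier (X q) \<Longrightarrow> t \<in> carrier T \<Longrightarrow> pure x t \<in> carrier (F q)"
  unfolding F_def pure_def by (rule free_gen_closed) simp

lemma X_hom_eq:
  assumes "Module.module k M" "f \<in> mod_hom k (X q) M" "g \<in> mod_hom k (X q) M"
    and "\<And>\<phi>. \<phi> \<in> mor G i q \<Longrightarrow> f (free_gen k \<phi>) = g (free_gen k \<phi>)" "x \<in> carrier (X q)"
  shows "f x = g x"
  using mod_free_hom_eq[OF assms(1) assms(2,3)[unfolded X_def] assms(4) assms(5)[unfolded X_def]] .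

lemma F_hom_eq:
  assumes "Module.module k M" "f \<in> mod_hom k (F q) M" "g \<in> mod_hom k (F q) M"
    and "\<And>x t. x \<in> carrier (X q) \<Longrightarrow> t \<in> carrier T \<Longrightarrow> f (pure x t) = g (pure x t)" "c \<in> carrier (F q)"
  shows "f c = g c"
  by (rule mod_free_hom_eq[OF assms(1) assms(2,3)[unfolded F_def] _ assms(5)[unfolded F_def]])
    (use assms(4) in \<open>auto simp: pure_def\<close>)

lemma ev_hom: "t \<in> carrier T \<Longrightarrow> (\<lambda>x. ev q x t) \<in> mod_hom k (X q) (obj Q q)"
  unfolding ev_def X_def by (rule free_eval_hom[OF MQ]) (rule act_closed[OF Q])

lemma ev_gen: "\<phi> \<in> mor G i q \<Longrightarrow> t \<in> carrier T \<Longrightarrow> ev q (free_gen k \<phi>) t = act Q i q \<phi> t"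
  unfolding ev_def by (rule free_eval_gen[OF MQ]) (rule act_closed[OF Q])

lemma ev_closed: "x \<in> carrier (X q) \<Longrightarrow> t \<in> carrier T \<Longrightarrow> ev q x t \<in> carrier (obj Q q)"
  by (rule mod_hom_closed[OF ev_hom])

lemma ev_add:
  assumes x: "x \<in> carrier (X q)" and t: "t \<in> carrier T" "t' \<in> carrier T"
  shows "ev q x (t \<oplus>\<^bsub>T\<^esub> t') = ev q x t \<oplus>\<^bsub>obj Q q\<^esub> ev q x t'"
proof -
  interpret T: Module.module k T by (rule MQ)
  have tt: "t \<oplus>\<^bsub>T\<^esub> t' \<in> carrier T" using t by simp
  show ?thesis
    by (rule X_hom_eq[OF MQ ev_hom[OF tt] mod_hom_sum[OF MQ ev_hom[OF t(1)] ev_hom[OF t(2)]] _ x])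
      (simp add: ev_gen t tt mod_hom_add[OF cmodule_act[OF Q]])
qed

lemma ev_smult:
  assumes x: "x \<in> carrier (X q)" and t: "t \<in> carrier T" and a: "a \<in> carrier k"
  shows "ev q x (a \<odot>\<^bsub>T\<^esub> t) = a \<odot>\<^bsub>obj Q q\<^esub> ev q x t"
proof -
  interpret T: Module.module k T by (rule MQ)
  have at: "a \<odot>\<^bsub>T\<^esub> t \<in> carrier T" using t a by simp
  show ?thesis
    by (rule X_hom_eq[OF MQ ev_hom[OF at] mod_hom_scale[OF MQ ev_hom[OF t] a] _ x])
      (simp add: ev_gen t at mod_hom_smult[OF cmodule_act[OF Q] a])
qed

lemma mor_right_inj:
  assumes \<sigma>: "\<sigma> \<in> mor G i i"
  shows "inj_on (\<lambda>\<phi>. mor_comp G i \<phi> \<sigma>) (mor G i q)"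
proof (rule inj_onI)
  obtain \<tau> where \<tau>: "\<tau> \<in> mor G i i" "mor_comp G i \<sigma> \<tau> = mor_id G i" using mor_inverse[OF \<sigma>] by blast
  fix \<phi> \<phi>' assume \<phi>: "\<phi> \<in> mor G i q" "\<phi>' \<in> mor G i q" and eq: "mor_comp G i \<phi> \<sigma> = mor_comp G i \<phi>' \<sigma>"
  have "mor_comp G i (mor_comp G i \<phi> \<sigma>) \<tau> = mor_comp G i (mor_comp G i \<phi>' \<sigma>) \<tau>" using eq by simp
  then show "\<phi> = \<phi>'"
    using \<phi> by (simp add: mor_comp_assoc[OF _ \<sigma> \<tau>(1), symmetric] \<tau>(2) mor_comp_id_right)
qed

lemma mor_right_hom: "\<sigma> \<in> mor G i i \<Longrightarrow> mor_right G k i \<sigma> \<in> mod_hom k (X q) (X q)"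
  unfolding mor_right_def X_def
  by (rule free_map_hom[OF mor_right_inj]) (auto intro: mor_comp_closed)

lemma mor_right_gen:
  "\<sigma> \<in> mor G i i \<Longrightarrow> \<phi> \<in> mor G i q \<Longrightarrow> mor_right G k i \<sigma> (free_gen k \<phi>) = free_gen k (mor_comp G i \<phi> \<sigma>)"
  unfolding mor_right_def by (rule free_map_gen[OF mor_right_inj])

lemma ev_balanced:
  assumes x: "x \<in> carrier (X q)" and t: "t \<in> carrier T" and \<sigma>: "\<sigma> \<in> mor G i i"
  shows "ev q (mor_right G k i \<sigma> x) t = ev q x (\<rho> \<sigma> t)"
proof -
  have \<sigma>t: "\<rho> \<sigma> t \<in> carrier T" by (rule act_closed[OF Q \<sigma> t])
  show ?thesis
    by (rule X_hom_eq[OF MQ mod_hom_comp[OF mor_right_hom[OF \<sigma>] ev_hom[OF t]] ev_hom[OF \<sigma>t] _ x])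
      (simp add: mor_right_gen[OF \<sigma>] ev_gen t \<sigma>t mor_comp_closed[OF _ \<sigma>] cmodule_comp[OF Q \<sigma>])
qed

lemma eps_hom: "eps q \<in> mod_hom k (F q) (obj Q q)"
  unfolding eps_def F_def by (rule free_eval_hom[OF MQ]) (auto intro: ev_closed)

lemma eps_pure: "x \<in> carrier (X q) \<Longrightarrow> t \<in> carrier T \<Longrightarrow> eps q (pure x t) = ev q x t"
  unfolding eps_def pure_def using free_eval_gen[OF MQ, of "\<lambda>(x, t). ev q x t" "(x, t)"] by (simp add: ev_closed)

section \<open>The tensor relations and the kernel of evaluation\<close>

lemma tensor_add_left:
  "x \<in> carrier (X q) \<Longrightarrow> x' \<in> carrier (X q) \<Longrightarrow> t \<in> carrier T \<Longrightarrow>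
     pure (x \<oplus>\<^bsub>X q\<^esub> x') t \<ominus>\<^bsub>F q\<^esub> (pure x t \<oplus>\<^bsub>F q\<^esub> pure x' t) \<in> R q"
  unfolding R_def tensor_sub_def F_def pure_def
  by (rule subsetD[OF mod_span_superset], unfold tensor_rels_def Let_def, rule UnI1, rule UnI1, rule UnI1, rule UnI1,
    rule CollectI, intro exI conjI, rule refl, assumption+)

lemma tensor_add_right:
  "x \<in> carrier (X q) \<Longrightarrow> t \<in> carrier T \<Longrightarrow> t' \<in> carrier T \<Longrightarrow>
     pure x (t \<oplus>\<^bsub>T\<^esub> t') \<ominus>\<^bsub>F q\<^esub> (pure x t \<oplus>\<^bsub>F q\<^esub> pure x t') \<in> R q"
  unfolding R_def tensor_sub_def F_def pure_def
  by (rule subsetD[OF mod_span_superset], unfold tensor_rels_def Let_def, rule UnI1, rule UnI1, rule UnI1, rule UnI2,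
    rule CollectI, intro exI conjI, rule refl, assumption+)

lemma tensor_smult_left:
  "a \<in> carrier k \<Longrightarrow> x \<in> carrier (X q) \<Longrightarrow> t \<in> carrier T \<Longrightarrow>
     pure (a \<odot>\<^bsub>X q\<^esub> x) t \<ominus>\<^bsub>F q\<^esub> (a \<odot>\<^bsub>F q\<^esub> pure x t) \<in> R q"
  unfolding R_def tensor_sub_def F_def pure_def
  by (rule subsetD[OF mod_span_superset], unfold tensor_rels_def Let_def, rule UnI1, rule UnI1, rule UnI2,
    rule CollectI, intro exI conjI, rule refl, assumption+)

lemma tensor_smult_right:
  "a \<in> carrier k \<Longrightarrow> x \<in> carrier (X q) \<Longrightarrow> t \<in> carrier T \<Longrightarrow>
     pure x (a \<odot>\<^bsub>T\<^esub> t) \<ominus>\<^bsub>F q\<^esub> (a \<odot>\<^bsub>F q\<^esub> pure x t) \<in> R q"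
  unfolding R_def tensor_sub_def F_def pure_def
  by (rule subsetD[OF mod_span_superset], unfold tensor_rels_def Let_def, rule UnI1, rule UnI2,
    rule CollectI, intro exI conjI, rule refl, assumption+)

lemma tensor_balanced:
  "\<sigma> \<in> mor G i i \<Longrightarrow> x \<in> carrier (X q) \<Longrightarrow> t \<in> carrier T \<Longrightarrow>
     pure (mor_right G k i \<sigma> x) t \<ominus>\<^bsub>F q\<^esub> pure x (\<rho> \<sigma> t) \<in> R q"
  unfolding R_def tensor_sub_def F_def pure_def
  by (rule subsetD[OF mod_span_superset], unfold tensor_rels_def Let_def, rule UnI2,
    rule CollectI, intro exI conjI, rule refl, assumption+)

lemma tensor_rels_ker:
  "tensor_rels k (mor G i i) (X q) (mor_right G k i) T \<rho> \<subseteq> {c \<in> carrier (F q). eps q c = \<zero>\<^bsub>obj Q q\<^esub>}"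
proof
  interpret F: Module.module k "F q" by (rule MF)
  interpret X: Module.module k "X q" by (rule MX)
  interpret T: Module.module k T by (rule MQ)
  interpret Qq: Module.module k "obj Q q" by (rule MQ)
  have D: "u \<ominus>\<^bsub>F q\<^esub> v \<in> {c \<in> carrier (F q). eps q c = \<zero>\<^bsub>obj Q q\<^esub>}"
    if "u \<in> carrier (F q)" "v \<in> carrier (F q)" "eps q u = eps q v" for u v
    using that mod_hom_closed[OF eps_hom]
    by (simp add: mod_hom_minus[OF MF MQ eps_hom] Qq.minus_eq Qq.r_neg)
  note e = mod_hom_add[OF eps_hom] mod_hom_smult[OF eps_hom] eps_pure ev_add ev_smult ev_balanced
    mod_hom_add[OF ev_hom] mod_hom_smult[OF ev_hom] pure_closed mod_hom_closed[OF mor_right_hom] act_closed[OF Q]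
  fix r assume "r \<in> tensor_rels k (mor G i i) (X q) (mor_right G k i) T \<rho>"
  then show "r \<in> {c \<in> carrier (F q). eps q c = \<zero>\<^bsub>obj Q q\<^esub>}"
    unfolding tensor_rels_def Let_def F_def[symmetric] pure_def[symmetric]
  proof (elim UnE CollectE exE conjE, goal_cases)
    case 1
    show ?case unfolding 1(1) by (rule D) (use 1(2-) in \<open>simp_all add: e\<close>)
  next
    case 2
    show ?case unfolding 2(1) by (rule D) (use 2(2-) in \<open>simp_all add: e\<close>)
  next
    case 3
    show ?case unfolding 3(1) by (rule D) (use 3(2-) in \<open>simp_all add: e\<close>)
  next
    case 4
    show ?case unfolding 4(1) by (rule D) (use 4(2-) in \<open>simp_all add: e\<close>)
  next
    case 5
    show ?case unfolding 5(1) by (rule D) (use 5(2-) in \<open>simp_all add: e\<close>)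
  qed
qed

lemma eps_ker_submodule: "submodule {c \<in> carrier (F q). eps q c = \<zero>\<^bsub>obj Q q\<^esub>} k (F q)"
  using submodule_preimage[OF MF MQ eps_hom submodule_trivial[OF MQ]] by simp

lemma R_submodule: "submodule (R q) k (F q)"
proof -
  have "tensor_rels k (mor G i i) (X q) (mor_right G k i) T \<rho> \<subseteq> carrier (F q)" using tensor_rels_ker by blast
  from mod_span_submodule[OF MF this] show ?thesis by (simp add: R_def tensor_sub_def F_def)
qed

lemma R_ker: "R q \<subseteq> {c \<in> carrier (F q). eps q c = \<zero>\<^bsub>obj Q q\<^esub>}"
  unfolding R_def tensor_sub_def F_def[symmetric]
  by (rule mod_span_least[OF eps_ker_submodule tensor_rels_ker])

section \<open>The tensor product and its bilinear map\<close>

definition MT :: "nat \<Rightarrow> ('k, (('g mor \<Rightarrow> 'k) \<times> 'b \<Rightarrow> 'k) set) module" where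
  "MT q = mod_quot (F q) (R q)"

definition cls :: "nat \<Rightarrow> (('g mor \<Rightarrow> 'k) \<times> 'b \<Rightarrow> 'k) \<Rightarrow> (('g mor \<Rightarrow> 'k) \<times> 'b \<Rightarrow> 'k) set" where
  "cls q c = R q +>\<^bsub>F q\<^esub> c"

lemma MT_obj: "obj (induced G k i T \<rho>) q = MT q"
  by (simp add: induced_def mod_tensor_def MT_def F_def R_def X_def)

lemma MMT: "Module.module k (MT q)"
  unfolding MT_def by (rule mod_quot_module[OF MF R_submodule])

lemma cls_hom: "cls q \<in> mod_hom k (F q) (MT q)"
  unfolding MT_def cls_def
  by (rule mod_homI) (simp_all only: mod_quot_image[OF MF R_submodule] mod_quot_simps(1) a_rcosets_image imageI)

lemma MT_carrier: "carrier (MT q) = cls q ` carrier (F q)"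
  by (simp add: MT_def a_rcosets_image cls_def[abs_def])

lemma cls_eq_iff: "c \<in> carrier (F q) \<Longrightarrow> d \<in> carrier (F q) \<Longrightarrow> cls q c = cls q d \<longleftrightarrow> c \<ominus>\<^bsub>F q\<^esub> d \<in> R q"
  unfolding cls_def by (rule abelian_group_cosets(4)[OF MF R_submodule])

definition bil :: "nat \<Rightarrow> ('g mor \<Rightarrow> 'k) \<Rightarrow> 'b \<Rightarrow> (('g mor \<Rightarrow> 'k) \<times> 'b \<Rightarrow> 'k) set" where
  "bil q x t = cls q (pure x t)"

lemma bil_closed: "x \<in> carrier (X q) \<Longrightarrow> t \<in> carrier T \<Longrightarrow> bil q x t \<in> carrier (MT q)"
  unfolding bil_def by (rule mod_hom_closed[OF cls_hom pure_closed])

lemma bil_hom_left: "t \<in> carrier T \<Longrightarrow> (\<lambda>x. bil q x t) \<in> mod_hom k (X q) (MT q)"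
proof -
  assume t: "t \<in> carrier T"
  interpret F: Module.module k "F q" by (rule MF)
  interpret X: Module.module k "X q" by (rule MX)
  show ?thesis
  proof (rule mod_homI)
    fix x y assume x: "x \<in> carrier (X q)" and y: "y \<in> carrier (X q)"
    note p = pure_closed[OF x t] pure_closed[OF y t]
    have "cls q (pure (x \<oplus>\<^bsub>X q\<^esub> y) t) = cls q (pure x t \<oplus>\<^bsub>F q\<^esub> pure y t)"
      using cls_eq_iff[OF pure_closed[OF X.add.m_closed[OF x y] t] F.add.m_closed[OF p]] tensor_add_left[OF x y t] by simp
    then show "bil q (x \<oplus>\<^bsub>X q\<^esub> y) t = bil q x t \<oplus>\<^bsub>MT q\<^esub> bil q y t"
      by (simp add: bil_def mod_hom_add[OF cls_hom p])
  next
    fix a x assume a: "a \<in> carrier k" and x: "x \<in> carrier (X q)"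
    note p = pure_closed[OF x t]
    have "cls q (pure (a \<odot>\<^bsub>X q\<^esub> x) t) = cls q (a \<odot>\<^bsub>F q\<^esub> pure x t)"
      using cls_eq_iff[OF pure_closed[OF X.smult_closed[OF a x] t] F.smult_closed[OF a p]] tensor_smult_left[OF a x t] by simp
    then show "bil q (a \<odot>\<^bsub>X q\<^esub> x) t = a \<odot>\<^bsub>MT q\<^esub> bil q x t"
      by (simp add: bil_def mod_hom_smult[OF cls_hom a p])
  qed (rule bil_closed[OF _ t])
qed

lemma bil_hom_right: "x \<in> carrier (X q) \<Longrightarrow> bil q x \<in> mod_hom k T (MT q)"
proof -
  assume x: "x \<in> carrier (X q)"
  interpret F: Module.module k "F q" by (rule MF)
  interpret T: Module.module k T by (rule MQ)
  show ?thesis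
  proof (rule mod_homI)
    fix t u assume t: "t \<in> carrier T" and u: "u \<in> carrier T"
    note p = pure_closed[OF x t] pure_closed[OF x u]
    have "cls q (pure x (t \<oplus>\<^bsub>T\<^esub> u)) = cls q (pure x t \<oplus>\<^bsub>F q\<^esub> pure x u)"
      using cls_eq_iff[OF pure_closed[OF x T.add.m_closed[OF t u]] F.add.m_closed[OF p]] tensor_add_right[OF x t u] by simp
    then show "bil q x (t \<oplus>\<^bsub>T\<^esub> u) = bil q x t \<oplus>\<^bsub>MT q\<^esub> bil q x u"
      by (simp add: bil_def mod_hom_add[OF cls_hom p])
  next
    fix a t assume a: "a \<in> carrier k" and t: "t \<in> carrier T"
    note p = pure_closed[OF x t]
    have "cls q (pure x (a \<odot>\<^bsub>T\<^esub> t)) = cls q (a \<odot>\<^bsub>F q\<^esub> pure x t)"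
      using cls_eq_iff[OF pure_closed[OF x T.smult_closed[OF a t]] F.smult_closed[OF a p]] tensor_smult_right[OF a x t] by simp
    then show "bil q x (a \<odot>\<^bsub>T\<^esub> t) = a \<odot>\<^bsub>MT q\<^esub> bil q x t"
      by (simp add: bil_def mod_hom_smult[OF cls_hom a p])
  qed (rule bil_closed[OF x])
qed

lemma bil_balanced:
  assumes x: "x \<in> carrier (X q)" and t: "t \<in> carrier T" and \<sigma>: "\<sigma> \<in> mor G i i"
  shows "bil q (mor_right G k i \<sigma> x) t = bil q x (\<rho> \<sigma> t)"
  unfolding bil_def
  using cls_eq_iff[OF pure_closed[OF mod_hom_closed[OF mor_right_hom[OF \<sigma>] x] t] pure_closed[OF x act_closed[OF Q \<sigma> t]]]
    tensor_balanced[OF \<sigma> x t] by simp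

section \<open>Normal forms in the induced module\<close>

definition subsets :: "nat \<Rightarrow> nat set set" where
  "subsets q = {S. S \<subseteq> {1..q} \<and> card S = i}"

text \<open>Morphisms from \<open>[i]\<close> with the same image differ by an automorphism of
  \<open>[i]\<close>, so these morphisms represent the orbits under precomposition.\<close>

definition rep :: "nat \<Rightarrow> nat set \<Rightarrow> 'g mor" where
  "rep q S = (SOME \<phi>. \<phi> \<in> mor G i q \<and> mor_image i \<phi> = S)"

lemma finite_subsets: "finite (subsets q)"
  by (rule finite_subset[of _ "Pow {1..q}"]) (auto simp: subsets_def)

lemma rep: "S \<in> subsets q \<Longrightarrow> rep q S \<in> mor G i q" "S \<in> subsets q \<Longrightarrow> mor_image i (rep q S) = S"
proof -
  assume "S \<in> subsets q"
  then have "\<exists>\<phi>. \<phi> \<in> mor G i q \<and> mor_image i \<phi> = S" using mor_with_image[of S q] by (auto simp: subsets_def)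
  from someI_ex[OF this] show "rep q S \<in> mor G i q" "mor_image i (rep q S) = S" by (simp_all add: rep_def)
qed

lemma mor_rep:
  assumes \<phi>: "\<phi> \<in> mor G i q"
  obtains S \<sigma> where "S \<in> subsets q" "\<sigma> \<in> mor G i i" "\<phi> = mor_comp G i (rep q S) \<sigma>"
proof -
  have "mor_image i \<phi> \<subseteq> {1..q}" using mor_fst[OF \<phi>] by blast
  then have S: "mor_image i \<phi> \<in> subsets q" using card_image[OF mor_inj[OF \<phi>]] by (simp add: subsets_def)
  have "mor_image i \<phi> \<subseteq> mor_image i (rep q (mor_image i \<phi>))" unfolding rep(2)[OF S] ..
  from mor_factor[OF \<phi> rep(1)[OF S] this] show thesis using that[OF S] by blast
qed

definition normal :: "nat \<Rightarrow> (nat set \<Rightarrow> 'b) \<Rightarrow> (('g mor \<Rightarrow> 'k) \<times> 'b \<Rightarrow> 'k) set" where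
  "normal q t = (\<Oplus>\<^bsub>MT q\<^esub>S\<in>subsets q. bil q (free_gen k (rep q S)) (t S))"

lemma bil_rep_closed: "S \<in> subsets q \<Longrightarrow> t \<in> carrier T \<Longrightarrow> bil q (free_gen k (rep q S)) t \<in> carrier (MT q)"
  by (rule bil_closed[OF X_gen[OF rep(1)]])

lemma normal_submodule: "submodule (normal q ` (subsets q \<rightarrow> carrier T)) k (MT q)"
proof -
  interpret MT: Module.module k "MT q" by (rule MMT)
  interpret T: Module.module k T by (rule MQ)
  have c: "(\<lambda>S. bil q (free_gen k (rep q S)) (t S)) \<in> subsets q \<rightarrow> carrier (MT q)"
    if "t \<in> subsets q \<rightarrow> carrier T" for t
    using that by (auto intro!: bil_rep_closed)
  note h = bil_hom_right[OF X_gen[OF rep(1)]]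
  show ?thesis
  proof (rule submoduleI'[OF MMT])
    show "normal q ` (subsets q \<rightarrow> carrier T) \<subseteq> carrier (MT q)"
      unfolding normal_def using MT.finsum_closed[OF c] by blast
    have "normal q (\<lambda>S. \<zero>\<^bsub>T\<^esub>) = \<zero>\<^bsub>MT q\<^esub>"
      unfolding normal_def by (rule MT.add.finprod_one_eqI) (simp add: mod_hom_zero[OF MQ MMT h])
    then show "\<zero>\<^bsub>MT q\<^esub> \<in> normal q ` (subsets q \<rightarrow> carrier T)"
      by (intro image_eqI[of _ _ "\<lambda>S. \<zero>\<^bsub>T\<^esub>"]) auto
  next
    fix u v assume "u \<in> normal q ` (subsets q \<rightarrow> carrier T)" "v \<in> normal q ` (subsets q \<rightarrow> carrier T)"
    then obtain t s where t: "t \<in> subsets q \<rightarrow> carrier T" "u = normal q t" and s: "s \<in> subsets q \<rightarrow> carrier T" "v = normal q s"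
      by blast
    have "u \<oplus>\<^bsub>MT q\<^esub> v = (\<Oplus>\<^bsub>MT q\<^esub>S\<in>subsets q. bil q (free_gen k (rep q S)) (t S) \<oplus>\<^bsub>MT q\<^esub> bil q (free_gen k (rep q S)) (s S))"
      unfolding t(2) s(2) normal_def by (rule MT.finsum_addf[OF c[OF t(1)] c[OF s(1)], symmetric])
    also have "\<dots> = normal q (\<lambda>S. t S \<oplus>\<^bsub>T\<^esub> s S)"
      unfolding normal_def
    proof (rule MT.finsum_cong'[OF refl])
      show "(\<lambda>S. bil q (free_gen k (rep q S)) (t S \<oplus>\<^bsub>T\<^esub> s S)) \<in> subsets q \<rightarrow> carrier (MT q)"
        by (rule c) (use t(1) s(1) in auto)
      show "bil q (free_gen k (rep q S)) (t S) \<oplus>\<^bsub>MT q\<^esub> bil q (free_gen k (rep q S)) (s S) =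
          bil q (free_gen k (rep q S)) (t S \<oplus>\<^bsub>T\<^esub> s S)" if "S \<in> subsets q" for S
        using mod_hom_add[OF h[OF that], of "t S" "s S"] t(1) s(1) that by auto
    qed
    finally show "u \<oplus>\<^bsub>MT q\<^esub> v \<in> normal q ` (subsets q \<rightarrow> carrier T)"
      by (rule image_eqI[where f = "normal q"]) (use t(1) s(1) in auto)
  next
    fix a u assume a: "a \<in> carrier k" and "u \<in> normal q ` (subsets q \<rightarrow> carrier T)"
    then obtain t where t: "t \<in> subsets q \<rightarrow> carrier T" "u = normal q t" by blast
    have "a \<odot>\<^bsub>MT q\<^esub> u = (\<Oplus>\<^bsub>MT q\<^esub>S\<in>subsets q. a \<odot>\<^bsub>MT q\<^esub> bil q (free_gen k (rep q S)) (t S))"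
      unfolding t(2) normal_def by (rule MT.finsum_smult_ldistr[OF finite_subsets a c[OF t(1)]])
    also have "\<dots> = normal q (\<lambda>S. a \<odot>\<^bsub>T\<^esub> t S)"
      unfolding normal_def
    proof (rule MT.finsum_cong'[OF refl])
      show "(\<lambda>S. bil q (free_gen k (rep q S)) (a \<odot>\<^bsub>T\<^esub> t S)) \<in> subsets q \<rightarrow> carrier (MT q)"
        by (rule c) (use t(1) a in auto)
      show "a \<odot>\<^bsub>MT q\<^esub> bil q (free_gen k (rep q S)) (t S) = bil q (free_gen k (rep q S)) (a \<odot>\<^bsub>T\<^esub> t S)"
        if "S \<in> subsets q" for S
        using mod_hom_smult[OF h[OF that] a, of "t S"] t(1) that by auto
    qed
    finally show "a \<odot>\<^bsub>MT q\<^esub> u \<in> normal q ` (subsets q \<rightarrow> carrier T)"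
      by (rule image_eqI[where f = "normal q"]) (use t(1) a in auto)
  qed
qed

text \<open>Balancing moves the automorphism that separates a morphism from its representative into
  the right factor; bilinearity then leaves one term for each \<open>i\<close>-subset.\<close>

lemma normal_form:
  assumes c: "c \<in> carrier (F q)"
  obtains t where "t \<in> subsets q \<rightarrow> carrier T" "cls q c = normal q t"
proof -
  interpret MT: Module.module k "MT q" by (rule MMT)
  interpret T: Module.module k T by (rule MQ)
  let ?N = "normal q ` (subsets q \<rightarrow> carrier T)"
  have gen: "bil q (free_gen k \<phi>) t \<in> ?N" if \<phi>: "\<phi> \<in> mor G i q" and t: "t \<in> carrier T" for \<phi> t
  proof -
    obtain S \<sigma> where S: "S \<in> subsets q" and \<sigma>: "\<sigma> \<in> mor G i i" and eq: "\<phi> = mor_comp G i (rep q S) \<sigma>"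
      using mor_rep[OF \<phi>] by blast
    have \<sigma>t: "\<rho> \<sigma> t \<in> carrier T" by (rule act_closed[OF Q \<sigma> t])
    let ?t = "\<lambda>S'. if S' = S then \<rho> \<sigma> t else \<zero>\<^bsub>T\<^esub>"
    have "bil q (free_gen k \<phi>) t = bil q (free_gen k (rep q S)) (\<rho> \<sigma> t)"
      unfolding eq mor_right_gen[OF \<sigma> rep(1)[OF S], symmetric] by (rule bil_balanced[OF X_gen[OF rep(1)[OF S]] t \<sigma>])
    also have "\<dots> = (\<Oplus>\<^bsub>MT q\<^esub>S'\<in>subsets q. if S = S' then bil q (free_gen k (rep q S')) (\<rho> \<sigma> t) else \<zero>\<^bsub>MT q\<^esub>)"
      by (rule MT.add.finprod_singleton[OF S finite_subsets, symmetric]) (auto intro!: bil_rep_closed \<sigma>t)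
    also have "\<dots> = normal q ?t"
      unfolding normal_def
    proof (rule MT.finsum_cong'[OF refl])
      show "(\<lambda>S'. bil q (free_gen k (rep q S')) (?t S')) \<in> subsets q \<rightarrow> carrier (MT q)"
        using \<sigma>t by (auto intro!: bil_rep_closed)
      show "(if S = S' then bil q (free_gen k (rep q S')) (\<rho> \<sigma> t) else \<zero>\<^bsub>MT q\<^esub>) = bil q (free_gen k (rep q S')) (?t S')"
        if "S' \<in> subsets q" for S'
        using mod_hom_zero[OF MQ MMT bil_hom_right[OF X_gen[OF rep(1)[OF that]]]] by auto
    qed
    finally show ?thesis by (rule image_eqI[where f = "normal q"]) (use \<sigma>t in auto)
  qed
  have pure: "cls q (pure x t) \<in> ?N" if x: "x \<in> carrier (X q)" and t: "t \<in> carrier T" for x t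
  proof -
    have "carrier (X q) \<subseteq> {x \<in> carrier (X q). bil q x t \<in> ?N}"
      unfolding X_def
    proof (rule mod_free_subset_submodule)
      show "submodule {x \<in> carrier (mod_free k (mor G i q)). bil q x t \<in> ?N} k (mod_free k (mor G i q))"
        using submodule_preimage[OF MX MMT bil_hom_left[OF t] normal_submodule, of q] unfolding X_def .
      show "free_gen k \<phi> \<in> {x \<in> carrier (mod_free k (mor G i q)). bil q x t \<in> ?N}" if "\<phi> \<in> mor G i q" for \<phi>
        using gen[OF that t] free_gen_closed[OF that] by simp
    qed
    then show ?thesis using x unfolding bil_def by blast
  qed
  have "carrier (F q) \<subseteq> {c \<in> carrier (F q). cls q c \<in> ?N}"
    unfolding F_def
  proof (rule mod_free_subset_submodule)
    show "submodule {c \<in> carrier (mod_free k (carrier (X q) \<times> carrier T)). cls q c \<in> ?N} k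
        (mod_free k (carrier (X q) \<times> carrier T))"
      using submodule_preimage[OF MF MMT cls_hom normal_submodule, of q] unfolding F_def .
    show "free_gen k b \<in> {c \<in> carrier (mod_free k (carrier (X q) \<times> carrier T)). cls q c \<in> ?N}"
      if b: "b \<in> carrier (X q) \<times> carrier T" for b
    proof -
      obtain x t where xt: "b = (x, t)" "x \<in> carrier (X q)" "t \<in> carrier T" using b by blast
      show ?thesis using pure[OF xt(2,3)] free_gen_closed[OF b] by (simp add: xt(1) pure_def)
    qed
  qed
  then show ?thesis using c that by blast
qed

lemma eps_act:
  assumes \<psi>: "\<psi> \<in> mor G q q'"
  defines "f \<equiv> free_map k (\<lambda>(x, t). (free_map k (mor_comp G i \<psi>) x, t))"
  shows "f \<in> mod_hom k (F q) (F q')" and "\<And>c. c \<in> carrier (F q) \<Longrightarrow> eps q' (f c) = act Q q q' \<psi> (eps q c)"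
proof -
  have inj1: "inj_on (mor_comp G i \<psi>) (mor G i q)"
    by (rule inj_onI) (rule mor_left_cancel[OF \<psi>])
  have sub1: "mor_comp G i \<psi> ` mor G i q \<subseteq> mor G i q'" using mor_comp_closed[OF \<psi>] by blast
  have h1: "free_map k (mor_comp G i \<psi>) \<in> mod_hom k (X q) (X q')"
    unfolding X_def by (rule free_map_hom[OF inj1 sub1])
  \<comment> \<open>The action on pairs has a \<open>free_map\<close> in its first component, so
    injectivity has to be lifted from morphisms to their linear combinations before the outer
    \<open>free_map\<close> can be computed.\<close>
  have inj_fm: "inj_on (free_map k (mor_comp G i \<psi>)) (carrier (X q))"
  proof (rule inj_onI)
    fix c d assume c: "c \<in> carrier (X q)" and d: "d \<in> carrier (X q)"
      and eq: "free_map k (mor_comp G i \<psi>) c = free_map k (mor_comp G i \<psi>) d"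
    show "c = d"
    proof
      fix \<phi> show "c \<phi> = d \<phi>"
      proof (cases "\<phi> \<in> mor G i q")
        case True
        then show ?thesis
          using free_map_image[OF inj1 c[unfolded X_def] True] free_map_image[OF inj1 d[unfolded X_def] True] eq by simp
      next
        case False
        then have "c \<phi> = \<zero>\<^bsub>k\<^esub>" "d \<phi> = \<zero>\<^bsub>k\<^esub>" using c d by (auto simp: X_def mod_free_iff)
        then show ?thesis by simp
      qed
    qed
  qed
  let ?g = "\<lambda>(x, t). (free_map k (mor_comp G i \<psi>) x, t)"
  have inj2: "inj_on ?g (carrier (X q) \<times> carrier T)"
    using inj_fm by (auto simp: inj_on_def)
  have sub2: "?g ` (carrier (X q) \<times> carrier T) \<subseteq> carrier (X q') \<times> carrier T"
    using mod_hom_closed[OF h1] by auto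
  show h2: "f \<in> mod_hom k (F q) (F q')"
    unfolding f_def F_def by (rule free_map_hom[OF inj2 sub2])
  fix c assume c: "c \<in> carrier (F q)"
  show "eps q' (f c) = act Q q q' \<psi> (eps q c)"
  proof (rule F_hom_eq[OF MQ mod_hom_comp[OF h2 eps_hom] mod_hom_comp[OF eps_hom cmodule_act[OF Q \<psi>]] _ c])
    fix x t assume x: "x \<in> carrier (X q)" and t: "t \<in> carrier T"
    have "f (pure x t) = pure (free_map k (mor_comp G i \<psi>) x) t"
      unfolding f_def pure_def using free_map_gen[OF inj2, of "(x, t)"] x t by simp
    moreover have "ev q' (free_map k (mor_comp G i \<psi>) x) t = act Q q q' \<psi> (ev q x t)"
    proof (rule X_hom_eq[OF MQ mod_hom_comp[OF h1 ev_hom[OF t]] mod_hom_comp[OF ev_hom[OF t] cmodule_act[OF Q \<psi>]] _ x])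
      fix \<phi> assume \<phi>: "\<phi> \<in> mor G i q"
      show "ev q' (free_map k (mor_comp G i \<psi>) (free_gen k \<phi>)) t = act Q q q' \<psi> (ev q (free_gen k \<phi>) t)"
        unfolding free_map_gen[OF inj1 \<phi>] ev_gen[OF mor_comp_closed[OF \<psi> \<phi>] t] ev_gen[OF \<phi> t]
        by (rule cmodule_comp[OF Q \<phi> \<psi> t])
    qed
    ultimately show "eps q' (f (pure x t)) = act Q q q' \<psi> (eps q (pure x t))"
      by (simp add: eps_pure x t mod_hom_closed[OF h1 x])
  qed
qed

text \<open>The relations lie in the kernel of \<open>eps\<close> by bilinearity. Conversely an
  element of the kernel is brought to normal form, whose coefficients vanish by the independence
  hypothesis, so the kernel is exactly \<open>R\<close>; generation in degree \<open>i\<close> gives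
  surjectivity.\<close>

theorem iso_induced:
  assumes gen: "\<And>q. full Q q \<subseteq> mod_span k (obj Q q) (\<Union>\<beta>\<in>mor G i q. act Q i q \<beta> ` carrier T)"
    and inj: "\<And>q t. t \<in> subsets q \<rightarrow> carrier T \<Longrightarrow>
      (\<Oplus>\<^bsub>obj Q q\<^esub>S\<in>subsets q. act Q i q (rep q S) (t S)) = \<zero>\<^bsub>obj Q q\<^esub> \<Longrightarrow> \<forall>S\<in>subsets q. t S = \<zero>\<^bsub>T\<^esub>"
  shows "cmod_iso G k Q (induced G k i T \<rho>)"
proof -
  have ker: "c \<in> R q" if c: "c \<in> carrier (F q)" and c0: "eps q c = \<zero>\<^bsub>obj Q q\<^esub>" for c q
  proof -
    interpret F: Module.module k "F q" by (rule MF)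
    interpret MT: Module.module k "MT q" by (rule MMT)
    interpret Qq: Module.module k "obj Q q" by (rule MQ)
    obtain t where t: "t \<in> subsets q \<rightarrow> carrier T" "cls q c = normal q t" by (rule normal_form[OF c])
    define s where "s = (\<Oplus>\<^bsub>F q\<^esub>S\<in>subsets q. pure (free_gen k (rep q S)) (t S))"
    have p: "pure (free_gen k (rep q S)) (t S) \<in> carrier (F q)" if "S \<in> subsets q" for S
      by (rule pure_closed[OF X_gen[OF rep(1)[OF that]]]) (use t(1) that in auto)
    have s: "s \<in> carrier (F q)" unfolding s_def by (rule F.finsum_closed) (use p in auto)
    have "cls q s = normal q t"
      unfolding s_def normal_def bil_def by (rule mod_hom_finsum[OF MF MMT cls_hom p])
    then have d: "c \<ominus>\<^bsub>F q\<^esub> s \<in> R q" using cls_eq_iff[OF c s] t(2) by simp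
    then have "eps q (c \<ominus>\<^bsub>F q\<^esub> s) = \<zero>\<^bsub>obj Q q\<^esub>" using R_ker by blast
    then have "eps q s = \<zero>\<^bsub>obj Q q\<^esub>"
      using c0 mod_hom_closed[OF eps_hom s] unfolding mod_hom_minus[OF MF MQ eps_hom c s]
      by (metis Qq.add.inv_closed Qq.l_zero Qq.minus_eq Qq.minus_minus Qq.minus_equality Qq.zero_closed)
    moreover have "eps q s = (\<Oplus>\<^bsub>obj Q q\<^esub>S\<in>subsets q. eps q (pure (free_gen k (rep q S)) (t S)))"
      unfolding s_def by (rule mod_hom_finsum[OF MF MQ eps_hom p])
    moreover have "(\<Oplus>\<^bsub>obj Q q\<^esub>S\<in>subsets q. eps q (pure (free_gen k (rep q S)) (t S))) =
        (\<Oplus>\<^bsub>obj Q q\<^esub>S\<in>subsets q. act Q i q (rep q S) (t S))"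
    proof (rule Qq.finsum_cong'[OF refl])
      show "(\<lambda>S. act Q i q (rep q S) (t S)) \<in> subsets q \<rightarrow> carrier (obj Q q)"
        using act_closed[OF Q rep(1)] t(1) by blast
      show "eps q (pure (free_gen k (rep q S)) (t S)) = act Q i q (rep q S) (t S)" if "S \<in> subsets q" for S
        using eps_pure[OF X_gen[OF rep(1)[OF that]], of "t S"] ev_gen[OF rep(1)[OF that], of "t S"] t(1) that by auto
    qed
    ultimately have t0: "\<forall>S\<in>subsets q. t S = \<zero>\<^bsub>T\<^esub>" using inj[OF t(1)] by simp
    have "normal q t = \<zero>\<^bsub>MT q\<^esub>"
      unfolding normal_def
      by (rule MT.add.finprod_one_eqI)
        (simp add: t0 mod_hom_zero[OF MQ MMT bil_hom_right[OF X_gen[OF rep(1)]]])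
    then have "cls q c = cls q \<zero>\<^bsub>F q\<^esub>" using t(2) mod_hom_zero[OF MF MMT cls_hom] by simp
    then have "c \<ominus>\<^bsub>F q\<^esub> \<zero>\<^bsub>F q\<^esub> \<in> R q" using cls_eq_iff[OF c F.zero_closed] by simp
    then show ?thesis
      using c by (simp add: F.minus_eq F.minus_equality[OF F.l_zero[OF F.zero_closed] F.zero_closed F.zero_closed])
  qed
  have eps_eq: "eps q c = eps q d \<longleftrightarrow> cls q c = cls q d" if c: "c \<in> carrier (F q)" and d: "d \<in> carrier (F q)" for q c d
  proof -
    interpret F: Module.module k "F q" by (rule MF)
    interpret Qq: Module.module k "obj Q q" by (rule MQ)
    have "eps q c = eps q d \<longleftrightarrow> eps q (c \<ominus>\<^bsub>F q\<^esub> d) = \<zero>\<^bsub>obj Q q\<^esub>"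
      unfolding mod_hom_minus[OF MF MQ eps_hom c d]
      using module_minus_eq_zero_iff[OF MQ mod_hom_closed[OF eps_hom c] mod_hom_closed[OF eps_hom d]] by simp
    also have "\<dots> \<longleftrightarrow> c \<ominus>\<^bsub>F q\<^esub> d \<in> R q" using ker R_ker c d F.minus_closed by blast
    finally show ?thesis using cls_eq_iff[OF c d] by simp
  qed
  have surj: "\<exists>c\<in>carrier (F q). eps q c = v" if v: "v \<in> full Q q" for q v
  proof -
    have "mod_span k (obj Q q) (\<Union>\<beta>\<in>mor G i q. act Q i q \<beta> ` carrier T) \<subseteq> eps q ` carrier (F q)"
    proof (rule mod_span_least[OF submodule_image[OF MF MQ eps_hom]], rule subsetI)
      fix w assume "w \<in> (\<Union>\<beta>\<in>mor G i q. act Q i q \<beta> ` carrier T)"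
      then obtain \<beta> t where \<beta>: "\<beta> \<in> mor G i q" and t: "t \<in> carrier T" and w: "w = act Q i q \<beta> t" by blast
      have "w = eps q (pure (free_gen k \<beta>) t)" by (simp add: w eps_pure[OF X_gen[OF \<beta>] t] ev_gen[OF \<beta> t])
      then show "w \<in> eps q ` carrier (F q)" by (rule image_eqI[where f = "eps q"]) (rule pure_closed[OF X_gen[OF \<beta>] t])
    qed
    then show ?thesis using gen[of q] v by blast
  qed
  \<comment> \<open>The inverse of the map induced by \<open>eps\<close>; the choice is harmless
    because equal values of \<open>eps\<close> mean equal classes.\<close>
  define \<eta> where "\<eta> q v = cls q (SOME c. c \<in> carrier (F q) \<and> eps q c = v)" for q v
  have \<eta>: "\<eta> q (eps q c) = cls q c" if c: "c \<in> carrier (F q)" for q c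
  proof -
    have "\<exists>d. d \<in> carrier (F q) \<and> eps q d = eps q c" using c by blast
    from someI_ex[OF this] show ?thesis unfolding \<eta>_def using eps_eq[OF _ c] by blast
  qed
  show ?thesis
    unfolding cmod_iso_def MT_obj
  proof (intro exI[of _ \<eta>] conjI allI ballI)
    fix q
    interpret F: Module.module k "F q" by (rule MF)
    show "\<eta> q \<in> mod_hom k (obj Q q) (MT q)"
    proof (rule mod_homI)
      fix v assume "v \<in> full Q q"
      then obtain c where c: "c \<in> carrier (F q)" "v = eps q c" using surj by blast
      show "\<eta> q v \<in> carrier (MT q)" unfolding c(2) \<eta>[OF c(1)] by (rule mod_hom_closed[OF cls_hom c(1)])
      show "\<eta> q (a \<odot>\<^bsub>obj Q q\<^esub> v) = a \<odot>\<^bsub>MT q\<^esub> \<eta> q v" if a: "a \<in> carrier k" for a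
        unfolding c(2) mod_hom_smult[OF eps_hom a c(1), symmetric] \<eta>[OF c(1)] \<eta>[OF F.smult_closed[OF a c(1)]]
        by (rule mod_hom_smult[OF cls_hom a c(1)])
      fix w assume "w \<in> full Q q"
      then obtain d where d: "d \<in> carrier (F q)" "w = eps q d" using surj by blast
      show "\<eta> q (v \<oplus>\<^bsub>obj Q q\<^esub> w) = \<eta> q v \<oplus>\<^bsub>MT q\<^esub> \<eta> q w"
        unfolding c(2) d(2) mod_hom_add[OF eps_hom c(1) d(1), symmetric] \<eta>[OF c(1)] \<eta>[OF d(1)]
          \<eta>[OF F.add.m_closed[OF c(1) d(1)]]
        by (rule mod_hom_add[OF cls_hom c(1) d(1)])
    qed
    show "bij_betw (\<eta> q) (full Q q) (carrier (MT q))"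
      unfolding bij_betw_def
    proof
      show "inj_on (\<eta> q) (full Q q)"
      proof (rule inj_onI)
        fix v w assume "v \<in> full Q q" "w \<in> full Q q" and eq: "\<eta> q v = \<eta> q w"
        then obtain c d where "c \<in> carrier (F q)" "v = eps q c" "d \<in> carrier (F q)" "w = eps q d" using surj by metis
        then show "v = w" using eq eps_eq \<eta> by simp
      qed
      have "eps q ` carrier (F q) = full Q q" using surj mod_hom_closed[OF eps_hom] by blast
      then have "\<eta> q ` full Q q = (\<lambda>c. \<eta> q (eps q c)) ` carrier (F q)" by (metis image_image)
      also have "\<dots> = cls q ` carrier (F q)" by (rule image_cong[OF refl \<eta>])
      finally show "\<eta> q ` full Q q = carrier (MT q)" by (simp add: MT_carrier)
    qed
  next
    fix q q' \<psi> v assume \<psi>: "\<psi> \<in> mor G q q'" and "v \<in> full Q q"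
    then obtain c where c: "c \<in> carrier (F q)" "v = eps q c" using surj by blast
    let ?f = "free_map k (\<lambda>(x, t). (free_map k (mor_comp G i \<psi>) x, t))"
    note f = eps_act[OF \<psi>]
    \<comment> \<open>Stability of the relations under the action follows from their description as
      a kernel, since \<open>eps\<close> commutes with the action.\<close>
    have fR: "?f ` R q \<subseteq> R q'"
    proof (rule image_subsetI)
      fix r assume "r \<in> R q"
      then have r: "r \<in> carrier (F q)" "eps q r = \<zero>\<^bsub>obj Q q\<^esub>" using R_ker by blast+
      show "?f r \<in> R q'"
        by (rule ker[OF mod_hom_closed[OF f(1) r(1)]]) (simp only: f(2)[OF r(1)] r(2) act_zero[OF Q \<psi>])
    qed
    have "act (induced G k i T \<rho>) q q' \<psi> = coset_map (F q') (R q') ?f"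
      by (simp add: induced_def F_def R_def X_def)
    then have "act (induced G k i T \<rho>) q q' \<psi> (cls q c) = cls q' (?f c)"
      unfolding cls_def using coset_map_coset[OF MF R_submodule MF R_submodule f(1) fR c(1)] by simp
    then show "\<eta> q' (act Q q q' \<psi> v) = act (induced G k i T \<rho>) q q' \<psi> (\<eta> q v)"
      unfolding c(2) \<eta>[OF c(1)] f(2)[OF c(1), symmetric] \<eta>[OF mod_hom_closed[OF f(1) c(1)]] by simp
  qed
qed

end

section \<open>The filtration by generation degree\<close>

context FIG
begin

text \<open>Only degrees strictly below \<open>i\<close> are allowed, so that the chain starts with
  the zero submodule and \<open>low W i i\<close> is the decomposable part in degree
  \<open>i\<close>.\<close>

definition low :: "('k, 'g, 'a) cmod \<Rightarrow> nat \<Rightarrow> nat \<Rightarrow> 'a set" where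
  "low W i q = mod_span k (obj W q) (\<Union>j\<in>{..<i}. \<Union>\<beta>\<in>mor G j q. act W j q \<beta> ` full W j)"

lemma low_gens: "cmodule G k W \<Longrightarrow> (\<Union>j\<in>{..<i}. \<Union>\<beta>\<in>mor G j q. act W j q \<beta> ` full W j) \<subseteq> full W q"
  using act_closed[of W _ _ q] by blast

lemma low_submodule: "cmodule G k W \<Longrightarrow> submodule (low W i q) k (obj W q)"
  unfolding low_def by (rule mod_span_submodule[OF cmodule_module low_gens])

lemma act_in_low: "j < i \<Longrightarrow> \<beta> \<in> mor G j q \<Longrightarrow> y \<in> full W j \<Longrightarrow> act W j q \<beta> y \<in> low W i q"
  unfolding low_def by (rule subsetD[OF mod_span_superset]) blast

lemma low_least:
  assumes "submodule N k (obj W q)"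
    and "\<And>j \<beta> y. j < i \<Longrightarrow> \<beta> \<in> mor G j q \<Longrightarrow> y \<in> full W j \<Longrightarrow> act W j q \<beta> y \<in> N"
  shows "low W i q \<subseteq> N"
  unfolding low_def
proof (rule mod_span_least[OF assms(1)], rule subsetI)
  fix x assume "x \<in> (\<Union>j\<in>{..<i}. \<Union>\<beta>\<in>mor G j q. act W j q \<beta> ` full W j)"
  then obtain j \<beta> y where "j < i" "\<beta> \<in> mor G j q" "y \<in> full W j" "x = act W j q \<beta> y" by blast
  then show "x \<in> N" using assms(2) by blast
qed

lemma low_csubmodule:
  assumes W: "cmodule G k W"
  shows "csubmodule G k W (low W i)"
  unfolding csubmodule_def
proof (intro conjI allI ballI low_submodule[OF W])
  fix m n \<phi> assume \<phi>: "\<phi> \<in> mor G m n"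
  have "low W i m \<subseteq> {v \<in> full W m. act W m n \<phi> v \<in> low W i n}"
  proof (rule low_least[OF submodule_preimage[OF cmodule_module[OF W] cmodule_module[OF W] cmodule_act[OF W \<phi>]
        low_submodule[OF W]]])
    fix j \<beta> y assume j: "j < i" and \<beta>: "\<beta> \<in> mor G j m" and y: "y \<in> full W j"
    show "act W j m \<beta> y \<in> {v \<in> full W m. act W m n \<phi> v \<in> low W i n}"
      using act_in_low[OF j mor_comp_closed[OF \<phi> \<beta>] y] act_closed[OF W \<beta> y] by (simp add: cmodule_comp[OF W \<beta> \<phi> y])
  qed
  then show "act W m n \<phi> ` low W i m \<subseteq> low W i n" by blast
qed

lemma low_mono: "cmodule G k W \<Longrightarrow> low W i q \<subseteq> low W (Suc i) q"
  by (rule low_least[OF low_submodule]) (auto intro: act_in_low)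

lemma full_in_low: "q < i \<Longrightarrow> full W q \<subseteq> low W i q" if W: "cmodule G k W"
proof
  fix v assume "q < i" "v \<in> full W q"
  then show "v \<in> low W i q" using act_in_low[OF _ mor_id_closed] cmodule_id[OF W] by metis
qed

lemma low_0: "cmodule G k W \<Longrightarrow> low W 0 q = {\<zero>\<^bsub>obj W q\<^esub>}"
proof
  assume W: "cmodule G k W"
  show "low W 0 q \<subseteq> {\<zero>\<^bsub>obj W q\<^esub>}"
    by (rule low_least[OF submodule_trivial[OF cmodule_module[OF W]]]) simp
  show "{\<zero>\<^bsub>obj W q\<^esub>} \<subseteq> low W 0 q" using submodule_zero[OF low_submodule[OF W]] by blast
qed

text \<open>A morphism from fewer than \<open>i\<close> points cannot have a set of at least
  \<open>i\<close> points in its image.\<close>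

lemma low_deficient:
  assumes W: "cmodule G k W" and S: "S \<subseteq> {1..q}" "i \<le> card S"
  shows "low W i q \<subseteq> deficient G k W S q"
proof (rule low_least[OF deficient_submodule[OF W]])
  fix j \<beta> y assume j: "j < i" and \<beta>: "\<beta> \<in> mor G j q" and y: "y \<in> full W j"
  have "\<not> S \<subseteq> mor_image j \<beta>"
  proof
    assume "S \<subseteq> mor_image j \<beta>"
    then have "card S \<le> card (mor_image j \<beta>)" by (rule card_mono[rotated]) simp
    then show False using card_image[OF mor_inj[OF \<beta>]] j S(2) by simp
  qed
  then show "act W j q \<beta> y \<in> deficient G k W S q" using act_in_deficient[OF \<beta> _ y] by blast
qed

lemma deficient_full_low:
  assumes W: "cmodule G k W"
  shows "deficient G k W {1..q} q \<subseteq> low W q q"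
proof (rule deficient_least[OF low_submodule[OF W]])
  fix j \<beta> y assume \<beta>: "\<beta> \<in> mor G j q" and miss: "\<not> {1..q} \<subseteq> mor_image j \<beta>" and y: "y \<in> full W j"
  have "j < q" using miss mor_le[OF \<beta>] mor_image_full_iff[OF \<beta>] by simp
  then show "act W j q \<beta> y \<in> low W q q" by (rule act_in_low[OF _ \<beta> y])
qed

text \<open>For \<open>q \<ge> D\<close> the derivative along all points of \<open>[q]\<close>
  vanishes, so degree \<open>q\<close> is spanned by images from smaller degrees; induction on
  \<open>q\<close> brings these below \<open>D\<close>.\<close>

lemma low_full:
  assumes W: "cmodule G k W" and deg: "degree_less D W"
  shows "low W D q = full W q"
proof
  show "low W D q \<subseteq> full W q" by (rule submodule_subset[OF low_submodule[OF W]])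
  show "full W q \<subseteq> low W D q"
  proof (induct q rule: less_induct)
    case (less q)
    show ?case
    proof (cases "q < D")
      case False
      then have "full W q \<subseteq> deficient G k W {1..q} q" using deg unfolding degree_less_def by simp
      also have "\<dots> \<subseteq> low W q q" by (rule deficient_full_low[OF W])
      also have "\<dots> \<subseteq> low W D q"
      proof (rule low_least[OF low_submodule[OF W]])
        fix j \<beta> y assume j: "j < q" and \<beta>: "\<beta> \<in> mor G j q" and y: "y \<in> full W j"
        show "act W j q \<beta> y \<in> low W D q" using csubmodule_act[OF low_csubmodule[OF W] \<beta>] less[OF j] y by blast
      qed
      finally show ?thesis .
    qed (rule full_in_low[OF W])
  qed
qed

text \<open>Modulo \<open>deficient G k W S q\<close> every summand except the one indexed by \<open>S\<close> vanishes.\<close>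

lemma summands_low:
  assumes W: "cmodule G k W" and inj: "injective_from 0 W"
    and J: "finite J" "\<And>S. S \<in> J \<Longrightarrow> S \<subseteq> {1..q} \<and> card S = i"
    and r: "\<And>S. S \<in> J \<Longrightarrow> r S \<in> mor G i q \<and> mor_image i (r S) = S"
    and v: "\<And>S. S \<in> J \<Longrightarrow> v S \<in> full W i"
    and sum: "(\<Oplus>\<^bsub>obj W q\<^esub>S\<in>J. act W i q (r S) (v S)) \<in> low W i q" and S: "S \<in> J"
  shows "v S \<in> low W i i"
proof -
  interpret Wq: Module.module k "obj W q" by (rule cmodule_module[OF W])
  let ?N = "deficient G k W S q" and ?a = "\<lambda>S. act W i q (r S) (v S)"
  have a: "?a S \<in> full W q" if "S \<in> J" for S using act_closed[OF W] r v that by blast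
  \<comment> \<open>Distinct sets of equal size: some point of \<open>S\<close> is missed by the
    representative with image \<open>S'\<close>.\<close>
  have other: "?a S' \<in> ?N" if S': "S' \<in> J - {S}" for S'
  proof -
    have "\<not> S \<subseteq> S'"
    proof
      assume "S \<subseteq> S'"
      moreover have "finite S'" using J(2)[of S'] S' finite_subset by blast
      ultimately have "S = S'" using J(2)[OF S] J(2)[of S'] S' card_subset_eq by (metis DiffD1)
      then show False using S' by blast
    qed
    then show ?thesis using act_in_deficient[of "r S'" i q S "v S'"] r[of S'] v[of S'] S' by simp
  qed
  have rest: "(\<Oplus>\<^bsub>obj W q\<^esub>S'\<in>J - {S}. ?a S') \<in> ?N"
    by (rule submodule_finsum[OF cmodule_module[OF W] deficient_submodule[OF W] other])
  have "J = insert S (J - {S})" using S by blast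
  then have "(\<Oplus>\<^bsub>obj W q\<^esub>S'\<in>J. ?a S') = ?a S \<oplus>\<^bsub>obj W q\<^esub> (\<Oplus>\<^bsub>obj W q\<^esub>S'\<in>J - {S}. ?a S')"
    using Wq.finsum_insert[of "J - {S}" S ?a] a J(1) S by simp
  moreover have "(\<Oplus>\<^bsub>obj W q\<^esub>S'\<in>J. ?a S') \<in> ?N"
    using low_deficient[OF W, of S q i] J(2)[OF S] sum by auto
  moreover have "(\<Oplus>\<^bsub>obj W q\<^esub>S'\<in>J - {S}. ?a S') \<in> full W q" using rest deficient_subset[OF W] by blast
  ultimately have "?a S = (\<Oplus>\<^bsub>obj W q\<^esub>S'\<in>J. ?a S') \<ominus>\<^bsub>obj W q\<^esub> (\<Oplus>\<^bsub>obj W q\<^esub>S'\<in>J - {S}. ?a S')"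
    using a[OF S] by (simp add: Wq.minus_eq Wq.a_assoc Wq.r_neg)
  then have "?a S \<in> ?N"
    using submodule_minus[OF deficient_submodule[OF W] \<open>(\<Oplus>\<^bsub>obj W q\<^esub>S'\<in>J. ?a S') \<in> ?N\<close> rest] by simp
  moreover have "fst (r S) ` {1..i} = S" using r[OF S] by simp
  \<comment> \<open>Injectivity is used in level 0 of the derivative along all \<open>i\<close>
    points, where \<open>card {1..i} + N \<le> i\<close> forces \<open>N = 0\<close>. For this
    reason the module must first be shifted until its bound is 0.\<close>
  ultimately have "v S \<in> deficient G k W {1..i} i"
    using inj r[OF S] v[OF S] unfolding injective_from_def by simp
  then show ?thesis using deficient_full_low[OF W] by blast
qed

text \<open>Generators of degree below \<open>i\<close> vanish in the layer, so it is generated in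
  degree \<open>i\<close>; a vanishing sum over \<open>i\<close>-subsets lifts to a sum in
  \<open>low W i q\<close>, and \<open>summands_low\<close> makes each coefficient trivial. These
  are the two hypotheses of \<open>iso_induced\<close>.\<close>

lemma filtration_quotient:
  fixes W :: "('k, 'g, 'a) cmod" and i :: nat
  assumes W: "cmodule G k W" and inj: "injective_from 0 W"
  defines "U \<equiv> cmod_restrict W (low W (Suc i))"
  defines "Q \<equiv> cmod_quot U (low W i)"
  shows "group_rep G k i (obj Q i) (act Q i i)" "cmod_iso G k Q (induced G k i (obj Q i) (act Q i i))"
proof -
  have U: "cmodule G k U" unfolding U_def by (rule cmod_restrict_cmodule[OF W low_csubmodule[OF W]])
  have Uobj: "obj U n = (obj W n)\<lparr>carrier := low W (Suc i) n\<rparr>" and Uact: "act U = act W" for n by (simp_all add: U_def)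
  have L: "csubmodule G k U (low W i)"
    unfolding csubmodule_def Uact
  proof (intro conjI allI ballI)
    fix n show "submodule (low W i n) k (obj U n)"
      by (rule submoduleI'[OF cmodule_module[OF U]])
        (use low_mono[OF W] submodule_zero[OF low_submodule[OF W, of i n]] submodule_add[OF low_submodule[OF W, of i n]]
          submodule_smult[OF low_submodule[OF W, of i n]] in \<open>simp_all add: Uobj\<close>)
  qed (use csubmodule_act[OF low_csubmodule[OF W]] in blast)
  have Q: "cmodule G k Q" and \<pi>: "cmod_hom G k U Q (\<lambda>n x. low W i n +>\<^bsub>obj U n\<^esub> x)"
    unfolding Q_def by (rule cmod_quot_cmodule[OF U L])+
  define \<pi> where "\<pi> n x = low W i n +>\<^bsub>obj U n\<^esub> x" for n x
  have \<pi>: "cmod_hom G k U Q \<pi>" using \<pi> by (simp add: \<pi>_def[abs_def])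
  interpret induction_data G k Q i using Q by unfold_locales
  have Qfull: "full Q n = \<pi> n ` low W (Suc i) n" for n
    by (simp add: Q_def a_rcosets_image Uobj \<pi>_def[abs_def])
  have \<pi>0: "\<pi> n x = \<zero>\<^bsub>obj Q n\<^esub> \<longleftrightarrow> x \<in> low W i n" if x: "x \<in> low W (Suc i) n" for n x
  proof -
    have xc: "x \<in> full U n" using x by (simp add: Uobj)
    have z: "\<zero>\<^bsub>obj Q n\<^esub> = low W i n" by (simp add: Q_def)
    show ?thesis
      unfolding z \<pi>_def
      using abelian_group_cosets(1,3)[OF cmodule_module[OF U] csubmodule_submodule[OF L], of x n] xc by blast
  qed
  note \<pi>h = cmod_hom_mod_hom[OF \<pi>]
  show "group_rep G k i (obj Q i) (act Q i i)" by (rule group_rep)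
  show "cmod_iso G k Q (induced G k i (obj Q i) (act Q i i))"
  proof (rule iso_induced)
    fix q
    let ?G = "\<Union>\<beta>\<in>mor G i q. act Q i q \<beta> ` full Q i"
    have gs: "?G \<subseteq> full Q q" using act_closed[OF Q, of _ i q] by blast
    note S = mod_span_submodule[OF cmodule_module[OF Q] gs]
    have incl: "submodule {u \<in> full U q. \<pi> q u \<in> mod_span k (obj Q q) ?G} k (obj U q)"
      by (rule submodule_preimage[OF cmodule_module[OF U] cmodule_module[OF Q] \<pi>h S])
    have "low W (Suc i) q \<subseteq> {u \<in> full U q. \<pi> q u \<in> mod_span k (obj Q q) ?G}"
    proof (rule low_least)
      show "submodule {u \<in> full U q. \<pi> q u \<in> mod_span k (obj Q q) ?G} k (obj W q)"
      proof (rule submoduleI'[OF cmodule_module[OF W]])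
        show "{u \<in> full U q. \<pi> q u \<in> mod_span k (obj Q q) ?G} \<subseteq> full W q"
          using submodule_subset[OF low_submodule[OF W, of "Suc i" q]] by (auto simp: Uobj)
      qed (use submodule_zero[OF incl] submodule_add[OF incl] submodule_smult[OF incl] in \<open>simp_all add: Uobj\<close>)
      fix j \<beta> y assume j: "j < Suc i" and \<beta>: "\<beta> \<in> mor G j q" and y: "y \<in> full W j"
      have in_low: "act W j q \<beta> y \<in> low W (Suc i) q" by (rule act_in_low[OF j \<beta> y])
      show "act W j q \<beta> y \<in> {u \<in> full U q. \<pi> q u \<in> mod_span k (obj Q q) ?G}"
      proof (cases "j = i")
        case True
        have y': "y \<in> full U j" using full_in_low[OF W j] y by (auto simp: Uobj)
        have "\<pi> q (act W j q \<beta> y) = act Q j q \<beta> (\<pi> j y)"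
          using cmod_hom_act[OF \<pi> \<beta> y'] by (simp add: Uact)
        moreover have "\<pi> j y \<in> full Q j" by (rule mod_hom_closed[OF \<pi>h y'])
        ultimately have "\<pi> q (act W j q \<beta> y) \<in> ?G" using \<beta> unfolding True by blast
        then have "\<pi> q (act W j q \<beta> y) \<in> mod_span k (obj Q q) ?G" by (rule subsetD[OF mod_span_superset])
        then show ?thesis using in_low by (simp add: Uobj)
      next
        case False
        then have "act W j q \<beta> y \<in> low W i q" using act_in_low[OF _ \<beta> y] j by simp
        then have "\<pi> q (act W j q \<beta> y) = \<zero>\<^bsub>obj Q q\<^esub>" using \<pi>0[OF in_low] by simp
        then show ?thesis using in_low submodule_zero[OF S] by (simp add: Uobj)
      qed
    qed
    then show "full Q q \<subseteq> mod_span k (obj Q q) ?G" unfolding Qfull[of q] by blast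
  next
    fix q t assume t: "t \<in> subsets q \<rightarrow> full Q i"
      and sum: "(\<Oplus>\<^bsub>obj Q q\<^esub>S\<in>subsets q. act Q i q (rep q S) (t S)) = \<zero>\<^bsub>obj Q q\<^esub>"
    have "\<exists>v. v \<in> low W (Suc i) i \<and> \<pi> i v = t S" if "S \<in> subsets q" for S
      using t that unfolding Qfull by fastforce
    then obtain v where v: "\<And>S. S \<in> subsets q \<Longrightarrow> v S \<in> low W (Suc i) i" "\<And>S. S \<in> subsets q \<Longrightarrow> \<pi> i (v S) = t S"
      by metis
    have vU: "v S \<in> full U i" if "S \<in> subsets q" for S using v(1)[OF that] by (simp add: Uobj)
    have vW: "v S \<in> full W i" if "S \<in> subsets q" for S
      using v(1)[OF that] submodule_subset[OF low_submodule[OF W]] by blast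
    let ?a = "\<lambda>S. act W i q (rep q S) (v S)"
    have aU: "?a S \<in> full U q" if "S \<in> subsets q" for S
      using act_closed[OF U rep(1)[OF that] vU[OF that]] by (simp add: Uact)
    have "\<pi> q (\<Oplus>\<^bsub>obj U q\<^esub>S\<in>subsets q. ?a S) = (\<Oplus>\<^bsub>obj Q q\<^esub>S\<in>subsets q. \<pi> q (?a S))"
      by (rule mod_hom_finsum[OF cmodule_module[OF U] cmodule_module[OF Q] \<pi>h aU])
    also have "\<dots> = (\<Oplus>\<^bsub>obj Q q\<^esub>S\<in>subsets q. act Q i q (rep q S) (t S))"
    proof (rule abelian_monoid.finsum_cong'[OF abelian_group.axioms(1)[OF cmodule_abelian[OF Q]] refl])
      show "(\<lambda>S. act Q i q (rep q S) (t S)) \<in> subsets q \<rightarrow> full Q q"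
        using act_closed[OF Q rep(1)] t by blast
      show "\<pi> q (?a S) = act Q i q (rep q S) (t S)" if "S \<in> subsets q" for S
        using cmod_hom_act[OF \<pi> rep(1)[OF that] vU[OF that]] v(2)[OF that] by (simp add: Uact)
    qed
    finally have 1: "\<pi> q (\<Oplus>\<^bsub>obj U q\<^esub>S\<in>subsets q. ?a S) = \<zero>\<^bsub>obj Q q\<^esub>" using sum by simp
    have "(\<Oplus>\<^bsub>obj U q\<^esub>S\<in>subsets q. ?a S) \<in> full U q"
      by (rule submodule_finsum[OF cmodule_module[OF U] submodule_carrier[OF cmodule_module[OF U]] aU])
    then have "(\<Oplus>\<^bsub>obj U q\<^esub>S\<in>subsets q. ?a S) \<in> low W i q" using 1 \<pi>0 by (simp add: Uobj)
    moreover have "(\<lambda>x. x) \<in> mod_hom k (obj U q) (obj W q)"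
      by (rule mod_homI) (use submodule_subset[OF low_submodule[OF W]] in \<open>auto simp: Uobj\<close>)
    from mod_hom_finsum[OF cmodule_module[OF U] cmodule_module[OF W] this aU]
    have "(\<Oplus>\<^bsub>obj U q\<^esub>S\<in>subsets q. ?a S) = (\<Oplus>\<^bsub>obj W q\<^esub>S\<in>subsets q. ?a S)" .
    ultimately have "(\<Oplus>\<^bsub>obj W q\<^esub>S\<in>subsets q. ?a S) \<in> low W i q" by simp
    from summands_low[OF W inj finite_subsets _ _ vW this]
    have "v S \<in> low W i i" if "S \<in> subsets q" for S using that rep by (simp add: subsets_def)
    then show "\<forall>S\<in>subsets q. t S = \<zero>\<^bsub>obj Q i\<^esub>" using \<pi>0 v by metis
  qed
qed

text \<open>Layer \<open>i\<close> is induced from its own value in degree \<open>i\<close>, which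
  is \<open>H_0(W)\<close> in that degree; the bound on derivatives makes the chain reach
  \<open>W\<close> after \<open>D\<close> steps.\<close>

lemma filtered_if_injective:
  fixes W :: "('k, 'g, 'a) cmod"
  assumes W: "cmodule G k W" and inj: "injective_from 0 W" and deg: "degree_less D W"
  shows "filtered G k W"
  unfolding filtered_def
proof (rule exI[of _ D], rule exI[of _ "low W"], intro conjI allI impI)
  show "low W 0 = (\<lambda>n. {\<zero>\<^bsub>obj W n\<^esub>})" by (rule ext) (rule low_0[OF W])
  show "low W D = (\<lambda>n. full W n)" by (rule ext) (rule low_full[OF W deg])
next
  fix i
  show "csubmodule G k W (low W i)" by (rule low_csubmodule[OF W])
  show "low W i n \<subseteq> low W (Suc i) n" for n by (rule low_mono[OF W])
  let ?Q = "cmod_quot (cmod_restrict W (low W (Suc i))) (low W i)"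
  show "\<exists>m (T :: ('k, 'a set) module) \<rho>. group_rep G k m T \<rho> \<and> cmod_iso G k ?Q (induced G k m T \<rho>)"
    using filtration_quotient[OF W inj, of i] by (intro exI conjI)
qed

end

theorem theorem3p8:
  fixes G :: "('g, 'x) monoid_scheme"
    and k :: "('k, 'y) ring_scheme"
    and V :: "('k, 'g, 'a) cmod"
  assumes "group G"
    and "cring k"
    and "cmodule G k V"
    and "presented_in_finite_degrees G k V"
  shows "\<exists>N. \<forall>n\<ge>N. filtered G k ((cmod_shift G ^^ n) V)"
proof -
  interpret FIG G k by (rule FIG.intro[OF assms(1,2)])
  obtain N D where tf: "\<And>a n. n \<ge> N \<Longrightarrow> torsionfree V a n"
    and gen: "\<And>a n. a \<ge> D \<Longrightarrow> full V (n + a) \<subseteq> face_sum G V (full V) a n"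
    using torsionfree_if_presented[OF assms(3,4)] by blast
  have "filtered G k ((cmod_shift G ^^ n) V)" if n: "n \<ge> N" for n
  proof -
    \<comment> \<open>Each shift lowers the injectivity bound by one and keeps \<open>D\<close>; for
      \<open>n \<ge> N\<close> the bound \<open>N - n\<close> is 0.\<close>
    have "cmodule G k ((cmod_shift G ^^ n) V)" "injective_from (N - n) ((cmod_shift G ^^ n) V)"
      "degree_less D ((cmod_shift G ^^ n) V)"
      using iterated_shift[OF assms(3) injective_from_if_torsionfree[OF assms(3) tf]
        degree_less_if_generated[OF assms(3) gen]] by blast+
    then show ?thesis using n by (intro filtered_if_injective[where D = D]) simp_all
  qed
  then show ?thesis by blast
qed

end
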